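(* Let $Y$ be a completely metrizable space. The following are equivalent: (i) $Y$ is connected and locally arcwise connected; (ii) $\mathrm{K}_1(X,Y)\cap\Sigma^f(X,Y)=\mathrm{B}_1(X,Y)$ for every topological space $X$; (iii) $\mathrm{H}_1([0,1],Y)=\mathrm{B}_1([0,1],Y)$.
   Context: Functionally closed/open sets: zero sets of continuous functions $X\to[0,1]$, resp. their complements; functionally $F_\sigma$: countable union of functionally closed sets. $\mathrm{H}_1(X,Y)$: mappings $f:X\to Y$ with $f^{-1}(V)$ an $F_\sigma$-set for every open $V\subseteq Y$. $\mathrm{K}_1(X,Y)$: mappings with $f^{-1}(V)$ functionally $F_\sigma$ for every open $V\subseteq Y$. A family $(A_i:i\in I)$ of subsets of $X$ is strongly functionally discrete (sfd) if there is a discrete family $(U_i:i\in I)$ of functionally open sets with $\overline{A_i}\subseteq U_i$ for all $i$; $\sigma$-sfd: countable union of sfd families. A family $\mathcal B$ is a base for $f$ if each $f^{-1}(V)$, $V$ open, is a union of members of $\mathcal B$. $\Sigma^f(X,Y)$: mappings having a $\sigma$-sfd base. $\mathrm{B}_1(X,Y)$: pointwise limits of sequences of continuous mappings $X\to Y$. *)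

theory Defs
  imports "HOL-Analysis.Analysis"
begin

definition arc_connectedin :: "'a topology \<Rightarrow> 'a set \<Rightarrow> bool" where
  "arc_connectedin Y S \<longleftrightarrow> S \<subseteq> topspace Y \<and>
     (\<forall>x\<in>S. \<forall>y\<in>S. x \<noteq> y \<longrightarrow>
        (\<exists>g. embedding_map (top_of_set {0..1::real}) (subtopology Y S) g \<and> g 0 = x \<and> g 1 = y))"

definition locally_arc_connected_space :: "'a topology \<Rightarrow> bool" where
  "locally_arc_connected_space Y \<equiv> neighbourhood_base_of (arc_connectedin Y) Y"

definition functionally_closed_in :: "'a topology \<Rightarrow> 'a set \<Rightarrow> bool" where
  "functionally_closed_in X A \<longleftrightarrow>
     (\<exists>g. continuous_map X (top_of_set {0..1::real}) g \<and> A = {x \<in> topspace X. g x = 0})"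

definition functionally_open_in :: "'a topology \<Rightarrow> 'a set \<Rightarrow> bool" where
  "functionally_open_in X U \<longleftrightarrow> U \<subseteq> topspace X \<and> functionally_closed_in X (topspace X - U)"

definition functionally_fsigma_in :: "'a topology \<Rightarrow> 'a set \<Rightarrow> bool" where
  "functionally_fsigma_in X \<equiv> countable union_of functionally_closed_in X"

definition H1 :: "'a topology \<Rightarrow> 'b topology \<Rightarrow> ('a \<Rightarrow> 'b) set" where
  "H1 X Y = {f. f \<in> topspace X \<rightarrow> topspace Y \<and>
     (\<forall>V. openin Y V \<longrightarrow> fsigma_in X {x \<in> topspace X. f x \<in> V})}"

definition K1 :: "'a topology \<Rightarrow> 'b topology \<Rightarrow> ('a \<Rightarrow> 'b) set" where
  "K1 X Y = {f. f \<in> topspace X \<rightarrow> topspace Y \<and>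
     (\<forall>V. openin Y V \<longrightarrow> functionally_fsigma_in X {x \<in> topspace X. f x \<in> V})}"

definition B1 :: "'a topology \<Rightarrow> 'b topology \<Rightarrow> ('a \<Rightarrow> 'b) set" where
  "B1 X Y = {f. f \<in> topspace X \<rightarrow> topspace Y \<and>
     (\<exists>fn :: nat \<Rightarrow> 'a \<Rightarrow> 'b. (\<forall>n. continuous_map X Y (fn n)) \<and>
        (\<forall>x \<in> topspace X. limitin Y (\<lambda>n. fn n x) (f x) sequentially))}"

definition discrete_family_in :: "'a topology \<Rightarrow> 'i set \<Rightarrow> ('i \<Rightarrow> 'a set) \<Rightarrow> bool" where
  "discrete_family_in X I U \<longleftrightarrow>
     (\<forall>x \<in> topspace X. \<exists>W. openin X W \<and> x \<in> W \<and>
        (\<forall>i\<in>I. \<forall>j\<in>I. W \<inter> U i \<noteq> {} \<and> W \<inter> U j \<noteq> {} \<longrightarrow> i = j))"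

definition sfd_family_in :: "'a topology \<Rightarrow> 'i set \<Rightarrow> ('i \<Rightarrow> 'a set) \<Rightarrow> bool" where
  "sfd_family_in X I A \<longleftrightarrow>
     (\<exists>U. discrete_family_in X I U \<and> (\<forall>i\<in>I. functionally_open_in X (U i)) \<and>
          (\<forall>i\<in>I. X closure_of (A i) \<subseteq> U i))"

definition sigma_sfd_in :: "'a topology \<Rightarrow> 'a set set \<Rightarrow> bool" where
  "sigma_sfd_in X \<B> \<longleftrightarrow>
     (\<exists>\<B>n :: nat \<Rightarrow> 'a set set. \<B> = (\<Union>n. \<B>n n) \<and> (\<forall>n. sfd_family_in X (\<B>n n) id))"

definition is_base_for :: "'a topology \<Rightarrow> 'b topology \<Rightarrow> 'a set set \<Rightarrow> ('a \<Rightarrow> 'b) \<Rightarrow> bool" where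
  "is_base_for X Y \<B> f \<longleftrightarrow>
     (\<forall>V. openin Y V \<longrightarrow> (\<exists>\<C> \<subseteq> \<B>. \<Union>\<C> = {x \<in> topspace X. f x \<in> V}))"

definition Sigma_f :: "'a topology \<Rightarrow> 'b topology \<Rightarrow> ('a \<Rightarrow> 'b) set" where
  "Sigma_f X Y = {f. f \<in> topspace X \<rightarrow> topspace Y \<and>
     (\<exists>\<B>. sigma_sfd_in X \<B> \<and> is_base_for X Y \<B> f)}"

end

theory Submission
  imports Defs "HOL-Probability.Discrete_Topology"
begin

text \<open>
  For \<open>K1 \<inter> Sigma_f \<subseteq> B1\<close>: a \<open>\<sigma>\<close>-sfd base and the functionally closed pieces of the preimages of balls give
  maps uniformly close to the given one that are pointwise limits, in the discrete topology, of labels that are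
  locally constant on cozero sets. Labels can be refined: the next label is a smaller open path-connected set inside the previous one, so
  the continuous approximation for one level is corrected to the next by running along a path that stays in
  the small set of the previous level. A diagonal sequence converges pointwise.

  For the inclusion of \<open>H1\<close> on the interval in \<open>Sigma_f\<close>: by a Baire category argument a colouring of a closed set
  all of whose colour unions are \<open>F\<^sub>\<sigma>\<close> has only countably many colours, so ranges are separable.

  For the converse: a function that equals \<open>y\<close> off the rationals and takes values converging to \<open>y\<close> along an enumeration of
  the rationals is in \<open>H1\<close>. If it is a pointwise limit of paths, Baire category confines these
  paths to a small ball on some interval, so nearby points are not separated from \<open>y\<close> by clopen subsets of small
  neighbourhoods. Hence quasi-components of open sets are open, \<open>Y\<close> is locally connected, and completeness yields
  paths, then arcs.
\<close>

section \<open>Locally constant labels\<close>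

text \<open>A path cannot in general be chosen continuously in its endpoints, and the target has no
  convex structure in which to average. Hence paths are chosen once per pair of labels, and whatever
  decides which path is used has to be a locally constant function of the position. This is why
  labels are treated as points of a discrete space, why every comparison of labels is a test on
  finitely many guessed ones, and why each guess carries a continuous weight that vanishes where the
  guess is not locally constant.

  At a given point a guess is right only from some stage on, and that stage depends on the level of
  the label. The correction at level k > 0 is therefore bounded by \<open>(1/2) ^ k\<close> whether
  or not the guesses are right; on the diagonal, wrong guesses at high levels then do no harm.

  On the unit interval closed sets are zero sets, so \<open>H1\<close> and \<open>K1\<close> agree
  there. Together with the inclusion in \<open>Sigma_f\<close> this makes (iii) the instance of (ii)
  at \<open>[0,1]\<close>.\<close>

lemma continuous_map_locally_coincide:
  assumes "\<And>x. x \<in> topspace X \<Longrightarrow>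
     \<exists>W h. openin X W \<and> x \<in> W \<and> continuous_map X Y h \<and> (\<forall>z\<in>W. g z = h z)"
  shows "continuous_map X Y g"
  unfolding continuous_map_def
proof (intro conjI allI impI)
  show "g \<in> topspace X \<rightarrow> topspace Y"
  proof
    fix x assume x: "x \<in> topspace X"
    obtain W h where "x \<in> W" "continuous_map X Y h" "\<forall>z\<in>W. g z = h z"
      using assms[OF x] by blast
    with x show "g x \<in> topspace Y" by (simp add: continuous_map_def Pi_iff)
  qed
next
  fix U assume U: "openin Y U"
  show "openin X {x \<in> topspace X. g x \<in> U}"
  proof (subst openin_subopen, clarify)
    fix x assume x: "x \<in> topspace X" "g x \<in> U"
    obtain W h where W: "openin X W" "x \<in> W" "continuous_map X Y h" "\<forall>z\<in>W. g z = h z"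
      using assms[OF x(1)] by blast
    let ?T = "W \<inter> {z \<in> topspace X. h z \<in> U}"
    have "openin X ?T" using W U openin_continuous_map_preimage by blast
    moreover have "x \<in> ?T" using W x by auto
    moreover have "?T \<subseteq> {x \<in> topspace X. g x \<in> U}" using W by auto
    ultimately show "\<exists>T. openin X T \<and> x \<in> T \<and> T \<subseteq> {x \<in> topspace X. g x \<in> U}" by blast
  qed
qed

definition clamp01 :: "real \<Rightarrow> real" where
  "clamp01 t = max 0 (min 1 t)"

lemma clamp01_simps [simp]:
  "0 \<le> clamp01 t" "clamp01 t \<le> 1" "t \<le> 0 \<Longrightarrow> clamp01 t = 0" "1 \<le> t \<Longrightarrow> clamp01 t = 1"
  "0 < clamp01 t \<longleftrightarrow> 0 < t"
  by (auto simp: clamp01_def)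

lemma continuous_map_clamp01:
  "continuous_map X euclideanreal f \<Longrightarrow> continuous_map X euclideanreal (\<lambda>x. clamp01 (f x))"
  unfolding clamp01_def by (intro continuous_intros) auto

text \<open>In other words, \<open>l\<close> is continuous into a discrete space on the cozero set
  of \<open>p\<close>. The region where \<open>p\<close> is 1 is where the label is to be trusted;
  the collar where \<open>p\<close> lies strictly between 0 and 1 is room for a continuous
  transition.\<close>

definition patch :: "'a topology \<Rightarrow> ('a \<Rightarrow> real) \<Rightarrow> ('a \<Rightarrow> 'l) \<Rightarrow> bool" where
  "patch X p l \<longleftrightarrow> continuous_map X euclideanreal p \<and> (\<forall>x \<in> topspace X. 0 \<le> p x \<and> p x \<le> 1) \<and>
     (\<forall>x \<in> topspace X. 0 < p x \<longrightarrow> (\<exists>W c. openin X W \<and> x \<in> W \<and> (\<forall>z\<in>W. l z = c)))"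

text \<open>Convergence in a discrete space is eventual equality, and the weight has to become
  exactly 1 as well. Nothing is uniform: the stage from which the guess is right depends on the
  point.\<close>

definition label_limit :: "'a topology \<Rightarrow> ('a \<Rightarrow> 'l) \<Rightarrow> bool" where
  "label_limit X lam \<longleftrightarrow> (\<exists>p l. (\<forall>N. patch X (p N) (l N)) \<and>
     (\<forall>x \<in> topspace X. \<forall>\<^sub>F N in sequentially. p N x = 1 \<and> l N x = lam x))"

lemma patch_continuous: "patch X p l \<Longrightarrow> continuous_map X euclideanreal p"
  and patch_bounds: "patch X p l \<Longrightarrow> x \<in> topspace X \<Longrightarrow> 0 \<le> p x \<and> p x \<le> 1"
  by (auto simp: patch_def)

lemma patch_label:
  assumes "patch X p l" "x \<in> topspace X" "0 < p x"
  obtains W c where "openin X W" "x \<in> W" "\<forall>z\<in>W. l z = c"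
  using assms unfolding patch_def by (elim conjE) (drule (1) bspec, drule (1) mp, elim exE conjE, rule that)

lemma label_limitE:
  assumes "label_limit X lam"
  obtains p l where "\<forall>N. patch X (p N) (l N)"
    "\<forall>x \<in> topspace X. \<forall>\<^sub>F N in sequentially. p N x = 1 \<and> l N x = lam x"
  using assms unfolding label_limit_def by (elim exE conjE)

lemma patch_shrink:
  assumes "patch X p l" "continuous_map X euclideanreal q"
    "\<And>x. x \<in> topspace X \<Longrightarrow> 0 \<le> q x \<and> q x \<le> 1"
    "\<And>x. x \<in> topspace X \<Longrightarrow> 0 < q x \<Longrightarrow> 0 < p x"
  shows "patch X q l"
  using assms unfolding patch_def by auto

lemma patch_Pair:
  assumes "patch X p l" "patch X q m"
  shows "patch X (\<lambda>x. p x * q x) (\<lambda>x. (l x, m x))"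
  unfolding patch_def
proof (intro conjI ballI impI)
  show "continuous_map X euclideanreal (\<lambda>x. p x * q x)"
    using assms by (intro continuous_intros patch_continuous)
next
  fix x assume x: "x \<in> topspace X"
  note b = patch_bounds[OF assms(1) x] patch_bounds[OF assms(2) x]
  show "0 \<le> p x * q x" "p x * q x \<le> 1" using b by (auto intro: mult_le_one)
  assume "0 < p x * q x"
  then have "0 < p x" "0 < q x" using b by (auto simp: zero_less_mult_iff)
  obtain W c where "openin X W" "x \<in> W" "\<forall>z\<in>W. l z = c"
    using patch_label[OF assms(1) x \<open>0 < p x\<close>] by blast
  moreover obtain V c' where "openin X V" "x \<in> V" "\<forall>z\<in>V. m z = c'"
    using patch_label[OF assms(2) x \<open>0 < q x\<close>] by blast
  ultimately show "\<exists>W c. openin X W \<and> x \<in> W \<and> (\<forall>z\<in>W. (l z, m z) = c)"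
    by (intro exI[of _ "W \<inter> V"]) auto
qed

lemma patch_map:
  assumes "patch X p l"
  shows "patch X p (\<lambda>x. f (l x))"
  unfolding patch_def
proof (intro conjI ballI impI)
  fix x assume x: "x \<in> topspace X" "0 < p x"
  obtain W c where "openin X W" "x \<in> W" "\<forall>z\<in>W. l z = c"
    using patch_label[OF assms x] by blast
  then show "\<exists>W c. openin X W \<and> x \<in> W \<and> (\<forall>z\<in>W. f (l z) = c)"
    by (intro exI[of _ W]) auto
qed (use patch_continuous[OF assms] patch_bounds[OF assms] in auto)

lemma continuous_map_real_iff:
  "continuous_map X euclideanreal f \<longleftrightarrow>
     (\<forall>x \<in> topspace X. \<forall>e>0. \<exists>U. openin X U \<and> x \<in> U \<and> (\<forall>y\<in>U. \<bar>f y - f x\<bar> < e))"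
  using Met_TC.continuous_map_to_metric[of X f] by (simp add: dist_real_def abs_minus_commute)

text \<open>Where \<open>p\<close> is positive, \<open>R (l x)\<close> is locally constant; at a
  zero of \<open>p\<close> the new weight is squeezed between 0 and \<open>p\<close>. So cutting off
  along a condition on the labels keeps the weight continuous.\<close>

lemma patch_restrict:
  assumes "patch X p l"
  shows "patch X (\<lambda>x. if R (l x) then p x else 0) l"
proof (rule patch_shrink[OF assms])
  show "continuous_map X euclideanreal (\<lambda>x. if R (l x) then p x else 0)"
    unfolding continuous_map_real_iff
  proof (intro ballI allI impI)
    fix x and e :: real assume x: "x \<in> topspace X" and e: "e > 0"
    obtain U where U: "openin X U" "x \<in> U" "\<forall>y\<in>U. \<bar>p y - p x\<bar> < e"
      using patch_continuous[OF assms] x e unfolding continuous_map_real_iff by blast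
    show "\<exists>U. openin X U \<and> x \<in> U \<and> (\<forall>y\<in>U. \<bar>(if R (l y) then p y else 0) - (if R (l x) then p x else 0)\<bar> < e)"
    proof (cases "p x > 0")
      case True
      obtain W c where "openin X W" "x \<in> W" "\<forall>z\<in>W. l z = c"
        using patch_label[OF assms x True] by blast
      then show ?thesis using U e by (intro exI[of _ "U \<inter> W"]) auto
    next
      case False
      then have "p x = 0" using patch_bounds[OF assms x] by auto
      then show ?thesis using U e by (intro exI[of _ U]) auto
    qed
  qed
next
  fix x assume x: "x \<in> topspace X"
  show "0 \<le> (if R (l x) then p x else 0) \<and> (if R (l x) then p x else 0) \<le> 1"
    using patch_bounds[OF assms x] by simp
  show "0 < p x" if "0 < (if R (l x) then p x else 0)"
    using that by (simp split: if_split_asm)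
qed

text \<open>Lists are used because the number of components varies while all labels must have one
  type.\<close>

lemma patch_list:
  assumes "\<And>i. i < (n::nat) \<Longrightarrow> patch X (p i) (l i)"
  shows "patch X (\<lambda>x. \<Prod>i<n. p i x) (\<lambda>x. map (\<lambda>i. l i x) [0..<n])"
  using assms
proof (induction n)
  case 0
  show ?case unfolding patch_def
    by (intro conjI ballI impI exI[of _ "topspace X"] exI[of _ "[]"]) simp_all
next
  case (Suc n)
  have "patch X (\<lambda>x. \<Prod>i<n. p i x) (\<lambda>x. map (\<lambda>i. l i x) [0..<n])"
    using Suc.prems by (intro Suc.IH) simp
  moreover have "patch X (p n) (l n)" using Suc.prems by simp
  ultimately have "patch X (\<lambda>x. (\<Prod>i<n. p i x) * p n x) (\<lambda>x. (map (\<lambda>i. l i x) [0..<n], l n x))"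
    by (rule patch_Pair)
  from patch_map[OF this, where f = "\<lambda>(a, b). a @ [b]"] show ?case by simp
qed

text \<open>At each stage at most one of the competing guesses is active at a point, so the weights
  can be added and the active index is locally constant. Summing only up to \<open>N\<close> keeps
  the sum finite and hence continuous; the guess with index \<open>n\<close> takes part from stage
  \<open>n\<close> on.\<close>

lemma label_limit_glue:
  fixes p :: "nat \<Rightarrow> nat \<Rightarrow> 'a \<Rightarrow> real"
  assumes patch: "\<And>n N. patch X (p n N) (l n N)"
    and uniq: "\<And>n n' N x. \<lbrakk>x \<in> topspace X; 0 < p n N x; 0 < p n' N x\<rbrakk> \<Longrightarrow> n = n'"
    and ev: "\<And>x. x \<in> topspace X \<Longrightarrow> \<exists>n. \<forall>\<^sub>F N in sequentially. p n N x = 1 \<and> l n N x = lam x"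
  shows "label_limit X lam"
proof -
  define q where "q N x = (\<Sum>n\<le>N. p n N x)" for N x
  define m where "m N x = l (THE n. 0 < p n N x) N x" for N x
  have the: "(THE n. 0 < p n N x) = n" if x: "x \<in> topspace X" and n: "0 < p n N x" for n N x
  proof (rule the_equality)
    show "0 < p n N x" by (rule n)
    show "n' = n" if "0 < p n' N x" for n' by (rule uniq[OF x that n])
  qed
  have q1: "q N x = p n N x" if x: "x \<in> topspace X" and n: "0 < p n N x" "n \<le> N" for n N x
  proof -
    have "p n' N x = 0" if "n' \<noteq> n" for n'
    proof (rule ccontr)
      assume "p n' N x \<noteq> 0"
      then have "0 < p n' N x" using patch_bounds[OF patch x, of n' N] by simp
      then show False using uniq[OF x _ n(1)] that by blast
    qed
    then have "(\<Sum>n\<le>N. p n N x) = (\<Sum>n'\<in>{n}. p n' N x)"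
      using n by (intro sum.mono_neutral_right) simp_all
    then show ?thesis by (simp add: q_def)
  qed
  have q0: "\<exists>n\<le>N. 0 < p n N x" if x: "x \<in> topspace X" and q: "q N x \<noteq> 0" for N x
  proof (rule ccontr)
    assume "\<not> ?thesis"
    then have "p n N x = 0" if "n \<le> N" for n
      using that patch_bounds[OF patch x, of n N] by (simp add: less_le)
    then show False using q by (simp add: q_def)
  qed
  have "patch X (q N) (m N)" for N
    unfolding patch_def
  proof (intro conjI ballI impI)
    show "continuous_map X euclideanreal (q N)"
      unfolding q_def using patch_continuous[OF patch] by (intro continuous_intros) auto
    fix x assume x: "x \<in> topspace X"
    show "0 \<le> q N x" "q N x \<le> 1"
    proof -
      have "0 \<le> q N x \<and> q N x \<le> 1"
      proof (cases "q N x = 0")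
        case False
        then obtain n where "n \<le> N" "0 < p n N x" using q0[OF x] by blast
        then show ?thesis using q1[OF x] patch_bounds[OF patch x] by simp
      qed simp
      then show "0 \<le> q N x" "q N x \<le> 1" by simp_all
    qed
    assume "0 < q N x"
    then obtain n where n: "n \<le> N" "0 < p n N x" using q0[OF x, of N] by (metis less_irrefl)
    obtain W c where W: "openin X W" "x \<in> W" "\<forall>z\<in>W. l n N z = c"
      using patch_label[OF patch x n(2)] by blast
    let ?V = "W \<inter> {z \<in> topspace X. p n N z \<in> {0<..}}"
    have "openin X ?V"
      using W openin_continuous_map_preimage[OF patch_continuous[OF patch[of n N]], of "{0<..}"] by auto
    moreover have "x \<in> ?V" using W x n by auto
    moreover have "m N z = c" if "z \<in> ?V" for z
    proof -
      have "(THE n. 0 < p n N z) = n" using that by (intro the) auto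
      then show ?thesis using W that by (simp add: m_def)
    qed
    ultimately show "\<exists>W c. openin X W \<and> x \<in> W \<and> (\<forall>z\<in>W. m N z = c)" by (intro exI[of _ ?V] exI[of _ c] conjI ballI)
  qed
  moreover have "\<forall>\<^sub>F N in sequentially. q N x = 1 \<and> m N x = lam x" if x: "x \<in> topspace X" for x
  proof -
    obtain n where n: "\<forall>\<^sub>F N in sequentially. p n N x = 1 \<and> l n N x = lam x" using ev[OF x] by blast
    show ?thesis
      using n eventually_ge_at_top[of n]
    proof eventually_elim
      case (elim N)
      then show ?case using q1[OF x, of n N] the[OF x, of n N] by (simp add: m_def)
    qed
  qed
  ultimately show ?thesis unfolding label_limit_def by (intro exI[of _ q] exI[of _ m]) simp
qed

text \<open>Being the least index with \<open>p n x = 1\<close> is not an open condition, so it does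
  not give a locally constant label directly. A threshold just below 1, moving up with the stage,
  separates the competitors at each stage and is correct in the limit.\<close>

lemma label_limit_least_patch:
  fixes p :: "nat \<Rightarrow> 'a \<Rightarrow> real"
  assumes patch: "\<And>n. patch X (p n) (l n)"
    and cover: "\<And>x. x \<in> topspace X \<Longrightarrow> \<exists>n. p n x = 1"
  shows "label_limit X (\<lambda>x. l (LEAST n. p n x = 1) x)"
proof -
  \<comment> \<open>Positive only if \<open>p n x\<close> lies above
    \<open>1 - 1 / (2 * (N + 1))\<close> and all earlier \<open>p m x\<close> lie below it, which
    excludes two indices at once. Equal to 1 as soon as \<open>p n x = 1\<close> and the earlier
    values are at most \<open>1 - 1 / (N + 1)\<close>.\<close>
  define q where "q n N x = clamp01 (2 * real (Suc N) * (p n x - 1) + 1) *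
       (\<Prod>m<n. clamp01 (2 * real (Suc N) * (1 - p m x) - 1))" for n N x
  have pos1: "p n x > 1 - 1 / (2 * real (Suc N))" if "q n N x > 0" for n N x
  proof -
    have "clamp01 (2 * real (Suc N) * (p n x - 1) + 1) > 0"
      using that clamp01_simps(1)[of "2 * real (Suc N) * (p n x - 1) + 1"] unfolding q_def
      by (auto simp: less_le simp del: clamp01_simps)
    then have "2 * real (Suc N) * (p n x - 1) + 1 > 0" by simp
    then show ?thesis by (simp add: field_simps del: of_nat_Suc)
  qed
  have pos2: "p m x < 1 - 1 / (2 * real (Suc N))" if "q n N x > 0" "m < n" for m n N x
  proof -
    have "clamp01 (2 * real (Suc N) * (1 - p m x) - 1) \<noteq> 0"
    proof
      assume "clamp01 (2 * real (Suc N) * (1 - p m x) - 1) = 0"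
      then have "(\<Prod>m<n. clamp01 (2 * real (Suc N) * (1 - p m x) - 1)) = 0"
        using \<open>m < n\<close> by (intro prod_zero) (auto intro!: bexI[of _ m])
      then show False using that(1) unfolding q_def by (metis less_irrefl mult_zero_right)
    qed
    then have "2 * real (Suc N) * (1 - p m x) - 1 > 0"
      using clamp01_simps(3) not_le by blast
    then show ?thesis by (simp add: field_simps del: of_nat_Suc)
  qed
  have patch_q: "patch X (q n N) (l n)" for n N
  proof (rule patch_shrink[OF patch])
    show "continuous_map X euclideanreal (q n N)"
      unfolding q_def
      by (intro continuous_map_real_mult continuous_map_prod continuous_map_clamp01 continuous_map_add continuous_map_diff
           continuous_map_const[THEN iffD2] patch_continuous[OF patch]) auto
    fix x assume x: "x \<in> topspace X"
    show "0 \<le> q n N x \<and> q n N x \<le> 1"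
      unfolding q_def by (auto intro!: mult_le_one mult_nonneg_nonneg prod_nonneg prod_le_1)
    assume "0 < q n N x"
    then have "p n x > 1 - 1 / (2 * real (Suc N))" by (rule pos1)
    moreover have "1 / (2 * real (Suc N)) < 1" by simp
    ultimately show "0 < p n x" by linarith
  qed
  have uniq: "n = n'" if "x \<in> topspace X" "0 < q n N x" "0 < q n' N x" for n n' N x
    using pos1[OF that(2)] pos1[OF that(3)] pos2[OF that(2)] pos2[OF that(3)]
    by (metis less_asym linorder_neqE_nat)
  have ev: "\<exists>n. \<forall>\<^sub>F N in sequentially. q n N x = 1 \<and> l n x = l (LEAST n. p n x = 1) x"
    if x: "x \<in> topspace X" for x
  proof (intro exI[of _ "LEAST n. p n x = 1"])
    define n where "n = (LEAST n. p n x = 1)"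
    have n1: "p n x = 1" unfolding n_def using cover[OF x] by (metis (mono_tags, lifting) LeastI_ex)
    have less: "p m x < 1" if "m < n" for m
      using not_less_Least[of m "\<lambda>n. p n x = 1"] that patch_bounds[OF patch x, of m] unfolding n_def by force
    have "\<forall>\<^sub>F N in sequentially. \<forall>m\<in>{..<n}. 1 \<le> real (Suc N) * (1 - p m x)"
    proof (intro eventually_ball_finite ballI)
      fix m assume "m \<in> {..<n}"
      then have "0 < 1 - p m x" using less by auto
      then obtain K :: nat where "1 / (1 - p m x) < real K" using reals_Archimedean2 by blast
      then have K: "1 < real K * (1 - p m x)" using \<open>0 < 1 - p m x\<close> by (simp add: field_simps)
      show "\<forall>\<^sub>F N in sequentially. 1 \<le> real (Suc N) * (1 - p m x)"
        using eventually_ge_at_top[of K]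
      proof eventually_elim
        case (elim N)
        then have "real K * (1 - p m x) \<le> real (Suc N) * (1 - p m x)"
          using \<open>0 < 1 - p m x\<close> by (intro mult_right_mono) auto
        then show ?case using K by linarith
      qed
    qed auto
    then have "\<forall>\<^sub>F N in sequentially. q n N x = 1"
    proof eventually_elim
      case (elim N)
      have "clamp01 (2 * real (Suc N) * (1 - p m x) - 1) = 1" if "m < n" for m
        using elim that by (intro clamp01_simps) (auto simp: mult.assoc simp del: of_nat_Suc)
      then show ?case using n1 by (simp add: q_def)
    qed
    then show "\<forall>\<^sub>F N in sequentially. q (LEAST n. p n x = 1) N x = 1 \<and>
        l (LEAST n. p n x = 1) x = l (LEAST n. p n x = 1) x"
      by (simp add: n_def)
  qed
  show ?thesis
    by (rule label_limit_glue[where p = q and l = "\<lambda>n N. l n", OF patch_q uniq ev])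
qed

text \<open>Whether \<open>j\<close> is least involves only \<open>lam x\<close> and the first
  \<open>j + 1\<close> labels, so it can be tested at stage \<open>N\<close> on finitely many
  guesses, and such a test is locally constant.\<close>

lemma label_limit_least:
  fixes mu :: "nat \<Rightarrow> 'a \<Rightarrow> 'm"
  assumes lam: "label_limit X lam" and mu: "\<And>j. label_limit X (mu j)"
    and ex: "\<And>x. x \<in> topspace X \<Longrightarrow> \<exists>j. P (lam x) j (mu j x)"
  shows "label_limit X (\<lambda>x. let j = LEAST j. P (lam x) j (mu j x) in F (lam x) j (mu j x))"
proof -
  obtain p l where p: "\<And>N. patch X (p N) (l N)"
    and pl: "\<And>x. x \<in> topspace X \<Longrightarrow> \<forall>\<^sub>F N in sequentially. p N x = 1 \<and> l N x = lam x"
    using label_limitE[OF lam] by metis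
  have "\<forall>j. \<exists>p l. (\<forall>N. patch X (p N) (l N)) \<and>
     (\<forall>x \<in> topspace X. \<forall>\<^sub>F N in sequentially. p N x = 1 \<and> l N x = mu j x)"
    using mu by (simp only: label_limit_def simp_thms)
  then obtain q m where qm0: "\<forall>j. (\<forall>N. patch X (q j N) (m j N)) \<and>
     (\<forall>x \<in> topspace X. \<forall>\<^sub>F N in sequentially. q j N x = 1 \<and> m j N x = mu j x)"
    unfolding choice_iff by (elim exE)
  then have q: "\<And>j N. patch X (q j N) (m j N)"
    and qm: "\<And>j x. x \<in> topspace X \<Longrightarrow> \<forall>\<^sub>F N in sequentially. q j N x = 1 \<and> m j N x = mu j x"
    by simp_all
  \<comment> \<open>Minimality of \<open>j\<close> as judged from the guessed labels. For different
    \<open>j\<close> these tests exclude each other even when the guesses are wrong, which is the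
    disjointness that \<open>label_limit_glue\<close> asks for.\<close>
  define R where "R j t \<longleftrightarrow> P (fst t) j (snd t ! j) \<and> (\<forall>i<j. \<not> P (fst t) i (snd t ! i))"
    for j and t :: "'b \<times> 'm list"
  define L where "L j N x = (l N x, map (\<lambda>i. m i N x) [0..<Suc j])" for j N x
  define r where "r j N x = (if R j (L j N x) then p N x * (\<Prod>i<Suc j. q i N x) else 0)" for j N x
  have nth: "map (\<lambda>i. m i N x) [0..<Suc j] ! i = m i N x" if "i \<le> j" for i j N x
    using that by (simp del: upt_Suc)
  have RL: "R j (L j N x) \<longleftrightarrow> P (l N x) j (m j N x) \<and> (\<forall>i<j. \<not> P (l N x) i (m i N x))" for j N x
    unfolding R_def L_def using nth by (auto simp del: upt_Suc)
  have patch_r: "patch X (r j N) (L j N)" for j N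
    unfolding r_def using patch_restrict[OF patch_Pair[OF p[of N] patch_list[of "Suc j" X "\<lambda>i. q i N" "\<lambda>i. m i N"]], of "R j"] q
    unfolding L_def by blast
  show ?thesis
  proof (rule label_limit_glue[where p = r and l = "\<lambda>j N x. F (fst (L j N x)) j (snd (L j N x) ! j)"])
    show "patch X (r j N) (\<lambda>x. F (fst (L j N x)) j (snd (L j N x) ! j))" for j N
      using patch_map[OF patch_r, where f = "\<lambda>t. F (fst t) j (snd t ! j)"] .
    show "j = j'" if "x \<in> topspace X" "0 < r j N x" "0 < r j' N x" for j j' N x
    proof -
      have "R j (L j N x)" "R j' (L j' N x)" using that unfolding r_def by (metis less_irrefl)+
      then show ?thesis unfolding RL by (metis linorder_neqE_nat)
    qed
    show "\<exists>j. \<forall>\<^sub>F N in sequentially. r j N x = 1 \<and> F (fst (L j N x)) j (snd (L j N x) ! j) =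
       (let j = LEAST j. P (lam x) j (mu j x) in F (lam x) j (mu j x))" if x: "x \<in> topspace X" for x
    proof (intro exI)
      define j where "j = (LEAST j. P (lam x) j (mu j x))"
      have j: "P (lam x) j (mu j x)" "\<And>i. i < j \<Longrightarrow> \<not> P (lam x) i (mu i x)"
        unfolding j_def using LeastI_ex[OF ex[OF x]] not_less_Least by auto
      have "\<forall>\<^sub>F N in sequentially. \<forall>i\<in>{..j}. q i N x = 1 \<and> m i N x = mu i x"
        using qm[OF x] by (intro eventually_ball_finite) auto
      with pl[OF x] show "\<forall>\<^sub>F N in sequentially. r j N x = 1 \<and> F (fst (L j N x)) j (snd (L j N x) ! j) =
       (let j = LEAST j. P (lam x) j (mu j x) in F (lam x) j (mu j x))"
      proof eventually_elim
        case (elim N)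
        have lN: "p N x = 1" "l N x = lam x" using elim by blast+
        have mN: "q i N x = 1" "m i N x = mu i x" if "i \<le> j" for i using elim that by blast+
        have "R j (L j N x)" unfolding RL lN using j mN(2) by (metis less_imp_le order_refl)
        moreover have "(\<Prod>i<Suc j. q i N x) = 1" using mN(1) by (intro prod.neutral) auto
        ultimately have "r j N x = 1" unfolding r_def lN by simp
        moreover have "snd (L j N x) ! j = mu j x" using nth[of j j N x] mN(2)[of j] unfolding L_def by (simp del: upt_Suc)
        moreover have "fst (L j N x) = lam x" unfolding L_def lN by simp
        ultimately show ?case unfolding Let_def j_def[symmetric] by (intro conjI) simp_all
      qed
    qed
  qed
qed

section \<open>Approximation of a function by labels\<close>

lemma functionally_open_inE:
  assumes "functionally_open_in X U"
  obtains u where "continuous_map X euclideanreal u" "\<forall>x\<in>topspace X. 0 \<le> u x \<and> u x \<le> 1"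
    "U = {x \<in> topspace X. 0 < u x}"
proof -
  obtain g where g: "continuous_map X (top_of_set {0..1::real}) g"
    "topspace X - U = {x \<in> topspace X. g x = 0}" and U: "U \<subseteq> topspace X"
    using assms unfolding functionally_open_in_def functionally_closed_in_def by blast
  have *: "continuous_map X euclideanreal g" "g \<in> topspace X \<rightarrow> {0..1}"
    using g(1) by (auto simp: continuous_map_in_subtopology)
  have "U = {x \<in> topspace X. 0 < g x}"
  proof (intro set_eqI)
    fix x
    show "x \<in> U \<longleftrightarrow> x \<in> {x \<in> topspace X. 0 < g x}"
    proof (cases "x \<in> topspace X")
      case True
      then have "0 \<le> g x" using *(2) by auto
      moreover have "x \<notin> U \<longleftrightarrow> g x = 0" using g(2) True by blast
      ultimately show ?thesis using True by auto
    qed (use U in auto)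
  qed
  moreover have "\<forall>x\<in>topspace X. 0 \<le> g x \<and> g x \<le> 1" using *(2) by auto
  ultimately show thesis using *(1) that by blast
qed

lemma openin_functionally_open: "functionally_open_in X U \<Longrightarrow> openin X U"
proof (elim functionally_open_inE)
  fix u assume u: "continuous_map X euclideanreal u" "U = {x \<in> topspace X. 0 < u x}"
  show "openin X U"
    using openin_continuous_map_preimage[OF u(1), of "{0<..}"] u(2) by auto
qed

lemma functionally_fsigma_inE:
  assumes "functionally_fsigma_in X S"
  obtains h :: "nat \<Rightarrow> 'a \<Rightarrow> real" where "\<And>n. continuous_map X euclideanreal (h n)"
    "\<And>n x. x \<in> topspace X \<Longrightarrow> 0 \<le> h n x \<and> h n x \<le> 1" "S = {x \<in> topspace X. \<exists>n. h n x = 0}"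
proof -
  obtain \<C> where \<C>: "countable \<C>" "\<C> \<subseteq> Collect (functionally_closed_in X)" "\<Union>\<C> = S"
    using assms unfolding functionally_fsigma_in_def union_of_def by auto
  define c where "c n = (if \<C> = {} then {} else from_nat_into \<C> n)" for n
  have "functionally_closed_in X {}"
    unfolding functionally_closed_in_def by (intro exI[of _ "\<lambda>x. 1"]) auto
  then have "functionally_closed_in X (c n)" for n
    using \<C>(2) from_nat_into[of \<C> n] by (auto simp: c_def)
  then have "\<forall>n. \<exists>g. continuous_map X (top_of_set {0..1::real}) g \<and> c n = {x \<in> topspace X. g x = 0}"
    by (simp add: functionally_closed_in_def)
  then obtain h where h: "\<forall>n. continuous_map X (top_of_set {0..1::real}) (h n) \<and> c n = {x \<in> topspace X. h n x = 0}"
    unfolding choice_iff by (elim exE)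
  have "(\<Union>n. c n) = S"
    using \<C> range_from_nat_into[of \<C>] by (auto simp: c_def)
  then have "S = {x \<in> topspace X. \<exists>n. h n x = 0}" using h by auto
  moreover have "continuous_map X euclideanreal (h n)" for n
    using h by (auto simp: continuous_map_in_subtopology)
  moreover have "0 \<le> h n x \<and> h n x \<le> 1" if "x \<in> topspace X" for n x
  proof -
    have "h n \<in> topspace X \<rightarrow> {0..1}" using h by (simp add: continuous_map_in_subtopology)
    then show ?thesis using that by (simp add: Pi_iff)
  qed
  ultimately show thesis using that[of h] by blast
qed

context Metric_space
begin

text \<open>\<open>Sigma_f\<close> makes the label locally constant and \<open>K1\<close> makes it
  close to \<open>f\<close>: discreteness leaves at most one relevant member \<open>b\<close> near
  each point, and the zero sets making up the preimage of the ball about \<open>y b\<close> single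
  out the points where \<open>y b\<close> is a good value.\<close>

lemma exists_label_limit_approx:
  assumes K1: "f \<in> K1 X mtopology" and Sigma: "f \<in> Sigma_f X mtopology" and "e > 0"
  shows "\<exists>h. (\<forall>x\<in>topspace X. h x \<in> M \<and> d (h x) (f x) < e) \<and> label_limit X h"
proof -
  have fM: "f x \<in> M" if "x \<in> topspace X" for x using K1 that by (auto simp: K1_def)
  have K1': "\<forall>V. openin mtopology V \<longrightarrow> functionally_fsigma_in X {x \<in> topspace X. f x \<in> V}"
    using K1 by (simp add: K1_def)
  obtain \<B> where \<B>: "sigma_sfd_in X \<B>" "is_base_for X mtopology \<B> f"
    using Sigma by (auto simp: Sigma_f_def)
  obtain Bn where Bn: "\<B> = (\<Union>n::nat. Bn n)" "\<And>n. sfd_family_in X (Bn n) id"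
    using \<B>(1) unfolding sigma_sfd_in_def by blast
  have "\<forall>n. \<exists>U. discrete_family_in X (Bn n) U \<and> (\<forall>b\<in>Bn n. functionally_open_in X (U b)) \<and>
      (\<forall>b\<in>Bn n. X closure_of b \<subseteq> U b)"
    using Bn(2) by (simp add: sfd_family_in_def)
  then obtain U where U: "\<forall>n. discrete_family_in X (Bn n) (U n) \<and>
      (\<forall>b\<in>Bn n. functionally_open_in X (U n b)) \<and> (\<forall>b\<in>Bn n. X closure_of b \<subseteq> U n b)"
    unfolding choice_iff by (elim exE)
  have "\<forall>n b. \<exists>u. b \<in> Bn n \<longrightarrow> continuous_map X euclideanreal u \<and>
       (\<forall>x\<in>topspace X. 0 \<le> u x \<and> u x \<le> 1) \<and> U n b = {x \<in> topspace X. 0 < u x}"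
  proof (intro allI)
    fix n b
    show "\<exists>u. b \<in> Bn n \<longrightarrow> continuous_map X euclideanreal u \<and>
       (\<forall>x\<in>topspace X. 0 \<le> u x \<and> u x \<le> 1) \<and> U n b = {x \<in> topspace X. 0 < u x}"
    proof (cases "b \<in> Bn n")
      case True
      then have "functionally_open_in X (U n b)" using U by simp
      then show ?thesis
      proof (rule functionally_open_inE)
        fix u assume "continuous_map X euclideanreal u" "\<forall>x\<in>topspace X. 0 \<le> u x \<and> u x \<le> 1"
          "U n b = {x \<in> topspace X. 0 < u x}"
        then show ?thesis by (intro exI[of _ u]) simp
      qed
    qed simp
  qed
  then obtain u where u: "\<forall>n b. b \<in> Bn n \<longrightarrow> continuous_map X euclideanreal (u n b) \<and>
       (\<forall>x\<in>topspace X. 0 \<le> u n b x \<and> u n b x \<le> 1) \<and> U n b = {x \<in> topspace X. 0 < u n b x}"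
    unfolding choice_iff by (elim exE)
  define good where "good b \<longleftrightarrow> (\<exists>y\<in>M. \<forall>x\<in>b. d y (f x) < e)" for b
  define y where "y b = (SOME y. y \<in> M \<and> (\<forall>x\<in>b. d y (f x) < e))" for b
  have y: "y b \<in> M" if "good b" for b
    using someI_ex[of "\<lambda>y. y \<in> M \<and> (\<forall>x\<in>b. d y (f x) < e)"] that unfolding good_def y_def by blast
  have yd: "d (y b) (f x) < e" if "good b" "x \<in> b" for b x
    using someI_ex[of "\<lambda>y. y \<in> M \<and> (\<forall>x\<in>b. d y (f x) < e)"] that unfolding good_def y_def by blast
  have "\<forall>b. \<exists>h. (\<forall>l::nat. continuous_map X euclideanreal (h l)) \<and>
       (\<forall>l. \<forall>x\<in>topspace X. 0 \<le> h l x \<and> h l x \<le> 1) \<and>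
       {x \<in> topspace X. f x \<in> mball (y b) e} = {x \<in> topspace X. \<exists>l. h l x = 0}"
  proof
    fix b
    have "functionally_fsigma_in X {x \<in> topspace X. f x \<in> mball (y b) e}"
      by (rule K1'[rule_format]) simp
    then show "\<exists>h. (\<forall>l::nat. continuous_map X euclideanreal (h l)) \<and>
       (\<forall>l. \<forall>x\<in>topspace X. 0 \<le> h l x \<and> h l x \<le> 1) \<and>
       {x \<in> topspace X. f x \<in> mball (y b) e} = {x \<in> topspace X. \<exists>l. h l x = 0}"
    proof (rule functionally_fsigma_inE)
      fix h :: "nat \<Rightarrow> 'b \<Rightarrow> real"
      assume "\<And>n. continuous_map X euclideanreal (h n)" "\<And>n x. x \<in> topspace X \<Longrightarrow> 0 \<le> h n x \<and> h n x \<le> 1"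
        "{x \<in> topspace X. f x \<in> mball (y b) e} = {x \<in> topspace X. \<exists>n. h n x = 0}"
      then show ?thesis by (intro exI[of _ h] conjI allI ballI) simp_all
    qed
  qed
  then have "\<exists>h. \<forall>b. (\<forall>l::nat. continuous_map X euclideanreal (h b l)) \<and>
       (\<forall>l. \<forall>x\<in>topspace X. 0 \<le> h b l x \<and> h b l x \<le> 1) \<and>
       {x \<in> topspace X. f x \<in> mball (y b) e} = {x \<in> topspace X. \<exists>l. h b l x = 0}"
    by (rule choice)
  then obtain h where h: "\<forall>b. (\<forall>l::nat. continuous_map X euclideanreal (h b l)) \<and>
       (\<forall>l. \<forall>x\<in>topspace X. 0 \<le> h b l x \<and> h b l x \<le> 1) \<and>
       {x \<in> topspace X. f x \<in> mball (y b) e} = {x \<in> topspace X. \<exists>l. h b l x = 0}"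
    by (elim exE)
  have h_eq: "{x \<in> topspace X. f x \<in> mball (y b) e} = {x \<in> topspace X. \<exists>l. h b l x = 0}" for b
    using h by simp
  define act where "act n b x \<longleftrightarrow> b \<in> Bn n \<and> good b \<and> x \<in> U n b" for n b x
  define bb where "bb n x = (SOME b. act n b x)" for n x
  \<comment> \<open>Weight 1 means \<open>u n b x \<ge> 1 / (k + 1)\<close> and
    \<open>h b l x = 0\<close>. The first condition alone is not enough, since \<open>U n b\<close>
    may contain points whose values are far from \<open>y b\<close>; the second puts
    \<open>f x\<close> into the ball.\<close>
  define q where "q n k l b x = min 1 (real (Suc k) * u n b x) * (1 - h b l x)" for n k l b x
  define p where "p n k l x = (if \<exists>b. act n b x then q n k l (bb n x) x else 0)" for n k l x
  have uniq: "\<exists>W. openin X W \<and> x \<in> W \<and> (\<forall>b b' z z'. z \<in> W \<and> z' \<in> W \<and> act n b z \<and> act n b' z' \<longrightarrow> b = b')"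
    if x: "x \<in> topspace X" for n x
  proof -
    obtain W where W: "openin X W" "x \<in> W"
      "\<forall>i\<in>Bn n. \<forall>j\<in>Bn n. W \<inter> U n i \<noteq> {} \<and> W \<inter> U n j \<noteq> {} \<longrightarrow> i = j"
    proof -
      have "discrete_family_in X (Bn n) (U n)" using U by simp
      from this[unfolded discrete_family_in_def] x
      have "\<exists>W. openin X W \<and> x \<in> W \<and>
          (\<forall>i\<in>Bn n. \<forall>j\<in>Bn n. W \<inter> U n i \<noteq> {} \<and> W \<inter> U n j \<noteq> {} \<longrightarrow> i = j)" by (rule bspec)
      then show ?thesis by (elim exE conjE) (rule that)
    qed
    show ?thesis
    proof (intro exI[of _ W] conjI allI impI)
      fix b b' z z' assume *: "z \<in> W \<and> z' \<in> W \<and> act n b z \<and> act n b' z'"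
      then have "W \<inter> U n b \<noteq> {}" "W \<inter> U n b' \<noteq> {}" "b \<in> Bn n" "b' \<in> Bn n"
        unfolding act_def by blast+
      then show "b = b'" using W(3) by blast
    qed (use W in auto)
  qed
  have bb: "bb n x = b" if "act n b x" "x \<in> topspace X" for n b x
  proof -
    have "act n (bb n x) x" unfolding bb_def using that(1) by (rule someI)
    then show ?thesis using uniq[OF that(2), of n] that(1) by blast
  qed
  have q_bounds: "0 \<le> q n k l b x \<and> q n k l b x \<le> 1" if "x \<in> topspace X" "b \<in> Bn n" for n k l b x
  proof -
    have "0 \<le> u n b x" "0 \<le> h b l x" "h b l x \<le> 1" using u h that by blast+
    then show ?thesis unfolding q_def by (intro conjI mult_nonneg_nonneg mult_le_one) simp_all
  qed
  have q_cont: "continuous_map X euclideanreal (q n k l b)" if "b \<in> Bn n" for n k l b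
    unfolding q_def using u h that
    by (intro continuous_map_real_mult continuous_map_real_min continuous_map_diff continuous_map_real_mult_left
        continuous_map_const[THEN iffD2]) simp_all
  have q_zero: "q n k l b x = 0" if "x \<in> topspace X" "b \<in> Bn n" "x \<notin> U n b" for n k l b x
  proof -
    have "u n b x = 0" using u that by fastforce
    then show ?thesis by (simp add: q_def)
  qed
  have p_act: "p n k l x = q n k l b x" if "act n b x" "x \<in> topspace X" for n k l b x
    using bb[OF that] that(1) unfolding p_def by auto
  have p_nonzero: "\<exists>b. act n b x" if "p n k l x \<noteq> 0" for n k l x
  proof (rule ccontr)
    assume "\<not> ?thesis"
    then have "p n k l x = 0" unfolding p_def by (rule if_not_P)
    with that show False by simp
  qed
  have patch_p: "patch X (p n k l) (\<lambda>x. y (bb n x))" for n k l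
    unfolding patch_def
  proof (intro conjI ballI impI)
    show "continuous_map X euclideanreal (p n k l)"
    proof (rule continuous_map_locally_coincide)
      fix x assume x: "x \<in> topspace X"
      obtain W where W: "openin X W" "x \<in> W"
        "\<forall>b b' z z'. z \<in> W \<and> z' \<in> W \<and> act n b z \<and> act n b' z' \<longrightarrow> b = b'"
        using uniq[OF x, of n] by (elim exE conjE)
      have Wtop: "z \<in> topspace X" if "z \<in> W" for z using W(1) openin_subset that by blast
      show "\<exists>W h. openin X W \<and> x \<in> W \<and> continuous_map X euclideanreal h \<and> (\<forall>z\<in>W. p n k l z = h z)"
      proof (cases "\<exists>b z. z \<in> W \<and> act n b z")
        case True
        then obtain b z where bz: "z \<in> W" "act n b z" by blast
        then have b: "b \<in> Bn n" "good b" by (auto simp: act_def)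
        have "p n k l w = q n k l b w" if w: "w \<in> W" for w
        proof (cases "\<exists>b'. act n b' w")
          case True
          then obtain b' where "act n b' w" by blast
          moreover from this W(3) bz w have "b = b'" by blast
          ultimately have "act n b w" by simp
          then show ?thesis by (rule p_act) (rule Wtop[OF w])
        next
          case False
          then have "p n k l w = 0" by (simp add: p_def)
          moreover have "w \<notin> U n b" using False b by (auto simp: act_def)
          ultimately show ?thesis using q_zero[OF Wtop[OF w] b(1)] by simp
        qed
        then show ?thesis using W(1,2) q_cont[OF b(1)] by (intro exI[of _ W] exI[of _ "q n k l b"]) simp
      next
        case False
        have "p n k l w = 0" if "w \<in> W" for w
        proof -
          have "\<nexists>b. act n b w" using False that by blast
          then show ?thesis by (simp add: p_def)
        qed
        then show ?thesis using W(1,2) by (intro exI[of _ W] exI[of _ "\<lambda>x. 0"]) simp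
      qed
    qed
    fix x assume x: "x \<in> topspace X"
    have "0 \<le> p n k l x \<and> p n k l x \<le> 1"
    proof (cases "\<exists>b. act n b x")
      case True
      then obtain b where b: "act n b x" by (elim exE)
      then show ?thesis using p_act[OF b x] q_bounds[OF x, of b n] by (simp add: act_def)
    qed (simp add: p_def)
    then show "0 \<le> p n k l x" "p n k l x \<le> 1" by simp_all
    assume "0 < p n k l x"
    then have "p n k l x \<noteq> 0" by simp
    from p_nonzero[OF this] obtain b where b: "act n b x" by (elim exE)
    have "openin X (U n b)" using U b by (intro openin_functionally_open) (simp add: act_def)
    moreover have "y (bb n z) = y b" if "z \<in> U n b" for z
    proof -
      have "z \<in> topspace X" using that \<open>openin X (U n b)\<close> openin_subset by blast
      have "act n b z" using b that by (simp add: act_def)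
      from bb[OF this \<open>z \<in> topspace X\<close>] show ?thesis by simp
    qed
    ultimately show "\<exists>W c. openin X W \<and> x \<in> W \<and> (\<forall>z\<in>W. y (bb n z) = c)"
      using b by (intro exI[of _ "U n b"] exI[of _ "y b"]) (simp add: act_def)
  qed
  have p_close: "y (bb n x) \<in> M \<and> d (y (bb n x)) (f x) < e" if x: "x \<in> topspace X" and "p n k l x = 1" for n k l x
  proof -
    have "p n k l x \<noteq> 0" using that(2) by simp
    from p_nonzero[OF this] obtain b where b: "act n b x" by (elim exE)
    then have b': "b \<in> Bn n" "good b" by (auto simp: act_def)
    have q1: "q n k l b x = 1" using p_act[OF b x] that(2) by simp
    have h01: "0 \<le> h b l x" "h b l x \<le> 1" using h x by blast+
    then have "min 1 (real (Suc k) * u n b x) * (1 - h b l x) \<le> 1 * (1 - h b l x)"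
      by (intro mult_right_mono) simp_all
    then have "q n k l b x \<le> 1 - h b l x" unfolding q_def by (simp only: mult_1)
    then have "h b l x = 0" using q1 h01(1) by linarith
    then have "x \<in> {x \<in> topspace X. \<exists>l. h b l x = 0}" using x by (intro CollectI conjI exI)
    then have "x \<in> {x \<in> topspace X. f x \<in> mball (y b) e}" using h_eq by simp
    then have "f x \<in> mball (y b) e" by simp
    then show ?thesis using bb[OF b x] by simp
  qed
  have p_cover: "\<exists>n k l. p n k l x = 1" if x: "x \<in> topspace X" for x
  proof -
    have "openin mtopology (mball (f x) e)" by simp
    from \<B>(2)[unfolded is_base_for_def, rule_format, OF this]
    obtain \<C> where \<C>: "\<C> \<subseteq> \<B>" "\<Union>\<C> = {z \<in> topspace X. f z \<in> mball (f x) e}"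
      by (elim exE conjE)
    have "x \<in> \<Union>\<C>" unfolding \<C>(2) using x fM \<open>e > 0\<close> by simp
    then obtain b where b: "x \<in> b" "b \<in> \<C>" by blast
    then obtain n where n: "b \<in> Bn n" using \<C>(1) Bn(1) by blast
    have "d (f x) (f z) < e" if "z \<in> b" for z
    proof -
      have "z \<in> \<Union>\<C>" using b(2) that by blast
      then show ?thesis unfolding \<C>(2) by simp
    qed
    then have g: "good b" unfolding good_def using fM[OF x] by (intro bexI[of _ "f x"] ballI)
    have "x \<in> X closure_of b"
      using b(1) x closure_of_subset_Int[of X b] by blast
    moreover have "X closure_of b \<subseteq> U n b" using U n by simp
    ultimately have xU: "x \<in> U n b" by blast
    have act: "act n b x" using g n xU by (simp add: act_def)
    have "U n b = {x \<in> topspace X. 0 < u n b x}" using u n by simp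
    then have "0 < u n b x" using xU by simp
    then obtain k :: nat where "1 / u n b x < real k" using reals_Archimedean2 by blast
    then have k: "1 < real k * u n b x" using \<open>0 < u n b x\<close> by (simp add: field_simps)
    have "f x \<in> mball (y b) e" using yd[OF g b(1)] y[OF g] fM[OF x] by simp
    then have "x \<in> {x \<in> topspace X. f x \<in> mball (y b) e}" using x by simp
    then have "\<exists>l. h b l x = 0" unfolding h_eq by simp
    then obtain l where l: "h b l x = 0" by (elim exE)
    have "1 \<le> real (Suc k) * u n b x" using k \<open>0 < u n b x\<close> by (simp add: distrib_right)
    then have "q n k l b x = 1" using l unfolding q_def by (simp only: min_absorb1) simp
    then have "p n k l x = 1" using p_act[OF act x] by simp
    then show ?thesis by (intro exI)
  qed
  define P where "P i = (case from_nat i of (n, k, l) \<Rightarrow> p n k l)" for i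
  define L where "L i = (case from_nat i of (n, k::nat, l::nat) \<Rightarrow> (\<lambda>x. y (bb n x)))" for i
  have "patch X (P i) (L i)" for i
  proof -
    obtain n k l :: nat where "from_nat i = (n, k, l)" by (metis prod_cases3)
    then show ?thesis using patch_p[of n k l] unfolding P_def L_def by simp
  qed
  moreover have ex: "\<exists>i. P i x = 1" if x: "x \<in> topspace X" for x
  proof -
    obtain n k l where "p n k l x = 1" using p_cover[OF x] by (elim exE)
    then show ?thesis by (intro exI[of _ "to_nat (n, k, l)"]) (simp add: P_def)
  qed
  ultimately have lim: "label_limit X (\<lambda>x. L (LEAST i. P i x = 1) x)"
    by (rule label_limit_least_patch)
  have "L (LEAST i. P i x = 1) x \<in> M \<and> d (L (LEAST i. P i x = 1) x) (f x) < e" if x: "x \<in> topspace X" for x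
  proof -
    have "P (LEAST i. P i x = 1) x = 1" using ex[OF x] by (rule LeastI_ex)
    moreover obtain n k l :: nat where "from_nat (LEAST i. P i x = 1) = (n, k, l)" by (metis prod_cases3)
    ultimately show ?thesis using p_close[OF x, of n k l] unfolding P_def L_def by simp
  qed
  then show ?thesis using lim by (intro exI[of _ "\<lambda>x. L (LEAST i. P i x = 1) x"]) simp
qed

end

section \<open>Continuous approximations along a tree of labels\<close>

text \<open>The path parameter \<open>3 p - 1\<close> is cut off at 0 and 1: the new map agrees with \<^term>\<open>g\<close> where \<open>p < 1/3\<close>, which gives
  continuity at zeros of \<^term>\<open>p\<close> without any uniformity of the paths, and sits at the endpoint where \<open>p \<ge> 2/3\<close>,
  which leaves room for the next correction.\<close>

lemma continuous_map_path_patch: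
  assumes g: "continuous_map X Y g" and p: "patch X p l"
    and path: "\<And>x. x \<in> topspace X \<Longrightarrow> 0 < p x \<Longrightarrow> pathin Y (\<gamma> (l x)) \<and> \<gamma> (l x) 0 = g x"
  shows "continuous_map X Y (\<lambda>x. if 0 < p x then \<gamma> (l x) (clamp01 (3 * p x - 1)) else g x)"
proof (rule continuous_map_locally_coincide)
  fix x assume x: "x \<in> topspace X"
  let ?f = "\<lambda>x. if 0 < p x then \<gamma> (l x) (clamp01 (3 * p x - 1)) else g x"
  note pc = patch_continuous[OF p]
  show "\<exists>W h. openin X W \<and> x \<in> W \<and> continuous_map X Y h \<and> (\<forall>z\<in>W. ?f z = h z)"
  proof (cases "0 < p x")
    case True
    obtain W c where W: "openin X W" "x \<in> W" "\<forall>z\<in>W. l z = c" using patch_label[OF p x True] by blast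
    let ?W = "W \<inter> {z \<in> topspace X. p z \<in> {0<..}}"
    have "openin X {z \<in> topspace X. p z \<in> {0<..}}" by (rule openin_continuous_map_preimage[OF pc]) simp
    then have "openin X ?W" using W(1) by blast
    moreover have "x \<in> ?W" using W x True by simp
    moreover have "continuous_map X Y (\<lambda>z. \<gamma> c (clamp01 (3 * p z - 1)))"
    proof -
      have "continuous_map X euclideanreal (\<lambda>z. clamp01 (3 * p z - 1))"
        by (intro continuous_map_clamp01 continuous_map_diff continuous_map_real_mult_left pc
            continuous_map_const[THEN iffD2]) simp
      then have "continuous_map X (top_of_set {0..1}) (\<lambda>z. clamp01 (3 * p z - 1))"
        by (simp add: continuous_map_in_subtopology Pi_iff)
      moreover have "continuous_map (top_of_set {0..1}) Y (\<gamma> c)"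
        using path[OF x True] W by (simp add: pathin_def)
      ultimately show ?thesis using continuous_map_compose unfolding comp_def by fast
    qed
    moreover have "\<forall>z\<in>?W. ?f z = \<gamma> c (clamp01 (3 * p z - 1))" using W(3) by simp
    ultimately show ?thesis by blast
  next
    case False
    let ?W = "{z \<in> topspace X. p z \<in> {..<1/3}}"
    have "openin X ?W" by (rule openin_continuous_map_preimage[OF pc]) simp
    moreover have "x \<in> ?W" using x False by simp
    moreover have "?f z = g z" if "z \<in> ?W" for z using path[of z] that by simp
    ultimately show ?thesis using g by blast
  qed
qed

section \<open>Corrections along paths and the diagonal sequence\<close>

context Metric_space
begin

text \<open>A label is a point together with a set around it; \<open>s\<close> is the label of level
  \<open>k\<close> and \<open>t\<close> that of level \<open>k + 1\<close>. The condition permits a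
  move from one point to the other by a path inside the set of \<open>s\<close>. Guessed labels need
  not fit together, hence the explicit test. Level 0 has no size bound because its set is the whole
  space.\<close>

definition admissible :: "nat \<Rightarrow> 'a \<times> 'a set \<Rightarrow> 'a \<times> 'a set \<Rightarrow> bool" where
  "admissible k s t \<longleftrightarrow> fst s \<in> snd s \<and> fst t \<in> snd s \<and> path_connectedin mtopology (snd s) \<and>
     (0 < k \<longrightarrow> (\<forall>u\<in>snd s. \<forall>v\<in>snd s. d u v \<le> (1/2) ^ k))"

text \<open>This takes place at one fixed stage, where labels are mere guesses. A correction is made
  only where consecutive guesses are admissible, and it stays in the small set of the older one;
  elsewhere nothing moves. So the bound \<open>(1/2) ^ k\<close> holds at every point, while the
  value \<open>fst (l k x)\<close> is promised only where all guesses up to \<open>k\<close> have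
  full weight and fit together.\<close>

lemma path_tower:
  fixes p :: "nat \<Rightarrow> 'x \<Rightarrow> real" and l :: "nat \<Rightarrow> 'x \<Rightarrow> 'a \<times> 'a set"
  assumes patch: "\<And>k. patch X (p k) (l k)" and l0: "\<And>x. fst (l 0 x) = y0" and "y0 \<in> M"
  shows "\<exists>g. (\<forall>k. continuous_map X mtopology (g k)) \<and>
     (\<forall>k. \<forall>x\<in>topspace X. (\<forall>j\<le>k. p j x = 1) \<longrightarrow> (\<forall>j<k. admissible j (l j x) (l (Suc j) x)) \<longrightarrow> g k x = fst (l k x)) \<and>
     (\<forall>k>0. \<forall>x\<in>topspace X. d (g (Suc k) x) (g k x) \<le> (1/2) ^ k)"
proof -
  \<comment> \<open>The constants interlock with the path parameter \<open>3 p - 1\<close>, which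
    reaches 1 at \<open>p = 2/3\<close>: \<open>3 * q x - 2\<close> is positive only beyond
    \<open>2/3\<close>, so a correction begins only where the previous one has arrived at its
    endpoint. Where \<open>q x = 1\<close> no weight is lost.\<close>
  define step where "step k q x = (if admissible k (l k x) (l (Suc k) x) then p (Suc k) x * clamp01 (3 * q x - 2) else 0)"
    for k q x
  define P where "P = rec_nat (p 0) step"
  have P_0: "P 0 = p 0" and P_Suc: "P (Suc k) = step k (P k)" for k by (simp_all add: P_def)
  have patch_step: "patch X (step k q) (\<lambda>x. (l (Suc k) x, l k x))" if q: "patch X q (l k)" for k q
  proof -
    have "patch X (\<lambda>x. clamp01 (3 * q x - 2)) (l k)"
      using patch_continuous[OF q]
      by (intro patch_shrink[OF q] continuous_map_clamp01 continuous_map_diff continuous_map_real_mult_left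
            continuous_map_const[THEN iffD2]) simp_all
    from patch_restrict[OF patch_Pair[OF patch[of "Suc k"] this], of "\<lambda>(t, s). admissible k s t"]
    show ?thesis unfolding step_def by simp
  qed
  have patch_P: "patch X (P k) (l k)" for k
  proof (induction k)
    case 0
    show ?case unfolding P_0 by (rule patch)
  next
    case (Suc k)
    from patch_map[OF patch_step[OF Suc], where f = fst] show ?case unfolding P_Suc by simp
  qed
  \<comment> \<open>One path per pair of labels (the newer label first), so the path is fixed
    wherever both labels are locally constant.\<close>
  define \<gamma> where "\<gamma> ts = (SOME g. pathin (subtopology mtopology (snd (snd ts))) g \<and> g 0 = fst (snd ts) \<and> g 1 = fst (fst ts))"
    for ts :: "('a \<times> 'a set) \<times> ('a \<times> 'a set)"
  have \<gamma>: "pathin (subtopology mtopology (snd s)) (\<gamma> (t, s)) \<and> \<gamma> (t, s) 0 = fst s \<and> \<gamma> (t, s) 1 = fst t"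
    if "admissible k s t" for k s t
  proof -
    have "path_connected_space (subtopology mtopology (snd s))" "snd s \<subseteq> M"
      using that by (auto simp: admissible_def path_connectedin_def)
    then have "\<exists>g. pathin (subtopology mtopology (snd s)) g \<and> g 0 = fst s \<and> g 1 = fst t"
      using that unfolding path_connected_space_def admissible_def by auto
    then show ?thesis unfolding \<gamma>_def fst_conv snd_conv
      by (rule someI_ex[where P = "\<lambda>g. pathin (subtopology mtopology (snd s)) g \<and> g 0 = fst s \<and> g 1 = fst t"])
  qed
  define G where "G = rec_nat (\<lambda>x. y0) (\<lambda>k g x. if 0 < P (Suc k) x then
       \<gamma> (l (Suc k) x, l k x) (clamp01 (3 * P (Suc k) x - 1)) else g x)"
  have G_0: "G 0 x = y0" and G_Suc: "G (Suc k) x = (if 0 < P (Suc k) x then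
       \<gamma> (l (Suc k) x, l k x) (clamp01 (3 * P (Suc k) x - 1)) else G k x)" for k x
    by (simp_all add: G_def)
  have pos: "admissible k (l k x) (l (Suc k) x) \<and> 2/3 < P k x" if x: "x \<in> topspace X" and "0 < P (Suc k) x" for k x
  proof -
    have adm: "admissible k (l k x) (l (Suc k) x)" using that by (auto simp: P_Suc step_def split: if_split_asm)
    then have "0 < p (Suc k) x * clamp01 (3 * P k x - 2)" using that by (simp add: P_Suc step_def)
    then have "0 < clamp01 (3 * P k x - 2)"
      using patch_bounds[OF patch x, of "Suc k"] by (simp add: zero_less_mult_iff del: clamp01_simps(5))
    then show ?thesis using adm by simp
  qed
  have gval: "G k x = fst (l k x)" if x: "x \<in> topspace X" and "2/3 \<le> P k x" for k x
  proof (cases k)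
    case 0
    then show ?thesis using G_0 l0 by simp
  next
    case (Suc j)
    then have gt: "0 < P (Suc j) x" "clamp01 (3 * P (Suc j) x - 1) = 1" using that by simp_all
    then show ?thesis using \<gamma>[OF conjunct1[OF pos[OF x gt(1)]]] Suc by (simp add: G_Suc)
  qed
  have cont: "continuous_map X mtopology (G k)" for k
  proof (induction k)
    case 0
    have "G 0 = (\<lambda>x. y0)" using G_0 by auto
    then show ?case using \<open>y0 \<in> M\<close> by simp
  next
    case (Suc k)
    have "G (Suc k) = (\<lambda>x. if 0 < P (Suc k) x then
       \<gamma> (l (Suc k) x, l k x) (clamp01 (3 * P (Suc k) x - 1)) else G k x)" using G_Suc by auto
    moreover have "continuous_map X mtopology \<dots>"
    proof (rule continuous_map_path_patch[where p = "P (Suc k)" and l = "\<lambda>x. (l (Suc k) x, l k x)" and \<gamma> = \<gamma>, OF Suc])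
      show "patch X (P (Suc k)) (\<lambda>x. (l (Suc k) x, l k x))" unfolding P_Suc by (rule patch_step[OF patch_P])
      fix x assume x: "x \<in> topspace X" "0 < P (Suc k) x"
      have a: "admissible k (l k x) (l (Suc k) x)" "2/3 < P k x" using pos[OF x] by auto
      show "pathin mtopology (\<gamma> (l (Suc k) x, l k x)) \<and> \<gamma> (l (Suc k) x, l k x) 0 = G k x"
        using \<gamma>[OF a(1)] gval[OF x(1), of k] a(2) by (simp add: pathin_subtopology)
    qed
    ultimately show ?case by simp
  qed
  have close: "d (G (Suc k) x) (G k x) \<le> (1/2) ^ k" if "0 < k" and x: "x \<in> topspace X" for k x
  proof (cases "0 < P (Suc k) x")
    case True
    have a: "admissible k (l k x) (l (Suc k) x)" "2/3 < P k x" using pos[OF x True] by auto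
    have "pathin (subtopology mtopology (snd (l k x))) (\<gamma> (l (Suc k) x, l k x))" using \<gamma>[OF a(1)] by blast
    then have "\<gamma> (l (Suc k) x, l k x) t \<in> snd (l k x)" if "t \<in> {0..1}" for t
      using that by (auto simp: pathin_subtopology)
    then have "G (Suc k) x \<in> snd (l k x)" using True by (simp add: G_Suc)
    moreover have "G k x \<in> snd (l k x)" using gval[OF x, of k] a by (simp add: admissible_def)
    ultimately show ?thesis using a(1) \<open>0 < k\<close> by (simp add: admissible_def)
  next
    case False
    have "G k x \<in> M" using continuous_map_image_subset_topspace[OF cont[of k]] x by auto
    then show ?thesis using False by (simp add: G_Suc)
  qed
  have one: "P k x = 1" if "\<forall>j\<le>k. p j x = 1" "\<forall>j<k. admissible j (l j x) (l (Suc j) x)" for k x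
    using that
  proof (induction k)
    case (Suc k)
    then show ?case by (simp add: P_Suc step_def)
  qed (simp add: P_0)
  show ?thesis
    using cont close gval one by (intro exI[of _ G] conjI allI ballI impI) auto
qed

text \<open>For a fixed level \<open>k\<close> and large \<open>N\<close> the guesses up to level
  \<open>k\<close> are right at the given point, which pins \<open>g N k x\<close> close to
  \<open>f x\<close>; beyond \<open>k\<close> only the summable bounds of the corrections are used.
  Nested sets make the correct labels of consecutive levels admissible.\<close>

lemma K1_Sigma_f_subset_B1:
  assumes pc: "path_connected_space mtopology" and lpc: "locally_path_connected_space mtopology"
  shows "K1 X mtopology \<inter> Sigma_f X mtopology \<subseteq> B1 X mtopology"
proof
  fix f assume "f \<in> K1 X mtopology \<inter> Sigma_f X mtopology"
  then have K1: "f \<in> K1 X mtopology" and Sigma: "f \<in> Sigma_f X mtopology" by auto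
  have fM: "f \<in> topspace X \<rightarrow> M" using K1 by (simp add: K1_def)
  show "f \<in> B1 X mtopology"
  \<comment> \<open>Over the empty space there may be no point of \<open>M\<close> to start
    from.\<close>
  proof (cases "topspace X = {}")
    case True
    then show ?thesis using fM unfolding B1_def
      by (auto intro!: exI[of _ "\<lambda>n. f"] simp: continuous_map_def)
  next
    case False
    then obtain y0 where y0: "y0 \<in> M" using fM by fastforce
    have "\<forall>j. \<exists>h. (\<forall>x\<in>topspace X. h x \<in> M \<and> d (h x) (f x) < (1/2) ^ j) \<and> label_limit X h"
      using exists_label_limit_approx[OF K1 Sigma] by simp
    then obtain h where h: "\<forall>j::nat. (\<forall>x\<in>topspace X. h j x \<in> M \<and> d (h j x) (f x) < (1/2) ^ j) \<and> label_limit X (h j)"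
      unfolding choice_iff by (elim exE)
    define good where "good k W \<longleftrightarrow> openin mtopology W \<and> path_connectedin mtopology W \<and>
       (0 < k \<longrightarrow> (\<forall>u\<in>W. \<forall>v\<in>W. d u v \<le> (1/2) ^ k))" for k :: nat and W
    \<comment> \<open>Level 0 is fixed to a constant label, because \<open>path_tower\<close> needs
      the same starting point \<open>y0\<close> at every stage and not only eventually.\<close>
    define inv where "inv k lab \<longleftrightarrow> label_limit X lab \<and>
       (\<forall>x\<in>topspace X. f x \<in> snd (lab x) \<and> fst (lab x) \<in> snd (lab x) \<and> good k (snd (lab x))) \<and> (k = 0 \<longrightarrow> lab = (\<lambda>x. (y0, M)))"
      for k :: nat and lab :: "'b \<Rightarrow> 'a \<times> 'a set"
    have patch_const: "patch X (\<lambda>x. 1) (\<lambda>x. (y0, M))"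
      unfolding patch_def by (intro conjI ballI impI exI[of _ "topspace X"] exI[of _ "(y0, M)"]) simp_all
    have base: "\<exists>lab. inv 0 lab"
    proof (intro exI)
      have "label_limit X (\<lambda>x. (y0, M))"
        unfolding label_limit_def using patch_const by (intro exI[of _ "\<lambda>N x. 1"] exI[of _ "\<lambda>N x. (y0, M)"]) simp
      moreover have "good 0 M" using pc unfolding good_def
        by (metis less_irrefl openin_topspace path_connectedin_topspace topspace_mtopology)
      ultimately show "inv 0 (\<lambda>x. (y0, M))" using fM y0 by (auto simp: inv_def)
    qed
    have step: "\<exists>lab'. inv (Suc k) lab' \<and> (\<forall>x\<in>topspace X. snd (lab' x) \<subseteq> snd (lab x))" if inv: "inv k lab" for k lab
    proof -
      \<comment> \<open>The label can see the approximation \<open>z = h j x\<close> but not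
        \<open>f x\<close>. Asking for a whole ball of radius \<open>(1/2) ^ j\<close> about
        \<open>z\<close> inside \<open>W\<close> forces \<open>f x \<in> W\<close>, as
        \<open>h j x\<close> is closer to \<open>f x\<close> than that.\<close>
      define Q where "Q t j z W \<longleftrightarrow> good (Suc k) W \<and> W \<subseteq> snd t \<and> z \<in> W \<and> mball z ((1/2) ^ j) \<subseteq> W"
        for t :: "'a \<times> 'a set" and j :: nat and z W
      define P where "P t j z \<longleftrightarrow> (\<exists>W. Q t j z W)" for t j z
      define F where "F t j z = (z, SOME W. Q t j z W)" for t j z
      have ex: "\<exists>j. P (lab x) j (h j x)" if x: "x \<in> topspace X" for x
      proof -
        have fx: "f x \<in> M" "f x \<in> snd (lab x)" "openin mtopology (snd (lab x))"
          using fM x inv by (auto simp: inv_def good_def)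
        define r :: real where "r = (1/2) ^ (Suc (Suc k))"
        have "r > 0" by (simp add: r_def)
        have "openin mtopology (snd (lab x) \<inter> mball (f x) r)" "f x \<in> snd (lab x) \<inter> mball (f x) r"
          using fx \<open>r > 0\<close> by auto
        then obtain W where W: "openin mtopology W" "path_connectedin mtopology W" "f x \<in> W"
          "W \<subseteq> snd (lab x) \<inter> mball (f x) r"
          using lpc unfolding locally_path_connected_space by metis
        have "d u v \<le> (1/2) ^ Suc k" if "u \<in> W" "v \<in> W" for u v
        proof -
          have "u \<in> M" "v \<in> M" "d (f x) u < r" "d (f x) v < r" using W(4) that by auto
          then have "d u v \<le> d (f x) u + d (f x) v" using triangle[of u "f x" v] fx(1) commute by simp
          then show ?thesis using \<open>d (f x) u < r\<close> \<open>d (f x) v < r\<close> by (simp add: r_def)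
        qed
        then have good: "good (Suc k) W" using W by (simp add: good_def)
        obtain s where s: "s > 0" "mball (f x) s \<subseteq> W"
          using W(1,3) unfolding openin_mtopology by blast
        obtain j :: nat where "(1/2) ^ j < s / 2" using real_arch_pow_inv[of "s / 2" "1/2"] s(1) by auto
        then have j: "2 * (1/2) ^ j < s" by simp
        have hj: "h j x \<in> M" "d (h j x) (f x) < (1/2) ^ j" using h x by blast+
        have sub: "mball (h j x) ((1/2) ^ j) \<subseteq> mball (f x) s"
        proof
          fix z assume "z \<in> mball (h j x) ((1/2) ^ j)"
          then have z: "z \<in> M" "d (h j x) z < (1/2) ^ j" by auto
          have "d (f x) z \<le> d (f x) (h j x) + d (h j x) z" using triangle fx(1) hj(1) z(1) by blast
          then show "z \<in> mball (f x) s" using hj z fx(1) j commute[of "f x"] by simp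
        qed
        have "h j x \<in> mball (h j x) ((1/2) ^ j)" using hj(1) by simp
        then have "Q (lab x) j (h j x) W" unfolding Q_def using good W(4) sub s(2) by blast
        then show ?thesis unfolding P_def by blast
      qed
      define lab' where "lab' x = (let j = LEAST j. P (lab x) j (h j x) in F (lab x) j (h j x))" for x
      have "label_limit X lab'"
        unfolding lab'_def by (rule label_limit_least) (use inv h ex in \<open>simp_all add: inv_def\<close>)
      moreover have "f x \<in> snd (lab' x) \<and> fst (lab' x) \<in> snd (lab' x) \<and> good (Suc k) (snd (lab' x)) \<and> snd (lab' x) \<subseteq> snd (lab x)"
        if x: "x \<in> topspace X" for x
      proof -
        define j where "j = (LEAST j. P (lab x) j (h j x))"
        have "P (lab x) j (h j x)" unfolding j_def using ex[OF x] by (rule LeastI_ex)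
        then have Q: "Q (lab x) j (h j x) (SOME W. Q (lab x) j (h j x) W)" unfolding P_def by (rule someI_ex)
        have eq: "lab' x = (h j x, SOME W. Q (lab x) j (h j x) W)"
          unfolding lab'_def Let_def F_def j_def ..
        have "h j x \<in> M" "f x \<in> M" "d (h j x) (f x) < (1/2) ^ j" using h fM x by blast+
        then have "f x \<in> mball (h j x) ((1/2) ^ j)" by simp
        then show ?thesis using Q unfolding eq fst_conv snd_conv Q_def by blast
      qed
      ultimately show ?thesis by (intro exI[of _ lab']) (simp add: inv_def)
    qed
    obtain \<Lambda> where \<Lambda>: "\<And>k. inv k (\<Lambda> k)" "\<And>k. \<forall>x\<in>topspace X. snd (\<Lambda> (Suc k) x) \<subseteq> snd (\<Lambda> k x)"
      using dependent_nat_choice[of inv "\<lambda>k lab lab'. \<forall>x\<in>topspace X. snd (lab' x) \<subseteq> snd (lab x)", OF base step] by blast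
    have "\<forall>k. \<exists>p l. (\<forall>N. patch X (p N) (l N)) \<and>
       (\<forall>x \<in> topspace X. \<forall>\<^sub>F N in sequentially. p N x = 1 \<and> l N x = \<Lambda> k x) \<and> (k = 0 \<longrightarrow> (\<forall>N. l N = (\<lambda>x. (y0, M))))"
    proof
      fix k
      show "\<exists>p l. (\<forall>N. patch X (p N) (l N)) \<and>
       (\<forall>x \<in> topspace X. \<forall>\<^sub>F N in sequentially. p N x = 1 \<and> l N x = \<Lambda> k x) \<and> (k = 0 \<longrightarrow> (\<forall>N. l N = (\<lambda>x. (y0, M))))"
      proof (cases "k = 0")
        case True
        then have "\<Lambda> k = (\<lambda>x. (y0, M))" using \<Lambda>(1)[of k] by (simp add: inv_def)
        then show ?thesis using patch_const by (intro exI[of _ "\<lambda>N x. 1"] exI[of _ "\<lambda>N x. (y0, M)"]) simp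
      next
        case False
        have "label_limit X (\<Lambda> k)" using \<Lambda>(1)[of k] by (simp add: inv_def)
        then show ?thesis using False unfolding label_limit_def by simp
      qed
    qed
    then obtain p l where pl: "\<forall>k. (\<forall>N. patch X (p k N) (l k N)) \<and>
       (\<forall>x \<in> topspace X. \<forall>\<^sub>F N in sequentially. p k N x = 1 \<and> l k N x = \<Lambda> k x) \<and> (k = 0 \<longrightarrow> (\<forall>N. l k N = (\<lambda>x. (y0, M))))"
      unfolding choice_iff by (elim exE)
    have "\<forall>N. \<exists>g. (\<forall>k. continuous_map X mtopology (g k)) \<and>
     (\<forall>k. \<forall>x\<in>topspace X. (\<forall>j\<le>k. p j N x = 1) \<longrightarrow> (\<forall>j<k. admissible j (l j N x) (l (Suc j) N x)) \<longrightarrow> g k x = fst (l k N x)) \<and>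
     (\<forall>k>0. \<forall>x\<in>topspace X. d (g (Suc k) x) (g k x) \<le> (1/2) ^ k)"
      using pl y0 by (intro allI path_tower[where ?y0.0 = y0]) simp_all
    then obtain g where g: "\<forall>N. (\<forall>k. continuous_map X mtopology (g N k)) \<and>
     (\<forall>k. \<forall>x\<in>topspace X. (\<forall>j\<le>k. p j N x = 1) \<longrightarrow> (\<forall>j<k. admissible j (l j N x) (l (Suc j) N x)) \<longrightarrow> g N k x = fst (l k N x)) \<and>
     (\<forall>k>0. \<forall>x\<in>topspace X. d (g N (Suc k) x) (g N k x) \<le> (1/2) ^ k)"
      unfolding choice_iff by (elim exE)
    have gM: "g N k x \<in> M" if "x \<in> topspace X" for N k x
      using g continuous_map_image_subset_topspace[of X mtopology "g N k"] that by auto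
    have telescope: "d (g N (k + i) x) (g N k x) \<le> 2 * (1/2) ^ k - 2 * (1/2) ^ (k + i)"
      if "0 < k" and x: "x \<in> topspace X" for N k i x
    proof (induction i)
      case 0
      show ?case using gM[OF x] by simp
    next
      case (Suc i)
      have "d (g N (Suc (k + i)) x) (g N (k + i) x) \<le> (1/2) ^ (k + i)" using g x \<open>0 < k\<close> by simp
      moreover have "d (g N (Suc (k + i)) x) (g N k x) \<le> d (g N (Suc (k + i)) x) (g N (k + i) x) + d (g N (k + i) x) (g N k x)"
        by (intro triangle gM x)
      ultimately show ?case using Suc by simp
    qed
    have lim: "limitin mtopology (\<lambda>N. g N N x) (f x) sequentially" if x: "x \<in> topspace X" for x
      unfolding limitin_metric
    proof (intro conjI allI impI)
      show "f x \<in> M" using fM x by auto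
      fix e :: real assume "0 < e"
      then obtain i :: nat where "(1/2) ^ i < e / 3" using real_arch_pow_inv[of "e / 3" "1/2"] by auto
      \<comment> \<open>\<open>k\<close> must be positive, as level 0 has no size bound. Of the
        three shares \<open>(1/2) ^ k\<close>, one is for the distance of \<open>g N k x\<close>
        from \<open>f x\<close> and two are for all later corrections together.\<close>
      define k where "k = Suc i"
      have k: "0 < k" "3 * (1/2) ^ k < e" using \<open>(1/2) ^ i < e / 3\<close> \<open>0 < e\<close> by (simp_all add: k_def)
      have "\<forall>\<^sub>F N in sequentially. \<forall>j\<in>{..k}. p j N x = 1 \<and> l j N x = \<Lambda> j x"
        using pl x by (intro eventually_ball_finite) auto
      then show "\<forall>\<^sub>F N in sequentially. g N N x \<in> M \<and> d (g N N x) (f x) < e"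
        using eventually_ge_at_top[of k]
      proof eventually_elim
        case (elim N)
        have pj: "p j N x = 1" and lj: "l j N x = \<Lambda> j x" if "j \<le> k" for j using elim(1) that by blast+
        have inv: "f x \<in> snd (\<Lambda> j x)" "fst (\<Lambda> j x) \<in> snd (\<Lambda> j x)" "good j (snd (\<Lambda> j x))"
          "snd (\<Lambda> (Suc j) x) \<subseteq> snd (\<Lambda> j x)" for j
          using \<Lambda>(1)[of j] \<Lambda>(2)[of j] x by (simp_all add: inv_def)
        have "admissible j (l j N x) (l (Suc j) N x)" if "j < k" for j
          unfolding admissible_def lj[OF less_imp_le[OF that]] lj[OF Suc_leI[OF that]]
          using inv(2)[of j] inv(3)[of j] inv(4)[of j] inv(2)[of "Suc j"] unfolding good_def by blast
        then have "g N k x = fst (l k N x)" using g x pj by simp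
        then have gk: "g N k x = fst (\<Lambda> k x)" using lj by simp
        have "d (g N k x) (f x) \<le> (1/2) ^ k"
          using inv(1,2,3)[of k] k(1) unfolding gk good_def by blast
        moreover have "d (g N N x) (g N k x) \<le> 2 * (1/2) ^ k"
        proof -
          have "N = k + (N - k)" using elim(2) by simp
          then have "d (g N N x) (g N k x) \<le> 2 * (1/2) ^ k - 2 * (1/2) ^ N" using telescope[OF k(1) x, of N "N - k"] by simp
          moreover have "0 < 2 * (1/2 :: real) ^ N" by simp
          ultimately show ?thesis by linarith
        qed
        moreover have "d (g N N x) (f x) \<le> d (g N N x) (g N k x) + d (g N k x) (f x)"
          using fM x by (intro triangle gM) auto
        ultimately show ?case using gM[OF x] k(2) by simp
      qed
    qed
    show ?thesis unfolding B1_def using fM g lim by (auto intro!: exI[of _ "\<lambda>N. g N N"])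
  qed
qed

end

section \<open>Pointwise limits of continuous functions\<close>

text \<open>The sum of the \<open>g m\<close> with weights \<open>(1/2) ^ Suc m\<close> converges
  uniformly and, its terms being nonnegative, vanishes exactly where all of them do.\<close>

lemma functionally_closed_in_all_zero:
  fixes g :: "nat \<Rightarrow> 'a \<Rightarrow> real"
  assumes cont: "\<And>m. continuous_map X euclideanreal (g m)"
    and bounds: "\<And>m x. x \<in> topspace X \<Longrightarrow> 0 \<le> g m x \<and> g m x \<le> 1"
  shows "functionally_closed_in X {x \<in> topspace X. \<forall>m. g m x = 0}"
proof -
  define h where "h x = (\<Sum>m. (1/2) ^ Suc m * g m x)" for x
  have le: "0 \<le> (1/2) ^ Suc m * g m x" "(1/2) ^ Suc m * g m x \<le> (1/2) ^ Suc m" if "x \<in> topspace X" for m x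
    using bounds[OF that, of m] by (auto intro: mult_left_le)
  have sums1: "(\<lambda>n. (1/2 :: real) ^ Suc n) sums 1" by (rule power_half_series)
  have summable: "summable (\<lambda>m. (1/2) ^ Suc m * g m x)" if "x \<in> topspace X" for x
    using le[OF that] by (intro summable_comparison_test'[OF sums_summable[OF sums1], of 0]) (simp del: power_Suc)
  have unif: "uniform_limit (topspace X) (\<lambda>n x. \<Sum>m<n. (1/2) ^ Suc m * g m x) h sequentially"
    unfolding h_def
    by (rule Weierstrass_m_test[OF _ sums_summable[OF sums1]]) (use le in \<open>simp del: power_Suc\<close>)
  have "continuous_map X Met_TC.mtopology h"
  proof (rule Met_TC.continuous_map_uniform_limit)
    show "\<forall>\<^sub>F n in sequentially. continuous_map X Met_TC.mtopology (\<lambda>x. \<Sum>m<n. (1/2) ^ Suc m * g m x)"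
      using cont by (intro always_eventually allI) (simp add: continuous_map_sum continuous_map_real_mult_left del: power_Suc)
    show "\<forall>\<^sub>F n in sequentially. \<forall>x\<in>topspace X. h x \<in> UNIV \<and> dist (\<Sum>m<n. (1/2) ^ Suc m * g m x) (h x) < e"
      if "0 < e" for e
      using unif that unfolding uniform_limit_iff by (simp del: power_Suc)
  qed simp
  then have "continuous_map X euclideanreal h" by simp
  moreover have h01: "0 \<le> h x \<and> h x \<le> 1" if "x \<in> topspace X" for x
  proof
    show "0 \<le> h x" unfolding h_def using le[OF that] summable[OF that] by (intro suminf_nonneg)
    have "h x \<le> (\<Sum>n. (1/2) ^ Suc n)"
      unfolding h_def using le[OF that] summable[OF that] sums_summable[OF sums1] by (intro suminf_le)
    then show "h x \<le> 1" using sums_unique[OF sums1] by simp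
  qed
  moreover have "h x = 0 \<longleftrightarrow> (\<forall>m. g m x = 0)" if "x \<in> topspace X" for x
    unfolding h_def using suminf_eq_zero_iff[OF summable[OF that]] le[OF that] by simp
  ultimately show ?thesis unfolding functionally_closed_in_def
    by (intro exI[of _ h]) (auto simp: continuous_map_in_subtopology)
qed

lemma functionally_open_in_preimage:
  assumes "functionally_open_in Y V" "continuous_map X Y g"
  shows "functionally_open_in X {x \<in> topspace X. g x \<in> V}"
proof -
  obtain h where h: "continuous_map Y (top_of_set {0..1::real}) h" "topspace Y - V = {y \<in> topspace Y. h y = 0}"
    using assms(1) unfolding functionally_open_in_def functionally_closed_in_def by (elim exE conjE)
  have gY: "g x \<in> topspace Y" if "x \<in> topspace X" for x
    using assms(2) that by (simp add: continuous_map_def Pi_iff)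
  have "continuous_map X (top_of_set {0..1::real}) (h \<circ> g)"
    by (rule continuous_map_compose[OF assms(2) h(1)])
  moreover have "topspace X - {x \<in> topspace X. g x \<in> V} = {x \<in> topspace X. (h \<circ> g) x = 0}"
  proof (intro set_eqI)
    fix x
    show "x \<in> topspace X - {x \<in> topspace X. g x \<in> V} \<longleftrightarrow> x \<in> {x \<in> topspace X. (h \<circ> g) x = 0}"
      using gY[of x] h(2)[unfolded set_eq_iff, rule_format, of "g x"] by auto
  qed
  ultimately show ?thesis unfolding functionally_open_in_def functionally_closed_in_def by auto
qed

text \<open>\<open>sigma_sfd_in\<close> uses families indexed by their own members. Choosing one
  index for each member passes from an indexed family, possibly with repetitions, to such a
  family.\<close>

lemma sfd_family_in_image:
  assumes "sfd_family_in X I A"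
  shows "sfd_family_in X (A ` I) id"
proof -
  obtain U where U: "discrete_family_in X I U" "\<forall>i\<in>I. functionally_open_in X (U i)"
    "\<forall>i\<in>I. X closure_of (A i) \<subseteq> U i"
    using assms unfolding sfd_family_in_def by (elim exE conjE)
  define c where "c = inv_into I A"
  have c: "c a \<in> I" "A (c a) = a" if "a \<in> A ` I" for a
    using that by (simp_all add: c_def inv_into_into f_inv_into_f)
  have "discrete_family_in X (A ` I) (\<lambda>a. U (c a))"
    unfolding discrete_family_in_def
  proof
    fix x assume "x \<in> topspace X"
    with U(1)[unfolded discrete_family_in_def]
    have "\<exists>W. openin X W \<and> x \<in> W \<and> (\<forall>i\<in>I. \<forall>j\<in>I. W \<inter> U i \<noteq> {} \<and> W \<inter> U j \<noteq> {} \<longrightarrow> i = j)" by (rule bspec)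
    then obtain W where W: "openin X W" "x \<in> W" "\<forall>i\<in>I. \<forall>j\<in>I. W \<inter> U i \<noteq> {} \<and> W \<inter> U j \<noteq> {} \<longrightarrow> i = j"
      by (elim exE conjE)
    have "a = b" if "a \<in> A ` I" "b \<in> A ` I" "W \<inter> U (c a) \<noteq> {} \<and> W \<inter> U (c b) \<noteq> {}" for a b
    proof -
      have "c a = c b" using W(3)[rule_format, OF c(1)[OF that(1)] c(1)[OF that(2)] that(3)] .
      from arg_cong[OF this, of A] show ?thesis unfolding c(2)[OF that(1)] c(2)[OF that(2)] .
    qed
    note eq = this
    show "\<exists>W. openin X W \<and> x \<in> W \<and>
        (\<forall>a\<in>A ` I. \<forall>b\<in>A ` I. W \<inter> U (c a) \<noteq> {} \<and> W \<inter> U (c b) \<noteq> {} \<longrightarrow> a = b)"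
      by (intro exI[of _ W] conjI ballI impI W(1,2)) (rule eq)
  qed
  moreover have "\<forall>a\<in>A ` I. functionally_open_in X (U (c a))" using U(2) c(1) by simp
  moreover have "\<forall>a\<in>A ` I. X closure_of (id a) \<subseteq> U (c a)"
  proof
    fix a assume "a \<in> A ` I"
    then show "X closure_of (id a) \<subseteq> U (c a)" using U(3)[rule_format, OF c(1)] c(2) by simp
  qed
  ultimately show ?thesis unfolding sfd_family_in_def by (intro exI[of _ "\<lambda>a. U (c a)"] conjI)
qed

section \<open>Limits of continuous maps into a metric space belong to \<open>K1\<close> and
  \<open>Sigma_f\<close>\<close>

context Metric_space
begin

lemma functionally_open_in_mtopology:
  assumes "openin mtopology V"
  shows "functionally_open_in mtopology V"
proof -
  have VM: "V \<subseteq> M" using openin_subset[OF assms] by simp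
  have "functionally_closed_in mtopology (M - V)"
  proof (cases "M - V = {}")
    case True
    show ?thesis unfolding True functionally_closed_in_def by (intro exI[of _ "\<lambda>x. 1"]) simp
  next
    case False
    define \<rho> where "\<rho> y = (INF z\<in>M - V. d y z)" for y
    have bdd: "bdd_below (d y ` (M - V))" for y by (intro bdd_belowI2[of _ 0]) simp
    have \<rho>_le: "\<rho> y \<le> d y z" if "z \<in> M - V" for y z unfolding \<rho>_def using that bdd by (intro cINF_lower)
    have \<rho>_ge: "c \<le> \<rho> y" if "\<And>z. z \<in> M - V \<Longrightarrow> c \<le> d y z" for c y
      unfolding \<rho>_def using that False by (intro cINF_greatest)
    have lip: "\<rho> x - d x y \<le> \<rho> y" if "x \<in> M" "y \<in> M" for x y
    proof (rule \<rho>_ge)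
      fix z assume z: "z \<in> M - V"
      have "d x z \<le> d x y + d y z" using triangle that z by simp
      then show "\<rho> x - d x y \<le> d y z" using \<rho>_le[OF z, of x] by simp
    qed
    have "continuous_map mtopology euclideanreal \<rho>"
      unfolding continuous_map_real_iff
    proof (intro ballI allI impI)
      fix x and e :: real assume "x \<in> topspace mtopology" and e: "0 < e"
      then have x: "x \<in> M" by simp
      have "\<bar>\<rho> y - \<rho> x\<bar> < e" if "y \<in> mball x e" for y
        using lip[of x y] lip[of y x] that x commute[of x y] by auto
      then show "\<exists>U. openin mtopology U \<and> x \<in> U \<and> (\<forall>y\<in>U. \<bar>\<rho> y - \<rho> x\<bar> < e)"
        using x e by (intro exI[of _ "mball x e"]) simp
    qed
    then have "continuous_map mtopology (top_of_set {0..1}) (\<lambda>y. clamp01 (\<rho> y))"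
      by (simp add: continuous_map_in_subtopology continuous_map_clamp01 Pi_iff)
    moreover have "M - V = {y \<in> M. clamp01 (\<rho> y) = 0}"
    proof (intro set_eqI)
      fix y
      show "y \<in> M - V \<longleftrightarrow> y \<in> {y \<in> M. clamp01 (\<rho> y) = 0}"
      proof (cases "y \<in> V")
        case True
        then obtain s where s: "s > 0" "mball y s \<subseteq> V" using assms unfolding openin_mtopology by blast
        have "s \<le> \<rho> y"
        proof (rule \<rho>_ge)
          fix z assume z: "z \<in> M - V"
          then have "z \<notin> mball y s" using s(2) by blast
          then show "s \<le> d y z" using z True VM by auto
        qed
        then have "clamp01 (\<rho> y) \<noteq> 0" using s(1) clamp01_simps(5)[of "\<rho> y"] by linarith
        then show ?thesis using True by simp
      next
        case False
        have "clamp01 (\<rho> y) = 0" if "y \<in> M"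
          using \<rho>_le[of y y] that False by simp
        then show ?thesis using False by auto
      qed
    qed
    ultimately show ?thesis unfolding functionally_closed_in_def
      by (intro exI[of _ "\<lambda>y. clamp01 (\<rho> y)"]) simp
  qed
  then show ?thesis using VM by (simp add: functionally_open_in_def)
qed

lemma B1_E:
  assumes "f \<in> B1 X mtopology"
  obtains fn :: "nat \<Rightarrow> _" where "f \<in> topspace X \<rightarrow> M" "\<forall>n. continuous_map X mtopology (fn n)"
    "\<forall>x\<in>topspace X. limitin mtopology (\<lambda>n. fn n x) (f x) sequentially"
  using assms unfolding B1_def by auto

text \<open>With \<open>V\<close> the cozero set of \<open>u\<close>, a limit value lies in
  \<open>V\<close> iff for some \<open>k\<close> the values \<open>u (fn m x)\<close> are eventually
  at least \<open>1 / (k + 1)\<close>. The weak inequality for all \<open>m \<ge> n\<close> is a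
  countable intersection of zero sets.\<close>

lemma B1_subset_K1: "B1 X mtopology \<subseteq> K1 X mtopology"
proof
  fix f assume "f \<in> B1 X mtopology"
  then obtain fn where fM: "f \<in> topspace X \<rightarrow> M" and cont: "\<forall>n. continuous_map X mtopology (fn n)"
    and lim: "\<forall>x\<in>topspace X. limitin mtopology (\<lambda>n. fn n x) (f x) sequentially"
    by (rule B1_E)
  have "functionally_fsigma_in X {x \<in> topspace X. f x \<in> V}" if V: "openin mtopology V" for V
  proof -
    obtain u where u: "continuous_map mtopology euclideanreal u" "\<forall>x\<in>topspace mtopology. 0 \<le> u x \<and> u x \<le> 1"
      "V = {x \<in> topspace mtopology. 0 < u x}"
      using functionally_open_in_mtopology[OF V] by (rule functionally_open_inE)
    define Z where "Z k n = {x \<in> topspace X. \<forall>m. clamp01 (1 / real (Suc k) - u (fn (n + m) x)) = 0}" for k n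
    have Z_iff: "x \<in> Z k n \<longleftrightarrow> x \<in> topspace X \<and> (\<forall>m\<ge>n. 1 / real (Suc k) \<le> u (fn m x))" for k n x
    proof -
      have "clamp01 t = 0 \<longleftrightarrow> t \<le> 0" for t by (simp add: clamp01_def max_def min_def)
      then show ?thesis unfolding Z_def by (auto simp: nat_le_iff_add)
    qed
    have "functionally_closed_in X (Z k n)" for k n
      unfolding Z_def
    proof (rule functionally_closed_in_all_zero)
      fix m
      have "continuous_map X euclideanreal (u \<circ> fn (n + m))" by (rule continuous_map_compose[OF _ u(1)]) (simp add: cont)
      then show "continuous_map X euclideanreal (\<lambda>x. clamp01 (1 / real (Suc k) - u (fn (n + m) x)))"
        by (intro continuous_map_clamp01 continuous_map_diff) (simp_all add: comp_def)
    qed simp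
    moreover have "(\<Union>k n. Z k n) = {x \<in> topspace X. f x \<in> V}"
    proof (intro set_eqI)
      fix x
      show "x \<in> (\<Union>k n. Z k n) \<longleftrightarrow> x \<in> {x \<in> topspace X. f x \<in> V}"
      proof (cases "x \<in> topspace X")
        case True
        have "limitin euclideanreal (u \<circ> (\<lambda>n. fn n x)) (u (f x)) sequentially"
          by (rule continuous_map_limit[OF u(1)]) (simp add: lim True)
        then have conv: "(\<lambda>n. u (fn n x)) \<longlonglongrightarrow> u (f x)" by (simp add: comp_def)
        have iff: "f x \<in> V \<longleftrightarrow> 0 < u (f x)" using u(3) fM True by auto
        show ?thesis
        proof
          assume "x \<in> (\<Union>k n. Z k n)"
          then obtain k n where "\<forall>m\<ge>n. 1 / real (Suc k) \<le> u (fn m x)" using Z_iff by blast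
          then have "1 / real (Suc k) \<le> u (f x)" using conv by (intro LIMSEQ_le_const) blast+
          then have "0 < u (f x)" by (rule less_le_trans[rotated]) simp
          then show "x \<in> {x \<in> topspace X. f x \<in> V}" using iff True by simp
        next
          assume "x \<in> {x \<in> topspace X. f x \<in> V}"
          then have "0 < u (f x)" using iff by simp
          then obtain k where k: "1 / real (Suc k) < u (f x)" using nat_approx_posE by blast
          then have "\<forall>\<^sub>F m in sequentially. 1 / real (Suc k) < u (fn m x)"
            using conv by (intro order_tendstoD(1))
          then obtain n where "\<forall>m\<ge>n. 1 / real (Suc k) < u (fn m x)" unfolding eventually_sequentially ..
          then have "x \<in> Z k n" unfolding Z_iff using True by (simp add: less_imp_le)
          then show "x \<in> (\<Union>k n. Z k n)" by blast
        qed
      qed (use Z_iff in blast)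
    qed
    moreover have "\<Union>(range (\<lambda>(k, n). Z k n)) = (\<Union>k n. Z k n)" by auto
    ultimately show ?thesis unfolding functionally_fsigma_in_def union_of_def
      by (intro exI[of _ "range (\<lambda>(k, n). Z k n)"] conjI) auto
  qed
  then show "f \<in> K1 X mtopology" using fM by (simp add: K1_def)
qed

text \<open>Each point is assigned the first centre, in a well-ordering, at distance less than \<^term>\<open>r\<close>; leaving a
  margin of \<open>1 / Suc n\<close> makes the resulting pieces uniformly separated (A. H. Stone).\<close>

lemma exists_separated_cover:
  assumes "0 < r"
  shows "\<exists>A :: nat \<Rightarrow> 'a \<Rightarrow> 'a set. (\<forall>n y x. x \<in> A n y \<longrightarrow> x \<in> M \<and> y \<in> M \<and> d x y < r) \<and>
      (\<forall>x. x \<in> M \<longrightarrow> (\<exists>n y. x \<in> A n y)) \<and>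
      (\<forall>n y y' x x'. x \<in> A n y \<longrightarrow> x' \<in> A n y' \<longrightarrow> y \<noteq> y' \<longrightarrow> 1 / real (Suc n) \<le> d x x')"
proof -
  obtain R :: "'a rel" where R: "well_order_on UNIV R" using well_order_on by blast
  have wf: "wf (R - Id)" and antisym: "antisym R" and total: "total R" and refl: "refl R"
    using R by (auto simp: well_order_on_def linear_order_on_def partial_order_on_def preorder_on_def)
  define A where "A n y = {x \<in> M. y \<in> M \<and> d x y \<le> r - 1 / real (Suc n) \<and> (\<forall>z\<in>M. d x z < r \<longrightarrow> (y, z) \<in> R)}"
    for n y
  have A_ball: "x \<in> M \<and> y \<in> M \<and> d x y < r" if x: "x \<in> A n y" for n y x
  proof -
    have "x \<in> M" "y \<in> M" "d x y \<le> r - 1 / real (Suc n)" using x by (simp_all add: A_def)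
    moreover have "0 < 1 / real (Suc n)" by simp
    ultimately show ?thesis by (intro conjI) linarith+
  qed
  have A_cover: "\<exists>n y. x \<in> A n y" if x: "x \<in> M" for x
  proof -
    have "x \<in> {z \<in> M. d x z < r}" using x assms by simp
    from wf[unfolded wf_eq_minimal, rule_format, OF this] obtain y where y: "y \<in> {z \<in> M. d x z < r}"
      and min: "\<forall>z. (z, y) \<in> R - Id \<longrightarrow> z \<notin> {z \<in> M. d x z < r}"
      by (elim bexE)
    have "(y, z) \<in> R" if "z \<in> M" "d x z < r" for z
    proof (cases "y = z")
      case True
      then show ?thesis using refl by (simp add: refl_on_def)
    next
      case False
      then have "(z, y) \<notin> R" using min[rule_format, of z] that by auto
      then show ?thesis using total False by (simp add: total_on_def) blast
    qed
    moreover obtain n where "1 / real (Suc n) < r - d x y" using y nat_approx_posE[of "r - d x y"] by auto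
    ultimately have "x \<in> A n y" unfolding A_def using x y by simp
    then show ?thesis by (intro exI)
  qed
  have A_sep: "1 / real (Suc n) \<le> d x x'" if x: "x \<in> A n y" and x': "x' \<in> A n y'" and "y \<noteq> y'"
    for n y y' x x'
  proof -
    have M: "x \<in> M" "y \<in> M" "x' \<in> M" "y' \<in> M" using x x' by (auto simp: A_def)
    have "\<not> ((y, y') \<in> R \<and> (y', y) \<in> R)" using antisym \<open>y \<noteq> y'\<close> unfolding antisym_def by blast
    \<comment> \<open>The earlier of the two centres lies at distance at least \<open>r\<close> from
      the point assigned to the later one, but within \<open>r - 1 / (n + 1)\<close> of its own
      point.\<close>
    then have "r \<le> d x y' \<or> r \<le> d x' y" using x x' M unfolding A_def by force
    moreover have "d x y \<le> r - 1 / real (Suc n)" "d x' y' \<le> r - 1 / real (Suc n)"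
      using x x' by (simp_all add: A_def)
    moreover have "d x y' \<le> d x x' + d x' y'" "d x' y \<le> d x' x + d x y" using M triangle by blast+
    ultimately show ?thesis using commute[of x x'] by linarith
  qed
  show ?thesis
  proof (rule exI[of _ A], intro conjI)
    show "\<forall>n y x. x \<in> A n y \<longrightarrow> x \<in> M \<and> y \<in> M \<and> d x y < r" using A_ball by simp
    show "\<forall>x. x \<in> M \<longrightarrow> (\<exists>n y. x \<in> A n y)" using A_cover by simp
    show "\<forall>n y y' x x'. x \<in> A n y \<longrightarrow> x' \<in> A n y' \<longrightarrow> y \<noteq> y' \<longrightarrow> 1 / real (Suc n) \<le> d x x'"
      using A_sep by (intro allI impI)
  qed
qed

text \<open>Discrete families can be pulled back along the continuous \<open>fn m\<close>, but not
  along \<open>f\<close>. The extra condition that all later values stay within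
  \<open>(1/2) ^ j\<close> of \<open>fn m x\<close> transfers smallness from \<open>fn m\<close> to
  \<open>f\<close>, and by convergence every point satisfies it for some \<open>m\<close>.\<close>

lemma B1_subset_Sigma_f: "B1 X mtopology \<subseteq> Sigma_f X mtopology"
proof
  fix f assume "f \<in> B1 X mtopology"
  then obtain fn where fM: "f \<in> topspace X \<rightarrow> M" and cont: "\<forall>n. continuous_map X mtopology (fn n)"
    and lim: "\<forall>x\<in>topspace X. limitin mtopology (\<lambda>n. fn n x) (f x) sequentially"
    by (rule B1_E)
  have fnM: "fn m x \<in> M" if "x \<in> topspace X" for m x
    using cont that by (simp add: continuous_map_def Pi_iff)
  have fM': "f x \<in> M" if "x \<in> topspace X" for x using fM that by blast
  have "\<forall>j. \<exists>A :: nat \<Rightarrow> 'a \<Rightarrow> 'a set. (\<forall>n y x. x \<in> A n y \<longrightarrow> x \<in> M \<and> y \<in> M \<and> d x y < (1/2) ^ j) \<and>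
      (\<forall>x. x \<in> M \<longrightarrow> (\<exists>n y. x \<in> A n y)) \<and>
      (\<forall>n y y' x x'. x \<in> A n y \<longrightarrow> x' \<in> A n y' \<longrightarrow> y \<noteq> y' \<longrightarrow> 1 / real (Suc n) \<le> d x x')"
    by (intro allI exists_separated_cover) simp
  from choice[OF this] obtain A :: "nat \<Rightarrow> nat \<Rightarrow> 'a \<Rightarrow> 'a set" where
    A: "\<forall>j. (\<forall>n y x. x \<in> A j n y \<longrightarrow> x \<in> M \<and> y \<in> M \<and> d x y < (1/2) ^ j) \<and>
      (\<forall>x. x \<in> M \<longrightarrow> (\<exists>n y. x \<in> A j n y)) \<and>
      (\<forall>n y y' x x'. x \<in> A j n y \<longrightarrow> x' \<in> A j n y' \<longrightarrow> y \<noteq> y' \<longrightarrow> 1 / real (Suc n) \<le> d x x')"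
    by (elim exE)
  have A_ball: "x \<in> M \<and> y \<in> M \<and> d x y < (1/2) ^ j" if "x \<in> A j n y" for j n y x using A that by simp
  have A_cover: "\<exists>n y. x \<in> A j n y" if "x \<in> M" for j x using A that by simp
  have A_sep: "1 / real (Suc n) \<le> d x x'" if "x \<in> A j n y" "x' \<in> A j n y'" "y \<noteq> y'" for j n y y' x x'
    using A[rule_format, of j] that by (elim conjE) simp
  define S where "S m j n y = {x \<in> topspace X. fn m x \<in> A j n y \<and> (\<forall>m'\<ge>m. d (fn m' x) (fn m x) \<le> (1/2) ^ j)}"
    for m j n y
  have sfd: "sfd_family_in X UNIV (S m j n)" for m j n
  proof -
    \<comment> \<open>A quarter of the separation of the pieces: if the neighbourhood of a point met
      two of the sets \<open>U y\<close>, four steps shorter than \<delta> would join points of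
      different pieces.\<close>
    define \<delta> where "\<delta> = 1 / (4 * real (Suc n))"
    have "0 < \<delta>" and \<delta>4: "4 * \<delta> = 1 / real (Suc n)" by (simp_all add: \<delta>_def field_simps)
    define V where "V y = (\<Union>a\<in>A j n y. mball a \<delta>)" for y
    define U where "U y = {x \<in> topspace X. fn m x \<in> V y}" for y
    have nbhd: "openin X {z \<in> topspace X. fn m z \<in> mball (fn m x) \<delta>}" for x
      by (rule openin_continuous_map_preimage[OF cont[rule_format]]) simp
    have "discrete_family_in X UNIV U"
      unfolding discrete_family_in_def
    proof (intro ballI)
      fix x assume x: "x \<in> topspace X"
      let ?W = "{z \<in> topspace X. fn m z \<in> mball (fn m x) \<delta>}"
      have "y = y'" if "?W \<inter> U y \<noteq> {}" "?W \<inter> U y' \<noteq> {}" for y y'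
      proof (rule ccontr)
        assume "y \<noteq> y'"
        obtain z where "z \<in> ?W" "z \<in> U y" using \<open>?W \<inter> U y \<noteq> {}\<close> by blast
        then obtain a where a: "a \<in> A j n y" "fn m z \<in> mball a \<delta>" by (auto simp: U_def V_def)
        obtain z' where "z' \<in> ?W" "z' \<in> U y'" using \<open>?W \<inter> U y' \<noteq> {}\<close> by blast
        then obtain a' where a': "a' \<in> A j n y'" "fn m z' \<in> mball a' \<delta>" by (auto simp: U_def V_def)
        have d4: "d a (fn m z) < \<delta>" "d (fn m x) (fn m z) < \<delta>" "d a' (fn m z') < \<delta>" "d (fn m x) (fn m z') < \<delta>"
          and M: "a \<in> M" "fn m z \<in> M" "a' \<in> M" "fn m z' \<in> M" "fn m x \<in> M"
          using a a' \<open>z \<in> ?W\<close> \<open>z' \<in> ?W\<close> by auto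
        have "d a a' \<le> d a (fn m z) + d (fn m z) a'" "d (fn m z) a' \<le> d (fn m z) (fn m x) + d (fn m x) a'"
          "d (fn m x) a' \<le> d (fn m x) (fn m z') + d (fn m z') a'"
          using M by (blast intro: triangle)+
        then have "d a a' < 4 * \<delta>" using d4 commute[of "fn m z" "fn m x"] commute[of "fn m z'" a'] by linarith
        then show False using A_sep[OF a(1) a'(1) \<open>y \<noteq> y'\<close>] \<delta>4 by linarith
      qed
      note disc = this
      have "x \<in> ?W" using x fnM[OF x, of m] \<open>0 < \<delta>\<close> by simp
      then show "\<exists>W. openin X W \<and> x \<in> W \<and> (\<forall>i\<in>UNIV. \<forall>i'\<in>UNIV. W \<inter> U i \<noteq> {} \<and> W \<inter> U i' \<noteq> {} \<longrightarrow> i = i')"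
      proof (intro exI[of _ ?W] conjI ballI impI)
        show "openin X ?W" by (rule nbhd)
        show "i = i'" if "?W \<inter> U i \<noteq> {} \<and> ?W \<inter> U i' \<noteq> {}" for i i'
          by (rule disc[OF conjunct1[OF that] conjunct2[OF that]])
      qed
    qed
    moreover have "functionally_open_in X (U y)" for y
      unfolding U_def V_def using cont
      by (intro functionally_open_in_preimage[OF functionally_open_in_mtopology]) auto
    moreover have "X closure_of (S m j n y) \<subseteq> U y" for y
    proof
      fix x assume x: "x \<in> X closure_of (S m j n y)"
      note x' = this[unfolded in_closure_of]
      note xt = conjunct1[OF x'] and meets = conjunct2[OF x']
      have "x \<in> {z \<in> topspace X. fn m z \<in> mball (fn m x) \<delta>}" using xt fnM[OF xt] \<open>0 < \<delta>\<close> by simp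
      from meets[rule_format, OF conjI[OF this nbhd]]
      obtain z where z: "z \<in> S m j n y" "z \<in> {z \<in> topspace X. fn m z \<in> mball (fn m x) \<delta>}"
        by (elim exE conjE)
      then have "fn m z \<in> A j n y" "fn m x \<in> mball (fn m z) \<delta>" using commute by (auto simp: S_def)
      then show "x \<in> U y" unfolding U_def V_def using xt by blast
    qed
    ultimately show ?thesis unfolding sfd_family_in_def by (intro exI[of _ U] conjI ballI)
  qed
  define \<B>n where "\<B>n i = (case from_nat i of (m, j, n) \<Rightarrow> range (S m j n))" for i
  define \<B> where "\<B> = (\<Union>i. \<B>n i)"
  have S_in: "S m j n y \<in> \<B>" for m j n y
    unfolding \<B>_def \<B>n_def by (rule UN_I[of "to_nat (m, j, n)"]) simp_all
  have "sfd_family_in X (\<B>n i) id" for i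
  proof -
    obtain m j n :: nat where "from_nat i = (m, j, n)" by (metis prod_cases3)
    then show ?thesis unfolding \<B>n_def using sfd_family_in_image[OF sfd] by simp
  qed
  then have "sigma_sfd_in X \<B>" unfolding sigma_sfd_in_def \<B>_def by blast
  moreover have "is_base_for X mtopology \<B> f"
    unfolding is_base_for_def
  proof (intro allI impI)
    fix V assume V: "openin mtopology V"
    let ?P = "{x \<in> topspace X. f x \<in> V}"
    have "?P \<subseteq> \<Union>{b \<in> \<B>. b \<subseteq> ?P}"
    proof
      fix x assume "x \<in> ?P"
      then have x: "x \<in> topspace X" "f x \<in> V" by auto
      obtain s where s: "0 < s" "mball (f x) s \<subseteq> V" using V x(2) unfolding openin_mtopology by blast
      obtain j :: nat where "(1/2) ^ j < s / 4" using real_arch_pow_inv[of "s / 4" "1/2"] s(1) by auto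
      define r :: real where "r = (1/2) ^ j"
      \<comment> \<open>The four steps lead from \<open>f x\<close> to \<open>fn m x\<close>, to the
        centre \<open>y\<close>, to \<open>fn m z\<close> and to \<open>f z\<close>, each of length
        at most \<open>r\<close>.\<close>
      have r: "4 * r < s" "0 < r" using \<open>(1/2) ^ j < s / 4\<close> by (simp_all add: r_def)
      have "\<forall>\<^sub>F m in sequentially. fn m x \<in> M \<and> d (fn m x) (f x) < r / 2"
        using lim[rule_format, OF x(1), unfolded limitin_metric] half_gt_zero[OF r(2)] by blast
      then obtain m where m: "\<forall>m'\<ge>m. fn m' x \<in> M \<and> d (fn m' x) (f x) < r / 2"
        unfolding eventually_sequentially ..
      have osc: "d (fn m' x) (fn m x) \<le> r" if "m' \<ge> m" for m'
      proof -
        have "d (fn m' x) (fn m x) \<le> d (fn m' x) (f x) + d (f x) (fn m x)"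
          by (intro triangle fnM fM' x(1))
        then show ?thesis using m[rule_format, OF that] m[rule_format, of m] commute[of "f x"] by simp
      qed
      obtain n y where A1: "fn m x \<in> A j n y" using A_cover[OF fnM[OF x(1)]] by blast
      have xS: "x \<in> S m j n y" using x(1) A1 osc by (simp add: S_def r_def)
      have near: "d (f z) (fn m z) \<le> r" if z: "z \<in> S m j n y" for z
      proof (rule field_le_epsilon)
        fix e :: real assume "0 < e"
        have zt: "z \<in> topspace X" using z by (simp add: S_def)
        have "\<forall>\<^sub>F m in sequentially. fn m z \<in> M \<and> d (fn m z) (f z) < e"
          using lim[rule_format, OF zt, unfolded limitin_metric] \<open>0 < e\<close> by blast
        then obtain m0 where "\<forall>m'\<ge>m0. fn m' z \<in> M \<and> d (fn m' z) (f z) < e"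
          unfolding eventually_sequentially ..
        then have "d (fn (max m m0) z) (f z) < e" by simp
        moreover have "d (fn (max m m0) z) (fn m z) \<le> r" using z by (simp add: S_def r_def)
        moreover have "d (f z) (fn m z) \<le> d (f z) (fn (max m m0) z) + d (fn (max m m0) z) (fn m z)"
          by (intro triangle fnM fM' zt)
        ultimately show "d (f z) (fn m z) \<le> r + e" using commute[of "f z"] by simp
      qed
      have "z \<in> ?P" if z: "z \<in> S m j n y" for z
      proof -
        have zt: "z \<in> topspace X" and zA: "fn m z \<in> A j n y" using z by (simp_all add: S_def)
        have "y \<in> M" "d (fn m z) y < r" "d (fn m x) y < r" using A_ball[OF zA] A_ball[OF A1] by (simp_all add: r_def)
        moreover have "d (f x) (f z) \<le> d (f x) (fn m x) + d (fn m x) (f z)"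
          "d (fn m x) (f z) \<le> d (fn m x) y + d y (f z)"
          by (intro triangle fnM fM' x(1) zt \<open>y \<in> M\<close>)+
        moreover have "d y (f z) \<le> d y (fn m z) + d (fn m z) (f z)"
          by (intro triangle fnM fM' x(1) zt \<open>y \<in> M\<close>)
        ultimately have "d (f x) (f z) < 4 * r"
          using near[OF z] near[OF xS] commute[of y "fn m z"] commute[of "fn m z" "f z"] by linarith
        then have "f z \<in> mball (f x) s" using r(1) fM'[OF zt] fM'[OF x(1)] by simp
        then show ?thesis using s(2) zt by blast
      qed
      then have "S m j n y \<in> {b \<in> \<B>. b \<subseteq> ?P}" using S_in by blast
      then show "x \<in> \<Union>{b \<in> \<B>. b \<subseteq> ?P}" using xS by blast
    qed
    then have "\<Union>{b \<in> \<B>. b \<subseteq> ?P} = ?P" by blast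
    then show "\<exists>\<C>\<subseteq>\<B>. \<Union>\<C> = ?P" by (intro exI[of _ "{b \<in> \<B>. b \<subseteq> ?P}"]) simp
  qed
  ultimately show "f \<in> Sigma_f X mtopology" using fM unfolding Sigma_f_def by auto
qed

end

section \<open>Baire category and functions of the first class on closed sets\<close>

text \<open>Otherwise every \<open>F - T\<close> would be relatively open and dense in
  \<open>F\<close>, and the Baire theorem would give a point of \<open>F\<close> that no member
  covers.\<close>

lemma Baire_closed_cover:
  fixes F :: "'a::{real_normed_vector,heine_borel} set"
  assumes "closed F" "F \<noteq> {}" "countable \<C>" and closed: "\<And>T. T \<in> \<C> \<Longrightarrow> closed T" and cover: "F \<subseteq> \<Union>\<C>"
  shows "\<exists>T\<in>\<C>. \<exists>U. open U \<and> U \<inter> F \<noteq> {} \<and> U \<inter> F \<subseteq> T"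
proof (rule ccontr)
  assume no: "\<not> ?thesis"
  have "F \<subseteq> closure (\<Inter>((\<lambda>T. F - T) ` \<C>))"
  proof (rule Baire[OF \<open>closed F\<close>])
    show "countable ((\<lambda>T. F - T) ` \<C>)" using assms(3) by simp
    fix S assume "S \<in> (\<lambda>T. F - T) ` \<C>"
    then obtain T where T: "T \<in> \<C>" "S = F - T" by blast
    have "openin (top_of_set F) (F - T)"
      unfolding Diff_eq by (intro openin_open_Int open_Compl closed[OF T(1)])
    moreover have "F \<subseteq> closure (F - T)"
    proof
      fix x assume x: "x \<in> F"
      have "U \<inter> (F - T) \<noteq> {}" if "open U" "x \<in> U" for U
      proof
        assume "U \<inter> (F - T) = {}"
        then have "open U \<and> U \<inter> F \<noteq> {} \<and> U \<inter> F \<subseteq> T" using that x by blast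
        then show False using no T(1) by blast
      qed
      then show "x \<in> closure (F - T)" unfolding closure_iff_nhds_not_empty by blast
    qed
    ultimately show "openin (top_of_set F) S \<and> F \<subseteq> closure S" using T(2) by simp
  qed
  then have "\<Inter>((\<lambda>T. F - T) ` \<C>) \<noteq> {}" using \<open>F \<noteq> {}\<close> by (metis closure_empty subset_empty)
  then obtain x where "x \<in> \<Inter>((\<lambda>T. F - T) ` \<C>)" by blast
  then have x: "\<forall>T\<in>\<C>. x \<in> F - T" by blast
  obtain z where "z \<in> F" using \<open>F \<noteq> {}\<close> by blast
  then obtain T where "T \<in> \<C>" using cover by blast
  then have "x \<in> F" using x by blast
  then show False using cover x by blast
qed

section \<open>Closed sets and zero sets in metric spaces\<close>

lemma functionally_closed_imp_closedin: "functionally_closed_in X A \<Longrightarrow> closedin X A"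
proof -
  assume "functionally_closed_in X A"
  then obtain g where g: "continuous_map X (top_of_set {0..1::real}) g" "A = {x \<in> topspace X. g x = 0}"
    unfolding functionally_closed_in_def by (elim exE conjE)
  have "continuous_map X euclideanreal g" using g(1) by (simp add: continuous_map_in_subtopology)
  then have "closedin X {x \<in> topspace X. g x \<in> {0}}" by (rule closedin_continuous_map_preimage) simp
  then show ?thesis using g(2) by simp
qed

lemma functionally_fsigma_imp_fsigma: "functionally_fsigma_in X A \<Longrightarrow> fsigma_in X A"
  unfolding functionally_fsigma_in_def fsigma_in_def
  by (erule union_of_mono) (rule functionally_closed_imp_closedin)

lemma closedin_top_of_set_imp_functionally_closed:
  fixes S :: "'a::metric_space set"
  assumes "closedin (top_of_set S) A"
  shows "functionally_closed_in (top_of_set S) A"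
proof -
  obtain T where T: "closed T" "A = S \<inter> T" using assms by (auto simp: closedin_closed)
  show ?thesis
  proof (cases "T = {}")
    case True
    then show ?thesis using T unfolding functionally_closed_in_def by (intro exI[of _ "\<lambda>x. 1"]) simp
  next
    case False
    have "continuous_on S (\<lambda>x. min 1 (infdist x T))" by (intro continuous_intros)
    moreover have "min 1 (infdist x T) = 0 \<longleftrightarrow> x \<in> T" for x
      using in_closed_iff_infdist_zero[OF T(1) False, of x] by (auto simp: min_def)
    ultimately show ?thesis unfolding functionally_closed_in_def T(2)
      by (intro exI[of _ "\<lambda>x. min 1 (infdist x T)"]) (auto simp: infdist_nonneg)
  qed
qed

lemma K1_subset_H1: "K1 X Y \<subseteq> H1 X Y"
  unfolding K1_def H1_def using functionally_fsigma_imp_fsigma by blast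

lemma H1_top_of_set_eq_K1:
  fixes S :: "'a::metric_space set"
  shows "H1 (top_of_set S) Y = K1 (top_of_set S) Y"
proof -
  have "functionally_fsigma_in (top_of_set S) A" if "fsigma_in (top_of_set S) A" for A
    using that unfolding functionally_fsigma_in_def fsigma_in_def
    by (rule union_of_mono) (rule closedin_top_of_set_imp_functionally_closed)
  then have "H1 (top_of_set S) Y \<subseteq> K1 (top_of_set S) Y" unfolding H1_def K1_def by blast
  then show ?thesis using K1_subset_H1 by blast
qed

lemma fsigma_in_top_of_setD:
  assumes "fsigma_in (top_of_set S) A" "closed S"
  shows "\<exists>\<C>. countable \<C> \<and> (\<forall>T\<in>\<C>. closed T) \<and> \<Union>\<C> = A"
proof -
  obtain \<C> where \<C>: "countable \<C>" "\<C> \<subseteq> Collect (closedin (top_of_set S))" "\<Union>\<C> = A"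
    using assms(1) unfolding fsigma_in_def union_of_def by auto
  have "closed T" if "T \<in> \<C>" for T
    using \<C>(2) that assms(2) closedin_closed_trans by blast
  then show ?thesis using \<C>(1,3) by (intro exI[of _ \<C>] conjI ballI)
qed

text \<open>If no fibre of \<^term>\<open>c\<close> had interior in \<^term>\<open>F\<close>, then the saturation of a countable dense set and its
  complement would both be meagre in \<^term>\<open>F\<close>, the complement because its closed subsets miss a dense set.\<close>

lemma fsigma_fibres_locally_constant:
  fixes c :: "'a::{real_normed_vector,heine_borel,second_countable_topology} \<Rightarrow> 'i"
  assumes fs: "\<And>E. fsigma_in (top_of_set K) {x \<in> K. c x \<in> E}" and "closed K"
    and F: "closed F" "F \<subseteq> K" "F \<noteq> {}"
  shows "\<exists>U i. open U \<and> U \<inter> F \<noteq> {} \<and> (\<forall>x\<in>U \<inter> F. c x = i)"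
proof (rule ccontr)
  assume no: "\<not> ?thesis"
  obtain Q where Q: "countable Q" "Q \<subseteq> F" "F \<subseteq> closure Q"
    using separable by metis
  have "\<forall>E. \<exists>\<C>. countable \<C> \<and> (\<forall>T\<in>\<C>. closed T) \<and> \<Union>\<C> = {x \<in> K. c x \<in> E}"
    using fsigma_in_top_of_setD[OF fs \<open>closed K\<close>] by (rule allI)
  from choice[OF this] obtain \<C> where \<C>: "\<forall>E. countable (\<C> E) \<and> (\<forall>T\<in>\<C> E. closed T) \<and> \<Union>(\<C> E) = {x \<in> K. c x \<in> E}"
    by (elim exE)
  have \<C>': "countable (\<C> E)" "T \<in> \<C> E \<Longrightarrow> closed T" "\<Union>(\<C> E) = {x \<in> K. c x \<in> E}" for E T using \<C> by simp_all
  \<comment> \<open>Each colour met by \<open>Q\<close> contributes its own closed pieces; all other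
    colours are lumped together. A lumped piece contains no point of \<open>Q\<close>, which is
    dense in \<open>F\<close>, so it has no relative interior; the piece found by Baire category
    thus has a single colour.\<close>
  define \<D> where "\<D> = (\<Union>q\<in>Q. \<C> {c q}) \<union> \<C> (- c ` Q)"
  have "F \<subseteq> \<Union>\<D>"
  proof
    fix x assume x: "x \<in> F"
    show "x \<in> \<Union>\<D>"
    proof (cases "c x \<in> c ` Q")
      case True
      then obtain q where q: "q \<in> Q" "c x = c q" by blast
      then have "x \<in> {x \<in> K. c x \<in> {c q}}" using x F by auto
      then have "x \<in> \<Union>(\<C> {c q})" unfolding \<C>'(3) .
      then show ?thesis using q(1) unfolding \<D>_def by blast
    next
      case False
      then have "x \<in> {x \<in> K. c x \<in> - c ` Q}" using x F by auto
      then have "x \<in> \<Union>(\<C> (- c ` Q))" unfolding \<C>'(3) .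
      then show ?thesis unfolding \<D>_def by blast
    qed
  qed
  moreover have "countable \<D>" unfolding \<D>_def using Q(1) \<C>'(1) by simp
  moreover have "closed T" if "T \<in> \<D>" for T using that \<C>'(2) unfolding \<D>_def by blast
  ultimately obtain T U where TU: "T \<in> \<D>" "open U" "U \<inter> F \<noteq> {}" "U \<inter> F \<subseteq> T"
    using Baire_closed_cover[OF F(1,3), of \<D>] by blast
  show False
  proof (cases "T \<in> \<C> (- c ` Q)")
    case True
    have "U \<inter> Q \<noteq> {}" using TU(2,3) Q(3) open_Int_closure_eq_empty[of U Q] by blast
    then obtain q where "q \<in> U" "q \<in> Q" by blast
    then have "q \<in> T" using TU(4) Q(2) by blast
    then have "q \<in> \<Union>(\<C> (- c ` Q))" using True by blast
    then have "q \<in> {x \<in> K. c x \<in> - c ` Q}" unfolding \<C>'(3) .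
    then show False using \<open>q \<in> Q\<close> by simp
  next
    case False
    then obtain q where q: "T \<in> \<C> {c q}" using TU(1) unfolding \<D>_def by blast
    have "c x = c q" if "x \<in> U \<inter> F" for x
    proof -
      have "x \<in> \<Union>(\<C> {c q})" using that TU(4) q by blast
      then have "x \<in> {x \<in> K. c x \<in> {c q}}" unfolding \<C>'(3) .
      then show ?thesis by simp
    qed
    then have "\<exists>U i. open U \<and> U \<inter> F \<noteq> {} \<and> (\<forall>x\<in>U \<inter> F. c x = i)" using TU(2,3) by (intro exI[of _ U] exI[of _ "c q"] conjI ballI)
    with no show False by (rule notE)
  qed
qed

text \<open>An argument in the manner of Cantor and Bendixson: discard all basic open sets that meet
  only countably many colours. If something remained, a relatively open part of it would have one
  colour, and a basic set around one of its points would have had to be discarded too.\<close>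

lemma fsigma_fibres_countable_range:
  fixes c :: "'a::{real_normed_vector,heine_borel,second_countable_topology} \<Rightarrow> 'i"
  assumes fs: "\<And>E. fsigma_in (top_of_set K) {x \<in> K. c x \<in> E}" and "closed K"
  shows "countable (c ` K)"
proof -
  obtain \<O> :: "'a set set" where \<O>: "countable \<O>" "topological_basis \<O>" using ex_countable_basis by blast
  define \<W> where "\<W> = {U \<in> \<O>. countable (c ` (U \<inter> K))}"
  have cW: "countable (c ` (\<Union>\<W> \<inter> K))"
  proof -
    have "c ` (\<Union>\<W> \<inter> K) = (\<Union>U\<in>\<W>. c ` (U \<inter> K))" by blast
    moreover have "countable \<W>" using \<O>(1) unfolding \<W>_def by simp
    moreover have "countable (\<Union>U\<in>\<W>. c ` (U \<inter> K))"
      by (rule countable_UN[OF \<open>countable \<W>\<close>]) (simp add: \<W>_def)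
    ultimately show ?thesis by simp
  qed
  have oW: "open (\<Union>\<W>)" using \<O>(2) unfolding \<W>_def by (intro open_Union) (auto intro: topological_basis_open)
  have "K - \<Union>\<W> = {}"
  proof (rule ccontr)
    assume ne: "K - \<Union>\<W> \<noteq> {}"
    have "closed (K - \<Union>\<W>)" using \<open>closed K\<close> oW by (rule closed_Diff)
    from fsigma_fibres_locally_constant[OF fs \<open>closed K\<close> this Diff_subset ne]
    obtain U i where U: "open U" "U \<inter> (K - \<Union>\<W>) \<noteq> {}" "\<forall>x\<in>U \<inter> (K - \<Union>\<W>). c x = i"
      by (elim exE conjE)
    obtain x where x: "x \<in> U" "x \<in> K" "x \<notin> \<Union>\<W>" using U(2) by blast
    obtain V where V: "V \<in> \<O>" "x \<in> V" "V \<subseteq> U" using topological_basisE[OF \<O>(2) U(1) x(1)] by blast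
    have "c ` (V \<inter> K) \<subseteq> insert i (c ` (\<Union>\<W> \<inter> K))"
    proof
      fix y assume "y \<in> c ` (V \<inter> K)"
      then obtain z where z: "z \<in> V" "z \<in> K" "y = c z" by blast
      show "y \<in> insert i (c ` (\<Union>\<W> \<inter> K))"
      proof (cases "z \<in> \<Union>\<W>")
        case True
        then show ?thesis using z by blast
      next
        case False
        then have "c z = i" using z V(3) by (intro U(3)[rule_format]) blast
        then show ?thesis using z(3) by simp
      qed
    qed
    then have "countable (c ` (V \<inter> K))" using cW countable_subset countable_insert by metis
    then have "V \<in> \<W>" using V(1) by (simp add: \<W>_def)
    then show False using V(2) x(3) by blast
  qed
  then have "K = \<Union>\<W> \<inter> K" by blast
  then show ?thesis using cW by simp
qed

text \<open>A one-member family is discrete, with the whole space as its functionally open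
  neighbourhood.\<close>

lemma countable_imp_sigma_sfd_in:
  assumes "countable \<B>"
  shows "sigma_sfd_in X \<B>"
proof -
  define \<B>n where "\<B>n n = (if \<B> = {} then {} else {from_nat_into \<B> n})" for n
  have "functionally_closed_in X {}" unfolding functionally_closed_in_def by (intro exI[of _ "\<lambda>x. 1"]) simp
  then have top: "functionally_open_in X (topspace X)" by (simp add: functionally_open_in_def)
  have "sfd_family_in X (\<B>n n) id" for n
    unfolding sfd_family_in_def
  proof (intro exI[of _ "\<lambda>_. topspace X"] conjI ballI)
    show "discrete_family_in X (\<B>n n) (\<lambda>_. topspace X)"
      unfolding discrete_family_in_def
      by (intro ballI exI[of _ "topspace X"]) (auto simp: \<B>n_def split: if_split_asm)
    show "functionally_open_in X (topspace X)" by (rule top)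
    show "X closure_of (id b) \<subseteq> topspace X" for b by (rule closure_of_subset_topspace)
  qed
  moreover have "\<B> = (\<Union>n. \<B>n n)"
    unfolding \<B>n_def using range_from_nat_into[OF _ assms] by auto
  ultimately show ?thesis unfolding sigma_sfd_in_def by blast
qed

section \<open>Separable ranges of maps of the first class on closed sets\<close>

context Metric_space
begin

text \<open>The separated pieces, thickened to disjoint open sets, colour the points by the piece in
  which their value lies. Any union of thickened pieces is open, so all unions of colour classes are
  F-sigma and only countably many colours occur; the centres of the pieces that are hit form the
  net.\<close>

lemma H1_countable_net:
  assumes f: "f \<in> H1 (top_of_set S) mtopology" and "closed S" and "0 < r"
  shows "\<exists>D. countable D \<and> D \<subseteq> M \<and> (\<forall>x\<in>S. \<exists>y\<in>D. d y (f (x :: 'x::{real_normed_vector,heine_borel,second_countable_topology})) < r)"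
proof -
  have fM: "f x \<in> M" if "x \<in> S" for x using f that by (auto simp: H1_def)
  have fs: "fsigma_in (top_of_set S) {x \<in> S. f x \<in> V}" if "openin mtopology V" for V
    using f that by (simp add: H1_def)
  from exists_separated_cover[OF \<open>0 < r\<close>] obtain A :: "nat \<Rightarrow> 'a \<Rightarrow> 'a set" where
    A: "\<forall>n y x. x \<in> A n y \<longrightarrow> x \<in> M \<and> y \<in> M \<and> d x y < r" "\<forall>x. x \<in> M \<longrightarrow> (\<exists>n y. x \<in> A n y)"
      "\<forall>n y y' x x'. x \<in> A n y \<longrightarrow> x' \<in> A n y' \<longrightarrow> y \<noteq> y' \<longrightarrow> 1 / real (Suc n) \<le> d x x'"
    by (elim exE conjE)
  define D where "D n = {y. \<exists>x\<in>S. f x \<in> A n y}" for n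
  have "countable (D n)" for n
  proof -
    \<comment> \<open>Half the separation, which makes the thickened pieces disjoint.\<close>
    define \<delta> where "\<delta> = 1 / (2 * real (Suc n))"
    have "0 < \<delta>" and \<delta>2: "2 * \<delta> = 1 / real (Suc n)" by (simp_all add: \<delta>_def field_simps)
    define V where "V y = (\<Union>a\<in>A n y. mball a \<delta>)" for y
    have disj: "y = y'" if zy: "z \<in> V y" and zy': "z \<in> V y'" for y y' z
    proof (rule ccontr)
      assume "y \<noteq> y'"
      obtain a where a: "a \<in> A n y" "z \<in> mball a \<delta>" using zy unfolding V_def by blast
      obtain a' where a': "a' \<in> A n y'" "z \<in> mball a' \<delta>" using zy' unfolding V_def by blast
      have "d a a' \<le> d a z + d z a'" using a a' by (intro triangle) auto
      then have "d a a' < 2 * \<delta>" using a(2) a'(2) commute[of a' z] by simp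
      moreover have "1 / real (Suc n) \<le> d a a'" using A(3) a(1) a'(1) \<open>y \<noteq> y'\<close> by simp
      ultimately show False using \<delta>2 by linarith
    qed
    have AV: "A n y \<subseteq> V y" for y
    proof
      fix a assume "a \<in> A n y"
      moreover from this have "a \<in> mball a \<delta>" using A(1) \<open>0 < \<delta>\<close> by simp
      ultimately show "a \<in> V y" unfolding V_def by blast
    qed
    have "openin mtopology (V y)" for y unfolding V_def by (rule openin_Union) auto
    then have oV: "openin mtopology (\<Union>y\<in>E. V y)" for E by (intro openin_Union) auto
    \<comment> \<open>The colour makes sense only where \<open>f\<close> lands in some
      \<open>V y\<close>, and this F-sigma set need not be closed. The colouring lemma wants a
      closed domain, so it is applied to each of countably many closed pieces.\<close>
    from fsigma_in_top_of_setD[OF fs[OF oV[of UNIV]] \<open>closed S\<close>]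
    obtain \<C> where \<C>: "countable \<C>" "\<forall>T\<in>\<C>. closed T" "\<Union>\<C> = {x \<in> S. f x \<in> (\<Union>y\<in>UNIV. V y)}"
      by (elim exE conjE)
    define c where "c x = (THE y. f x \<in> V y)" for x
    have c: "c x = y" if "f x \<in> V y" for x y
      unfolding c_def
    proof (rule the_equality)
      show "f x \<in> V y" by (rule that)
      show "y' = y" if "f x \<in> V y'" for y' by (rule disj[OF that \<open>f x \<in> V y\<close>])
    qed
    have "countable (c ` T)" if T: "T \<in> \<C>" for T
    proof (rule fsigma_fibres_countable_range[OF _ \<C>(2)[rule_format, OF T]])
      fix E
      have "T \<subseteq> {x \<in> S. f x \<in> (\<Union>y\<in>UNIV. V y)}" unfolding \<C>(3)[symmetric] using T by (rule Union_upper)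
      then have TS: "T \<subseteq> S" and TV: "\<And>x. x \<in> T \<Longrightarrow> \<exists>y. f x \<in> V y" by auto
      have "{x \<in> T. c x \<in> E} = {x \<in> S. f x \<in> (\<Union>y\<in>E. V y)} \<inter> T"
      proof (intro set_eqI)
        fix x
        show "x \<in> {x \<in> T. c x \<in> E} \<longleftrightarrow> x \<in> {x \<in> S. f x \<in> (\<Union>y\<in>E. V y)} \<inter> T"
        proof (cases "x \<in> T")
          case True
          then obtain y where y: "f x \<in> V y" using TV by blast
          have "y \<in> E \<longleftrightarrow> f x \<in> (\<Union>y\<in>E. V y)"
          proof
            assume "f x \<in> (\<Union>y\<in>E. V y)"
            then obtain y' where "y' \<in> E" "f x \<in> V y'" by (elim UN_E)
            then show "y \<in> E" using disj[OF y \<open>f x \<in> V y'\<close>] by simp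
          next
            assume "y \<in> E"
            then show "f x \<in> (\<Union>y\<in>E. V y)" using y by (rule UN_I)
          qed
          moreover have "x \<in> S" using TS True by blast
          ultimately show ?thesis using True c[OF y] by simp
        qed simp
      qed
      moreover have "fsigma_in (subtopology (top_of_set S) T) ({x \<in> S. f x \<in> (\<Union>y\<in>E. V y)} \<inter> T)"
        by (rule fsigma_in_subtopology[THEN iffD2]) (rule exI, rule conjI[OF fs[OF oV] refl])
      moreover have "subtopology (top_of_set S) T = top_of_set T"
        using TS by (simp add: subtopology_subtopology Int_absorb1)
      ultimately show "fsigma_in (top_of_set T) {x \<in> T. c x \<in> E}" by simp
    qed
    then have "countable (\<Union>T\<in>\<C>. c ` T)" using \<C>(1) by simp
    moreover have "D n \<subseteq> (\<Union>T\<in>\<C>. c ` T)"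
    proof
      fix y assume "y \<in> D n"
      then obtain x where x: "x \<in> S" "f x \<in> A n y" by (auto simp: D_def)
      then have y: "f x \<in> V y" using AV by blast
      then have "x \<in> \<Union>\<C>" unfolding \<C>(3) using x(1) by blast
      then obtain T where "T \<in> \<C>" "x \<in> T" by blast
      then have "c x \<in> (\<Union>T\<in>\<C>. c ` T)" by (intro UN_I imageI)
      then show "y \<in> (\<Union>T\<in>\<C>. c ` T)" unfolding c[OF y] .
    qed
    ultimately show ?thesis by (rule countable_subset[rotated])
  qed
  then have "countable (\<Union>n. D n)" by simp
  moreover have "(\<Union>n. D n) \<subseteq> M" using A(1) by (auto simp: D_def)
  moreover have "\<exists>y\<in>(\<Union>n. D n). d y (f x) < r" if x: "x \<in> S" for x
  proof -
    from A(2)[rule_format, OF fM[OF x]] obtain n y where y: "f x \<in> A n y" by (elim exE)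
    from A(1)[rule_format, OF this] have "d y (f x) < r" using commute[of y "f x"] by simp
    moreover have "y \<in> D n" using x y by (auto simp: D_def)
    ultimately show ?thesis by blast
  qed
  ultimately show ?thesis by (intro exI[of _ "\<Union>n. D n"]) simp
qed

text \<open>Balls about the points of countable nets of the range have preimages that form a
  countable base for \<open>f\<close>.\<close>

lemma H1_subset_Sigma_f:
  fixes S :: "'x::{real_normed_vector,heine_borel,second_countable_topology} set"
  assumes "closed S"
  shows "H1 (top_of_set S) mtopology \<subseteq> Sigma_f (top_of_set S) mtopology"
proof
  fix f assume f: "f \<in> H1 (top_of_set S) mtopology"
  then have fM: "f \<in> S \<rightarrow> M" by (simp add: H1_def)
  have "\<forall>j. \<exists>D. countable D \<and> D \<subseteq> M \<and> (\<forall>x\<in>S. \<exists>y\<in>D. d y (f x) < (1/2) ^ j)"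
    by (intro allI H1_countable_net[OF f assms]) simp
  from choice[OF this] obtain D :: "nat \<Rightarrow> 'a set" where
    D: "\<forall>j. countable (D j) \<and> D j \<subseteq> M \<and> (\<forall>x\<in>S. \<exists>y\<in>D j. d y (f x) < (1/2) ^ j)" by (elim exE)
  define \<B> where "\<B> = (\<Union>j. (\<lambda>y. {x \<in> S. f x \<in> mball y ((1/2) ^ j)}) ` D j)"
  have "countable \<B>" unfolding \<B>_def using D by simp
  then have "sigma_sfd_in (top_of_set S) \<B>" by (rule countable_imp_sigma_sfd_in)
  moreover have "is_base_for (top_of_set S) mtopology \<B> f"
    unfolding is_base_for_def
  proof (intro allI impI)
    fix V assume V: "openin mtopology V"
    let ?P = "{x \<in> topspace (top_of_set S). f x \<in> V}"
    have "?P \<subseteq> \<Union>{b \<in> \<B>. b \<subseteq> ?P}"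
    proof
      fix x assume "x \<in> ?P"
      then have x: "x \<in> S" "f x \<in> V" by auto
      have fxM: "f x \<in> M" using fM x(1) by blast
      obtain s where s: "0 < s" "mball (f x) s \<subseteq> V" using V x(2) unfolding openin_mtopology by blast
      obtain j :: nat where "(1/2) ^ j < s / 2" using real_arch_pow_inv[of "s / 2" "1/2"] s(1) by auto
      then have j: "2 * (1/2) ^ j < s" by simp
      obtain y where y: "y \<in> D j" "d y (f x) < (1/2) ^ j" using D x(1) by blast
      then have yM: "y \<in> M" using D by blast
      let ?b = "{z \<in> S. f z \<in> mball y ((1/2) ^ j)}"
      have "?b \<in> \<B>" unfolding \<B>_def using y(1) by blast
      moreover have "?b \<subseteq> ?P"
      proof
        fix z assume "z \<in> ?b"
        then have z: "z \<in> S" "d y (f z) < (1/2) ^ j" "f z \<in> M" by auto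
        have "d (f x) (f z) \<le> d (f x) y + d y (f z)" by (intro triangle fxM yM z(3))
        then have "f z \<in> mball (f x) s" using y(2) z j fxM commute[of "f x" y] by simp
        then show "z \<in> ?P" using s(2) z(1) by auto
      qed
      moreover have "x \<in> ?b" using x(1) y(2) yM fxM by simp
      ultimately show "x \<in> \<Union>{b \<in> \<B>. b \<subseteq> ?P}" by blast
    qed
    then have "\<Union>{b \<in> \<B>. b \<subseteq> ?P} = ?P" by blast
    then show "\<exists>\<C>\<subseteq>\<B>. \<Union>\<C> = ?P" by (intro exI[of _ "{b \<in> \<B>. b \<subseteq> ?P}"]) simp
  qed
  ultimately show "f \<in> Sigma_f (top_of_set S) mtopology" using fM unfolding Sigma_f_def by auto
qed

end

section \<open>Local connectedness of the target\<close>

context Metric_space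
begin

text \<open>The preimage of an open set is the complement of a finite set if it contains
  \<open>y\<close>, and a countable set otherwise.\<close>

lemma H1_countable_perturbation:
  fixes C S :: "real set"
  assumes "countable C" and s: "\<And>t. t \<in> C \<Longrightarrow> s t \<in> M" and "y \<in> M"
    and fin: "\<And>V. openin mtopology V \<Longrightarrow> y \<in> V \<Longrightarrow> finite {t \<in> C. s t \<notin> V}"
  shows "(\<lambda>t. if t \<in> C then s t else y) \<in> H1 (top_of_set S) mtopology"
proof -
  let ?f = "\<lambda>t. if t \<in> C then s t else y"
  have "fsigma_in (top_of_set S) {t \<in> S. ?f t \<in> V}" if V: "openin mtopology V" for V
  proof (cases "y \<in> V")
    case True
    let ?E = "{t \<in> C. s t \<notin> V}"
    have "open (- ?E)" using fin[OF V True] by (intro open_Compl finite_imp_closed)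
    then have "openin (top_of_set S) (S \<inter> - ?E)" by (rule openin_open_Int)
    moreover have "{t \<in> S. ?f t \<in> V} = S \<inter> - ?E" using True by auto
    moreover have "metrizable_space (top_of_set S)"
      by (intro metrizable_space_subtopology metrizable_space_euclidean)
    ultimately show ?thesis using open_imp_fsigma_in by metis
  next
    case False
    let ?E = "{t \<in> S. ?f t \<in> V}"
    have "?E \<subseteq> C" using False by (auto split: if_split_asm)
    then have "countable ?E" using \<open>countable C\<close> countable_subset by blast
    then have "countable ((\<lambda>t. {t}) ` ?E)" by simp
    moreover have "fsigma_in (top_of_set S) {t}" if "t \<in> ?E" for t
      using that by (intro closed_imp_fsigma_in closed_subset) auto
    ultimately have "fsigma_in (top_of_set S) (\<Union>((\<lambda>t. {t}) ` ?E))"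
      by (intro fsigma_in_Union) auto
    then show ?thesis by simp
  qed
  then show ?thesis using s \<open>y \<in> M\<close> unfolding H1_def by simp
qed

lemma limitin_eventually_in:
  assumes "limitin mtopology g l sequentially" "openin mtopology V" "l \<in> V"
  shows "\<exists>n. \<forall>m\<ge>n. g m \<in> V"
  using assms unfolding limitin_def eventually_sequentially by blast

text \<open>A map with a jump at the single point 0, from one side of a clopen set to the other, is
  in \<open>H1\<close>. If it were a limit of paths, some path would have its two ends on different
  sides.\<close>

lemma H1_subset_B1_imp_connected_space:
  assumes sub: "H1 (top_of_set {0..1::real}) mtopology \<subseteq> B1 (top_of_set {0..1::real}) mtopology"
  shows "connected_space mtopology"
  unfolding connected_space_clopen_in
proof (intro allI impI)
  fix T assume T: "openin mtopology T \<and> closedin mtopology T"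
  show "T = {} \<or> T = topspace mtopology"
  proof (rule ccontr)
    assume "\<not> ?thesis"
    moreover have "T \<subseteq> M" using T openin_subset[of mtopology T] by simp
    ultimately obtain x y where x: "x \<in> T" and y: "y \<in> M - T" by auto
    have "x \<in> M" using x \<open>T \<subseteq> M\<close> by blast
    define f where "f t = (if t \<in> {0::real} then x else y)" for t
    have "f \<in> H1 (top_of_set {0..1}) mtopology"
      unfolding f_def
    proof (rule H1_countable_perturbation[where s = "\<lambda>t. x"])
      show "finite {t \<in> {0::real}. x \<notin> V}" for V by simp
    qed (use y \<open>x \<in> M\<close> in simp_all)
    then have "f \<in> B1 (top_of_set {0..1}) mtopology" using sub by blast
    then obtain fn :: "nat \<Rightarrow> real \<Rightarrow> 'a" where cont: "\<forall>n. continuous_map (top_of_set {0..1}) mtopology (fn n)"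
      and lim: "\<forall>t\<in>{0..1}. limitin mtopology (\<lambda>n. fn n t) (f t) sequentially"
      unfolding B1_def by auto
    have "openin mtopology (M - T)" using T by (metis openin_diff openin_topspace topspace_mtopology)
    have lim0: "limitin mtopology (\<lambda>n. fn n 0) x sequentially" and lim1: "limitin mtopology (\<lambda>n. fn n 1) y sequentially"
      using lim[rule_format, of 0] lim[rule_format, of 1] by (simp_all add: f_def)
    obtain n0 where n0: "\<forall>m\<ge>n0. fn m 0 \<in> T" using limitin_eventually_in[OF lim0 conjunct1[OF T] x] by (elim exE)
    obtain n1 where n1: "\<forall>m\<ge>n1. fn m 1 \<in> M - T" using limitin_eventually_in[OF lim1 \<open>openin mtopology (M - T)\<close> y] by (elim exE)
    let ?m = "max n0 n1"
    have "connectedin (top_of_set {0..1}) {0..1::real}" by (simp add: connectedin_subtopology)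
    then have "connectedin mtopology (fn ?m ` {0..1})" using cont connectedin_continuous_map_image by blast
    then have "fn ?m ` {0..1} \<subseteq> T \<or> disjnt (fn ?m ` {0..1}) T"
      using T by (intro connectedin_clopen_cases) auto
    moreover have "fn ?m 0 \<in> T" "fn ?m 1 \<notin> T" using n0[rule_format, of ?m] n1[rule_format, of ?m] by simp_all
    moreover have "fn ?m 0 \<in> fn ?m ` {0..1}" "fn ?m 1 \<in> fn ?m ` {0..1}" by (simp_all only: imageI atLeastAtMost_iff order_refl zero_le_one conj_absorb simp_thms)
    ultimately show False unfolding disjnt_iff by (elim disjE) (metis subsetD, metis)
  qed
qed

text \<open>The clopen set of \<open>U\<close> varies with the point that it cuts off from
  \<open>y\<close>, so it is chosen only after Baire category has fixed an interval. There a path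
  \<open>fn m\<close> inside \<open>U\<close> leads from near \<open>s a\<close>, with
  \<open>a\<close> rational, to near \<open>y\<close>, at an irrational \<open>b\<close>, and would
  have to cross the clopen set.\<close>

lemma H1_subset_B1_imp_quasi_component_nbhd:
  assumes sub: "H1 (top_of_set {0..1::real}) mtopology \<subseteq> B1 (top_of_set {0..1::real}) mtopology"
    and U: "openin mtopology U" "y \<in> U"
  shows "\<exists>e>0. \<forall>z\<in>mball y e. quasi_component_of (subtopology mtopology U) y z"
proof (rule ccontr)
  assume no: "\<not> ?thesis"
  have "y \<in> M" using U openin_subset[OF U(1)] by auto
  obtain r0 where r0: "r0 > 0" "mball y r0 \<subseteq> U" using U unfolding openin_mtopology by blast
  \<comment> \<open>Halved so that the closed ball still lies in \<open>U\<close>; closed balls make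
    the sets \<open>F n\<close> below closed.\<close>
  define r where "r = r0 / 2"
  have "r > 0" using r0 by (simp add: r_def)
  have cball_sub: "mcball y r \<subseteq> U" using r0 by (auto simp: r_def subset_iff)
  have "\<forall>n. \<exists>z. z \<in> mball y (min r (1 / real (Suc n))) \<and> \<not> quasi_component_of (subtopology mtopology U) y z"
  proof
    fix n
    have "0 < min r (1 / real (Suc n))" using \<open>r > 0\<close> by simp
    then show "\<exists>z. z \<in> mball y (min r (1 / real (Suc n))) \<and> \<not> quasi_component_of (subtopology mtopology U) y z"
      using no by blast
  qed
  from choice[OF this] obtain z where z: "\<forall>n. z n \<in> mball y (min r (1 / real (Suc n))) \<and>
      \<not> quasi_component_of (subtopology mtopology U) y (z n)" by (elim exE)
  \<comment> \<open>Countable, and met together with its complement by every nondegenerate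
    subinterval of \<open>[0,1]\<close>: \<open>C\<close> supplies \<open>a\<close> and the
    complement supplies \<open>b\<close>.\<close>
  define C :: "real set" where "C = \<rat> \<inter> {0..1}"
  have "countable C" unfolding C_def by (simp add: countable_rat countable_Int1)
  define s where "s t = z (to_nat_on C t)" for t
  define f where "f t = (if t \<in> C then s t else y)" for t
  have sM: "s t \<in> mball y r" for t using z[rule_format, of "to_nat_on C t"] by (simp add: s_def)
  have "f \<in> H1 (top_of_set {0..1}) mtopology"
    unfolding f_def
  proof (rule H1_countable_perturbation[OF \<open>countable C\<close> _ \<open>y \<in> M\<close>])
    show "s t \<in> M" for t using sM[of t] by simp
    fix V assume V: "openin mtopology V" "y \<in> V"
    obtain e where e: "e > 0" "mball y e \<subseteq> V" using V unfolding openin_mtopology by blast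
    obtain n where n: "1 / real (Suc n) < e" using e(1) nat_approx_posE by blast
    have "{t \<in> C. s t \<notin> V} \<subseteq> {t \<in> C. to_nat_on C t < n}"
    proof
      fix t assume t: "t \<in> {t \<in> C. s t \<notin> V}"
      have "to_nat_on C t < n"
      proof (rule ccontr)
        assume "\<not> ?thesis"
        then have "1 / real (Suc (to_nat_on C t)) \<le> 1 / real (Suc n)" by (intro divide_left_mono) simp_all
        then have "s t \<in> mball y e" using z[rule_format, of "to_nat_on C t"] n by (simp add: s_def)
        then show False using e(2) t by blast
      qed
      then show "t \<in> {t \<in> C. to_nat_on C t < n}" using t by simp
    qed
    moreover have "finite {t \<in> C. to_nat_on C t < n}"
    proof (rule finite_imageD)
      show "finite (to_nat_on C ` {t \<in> C. to_nat_on C t < n})" by (rule finite_subset[of _ "{..<n}"]) auto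
      show "inj_on (to_nat_on C) {t \<in> C. to_nat_on C t < n}"
        using inj_on_to_nat_on[OF \<open>countable C\<close>] by (rule inj_on_subset) auto
    qed
    ultimately show "finite {t \<in> C. s t \<notin> V}" by (rule finite_subset)
  qed
  then have "f \<in> B1 (top_of_set {0..1}) mtopology" using sub by blast
  then obtain fn :: "nat \<Rightarrow> real \<Rightarrow> 'a" where cont: "\<forall>n. continuous_map (top_of_set {0..1}) mtopology (fn n)"
    and lim: "\<forall>t\<in>{0..1}. limitin mtopology (\<lambda>n. fn n t) (f t) sequentially"
    unfolding B1_def by auto
  define F where "F n = (\<Inter>m\<in>{n..}. {t \<in> {0..1}. fn m t \<in> mcball y r})" for n
  have F_iff: "t \<in> F n \<longleftrightarrow> t \<in> {0..1} \<and> (\<forall>m\<ge>n. fn m t \<in> mcball y r)" for t n unfolding F_def by auto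
  have "closed (F n)" for n
    unfolding F_def
  proof (intro closed_INT ballI)
    fix m
    have "closedin (top_of_set {0..1}) {t \<in> topspace (top_of_set {0..1}). fn m t \<in> mcball y r}"
      by (rule closedin_continuous_map_preimage[OF cont[rule_format] closedin_mcball])
    then show "closed {t \<in> {0..1}. fn m t \<in> mcball y r}"
      using closedin_closed_trans[of "{0..1::real}"] by simp
  qed
  moreover have "{0..1} \<subseteq> \<Union>(range F)"
  proof
    fix t :: real assume t: "t \<in> {0..1}"
    have "f t \<in> mball y r" using sM[of t] \<open>y \<in> M\<close> \<open>r > 0\<close> by (simp add: f_def)
    from limitin_eventually_in[OF lim[rule_format, OF t] openin_mball this]
    obtain n where "\<forall>m\<ge>n. fn m t \<in> mball y r" by (elim exE)
    then have "t \<in> F n" using t mball_subset_mcball unfolding F_iff by blast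
    then show "t \<in> \<Union>(range F)" by blast
  qed
  ultimately have "\<exists>T\<in>range F. \<exists>W. open W \<and> W \<inter> {0..1} \<noteq> {} \<and> W \<inter> {0..1} \<subseteq> T"
    by (intro Baire_closed_cover) auto
  then obtain n W where W: "open W" "W \<inter> {0..1} \<noteq> {}" "W \<inter> {0..1} \<subseteq> F n" by blast
  obtain t0 where t0: "t0 \<in> W" "0 \<le> t0" "t0 \<le> 1" using W(2) by auto
  obtain e where e: "e > 0" "ball t0 e \<subseteq> W" using W(1) t0(1) openE by blast
  \<comment> \<open>\<open>t0\<close> may be an endpoint of \<open>[0,1]\<close>; clipping keeps the
    interval inside and nondegenerate.\<close>
  define l where "l = max 0 (t0 - e / 2)"
  define u where "u = min 1 (t0 + e / 2)"
  have "l < u" using t0 e(1) by (auto simp: l_def u_def)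
  have lu: "{l..u} \<subseteq> F n"
  proof -
    have "{l..u} \<subseteq> ball t0 e" using e(1) by (auto simp: l_def u_def dist_real_def)
    moreover have "{l..u} \<subseteq> {0..1}" by (auto simp: l_def u_def)
    ultimately show ?thesis using e(2) W(3) by blast
  qed
  then have lu01: "{l..u} \<subseteq> {0..1}" unfolding F_def by auto
  obtain a where a: "a \<in> \<rat>" "l < a" "a < u" using Rats_dense_in_real[OF \<open>l < u\<close>] by blast
  then have aC: "a \<in> C" using lu01 by (auto simp: C_def subset_iff)
  have "\<not> {l<..<u} \<subseteq> C"
    using uncountable_open_interval[of l u] \<open>l < u\<close> \<open>countable C\<close> countable_subset by blast
  then obtain b where "b \<in> {l<..<u}" "b \<notin> C" by blast
  then have b: "l < b" "b < u" "b \<notin> C" by auto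
  have ab: "a \<in> {l..u}" "b \<in> {l..u}" using a b by auto
  have "\<not> quasi_component_of (subtopology mtopology U) y (s a)" using z by (simp add: s_def)
  moreover have "y \<in> topspace (subtopology mtopology U)" "s a \<in> topspace (subtopology mtopology U)"
    using U(2) \<open>y \<in> M\<close> sM[of a] cball_sub by auto
  ultimately obtain T where T: "y \<in> T" "closedin (subtopology mtopology U) T" "openin (subtopology mtopology U) T" "s a \<notin> T"
    unfolding quasi_component_of by blast
  have oT: "openin mtopology T" using openin_trans_full[OF T(3) U(1)] .
  have "openin (subtopology mtopology U) (topspace (subtopology mtopology U) - T)" using T(2) by (simp add: closedin_def)
  then have "openin mtopology (topspace (subtopology mtopology U) - T)" using openin_trans_full U(1) by blast
  moreover have "topspace (subtopology mtopology U) = U" using openin_subset[OF U(1)] by auto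
  ultimately have oUT: "openin mtopology (U - T)" by simp
  have "f b = y" "f a = s a" using aC b by (simp_all add: f_def)
  have saUT: "s a \<in> U - T" using T(4) sM[of a] cball_sub mball_subset_mcball by blast
  have limb: "limitin mtopology (\<lambda>n. fn n b) y sequentially" and lima: "limitin mtopology (\<lambda>n. fn n a) (s a) sequentially"
    using lim ab lu01 \<open>f b = y\<close> \<open>f a = s a\<close> by (metis subsetD)+
  obtain n0 where n0: "\<forall>m\<ge>n0. fn m b \<in> T" using limitin_eventually_in[OF limb oT T(1)] by (elim exE)
  obtain n1 where n1: "\<forall>m\<ge>n1. fn m a \<in> U - T" using limitin_eventually_in[OF lima oUT saUT] by (elim exE)
  define m where "m = max n (max n0 n1)"
  have "connectedin (top_of_set {0..1}) {l..u}" using lu01 by (simp add: connectedin_subtopology)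
  then have "connectedin mtopology (fn m ` {l..u})" using cont connectedin_continuous_map_image by blast
  moreover have "fn m ` {l..u} \<subseteq> U"
  proof
    fix w assume "w \<in> fn m ` {l..u}"
    then obtain t where t: "t \<in> {l..u}" "w = fn m t" by blast
    then have "t \<in> F n" using lu by blast
    moreover have "n \<le> m" by (simp add: m_def)
    ultimately have "fn m t \<in> mcball y r" using F_iff by blast
    then show "w \<in> U" using t cball_sub by blast
  qed
  ultimately have "connectedin (subtopology mtopology U) (fn m ` {l..u})" by (simp add: connectedin_subtopology)
  then have "fn m ` {l..u} \<subseteq> T \<or> disjnt (fn m ` {l..u}) T" using T(2,3) by (rule connectedin_clopen_cases)
  moreover have "fn m a \<in> fn m ` {l..u}" "fn m b \<in> fn m ` {l..u}" using ab by blast+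
  moreover have "fn m b \<in> T" "fn m a \<in> U - T" using n0 n1 by (simp_all add: m_def)
  ultimately show False unfolding disjnt_iff by (elim disjE) (metis DiffD2 subsetD, metis)
qed

text \<open>A quasi-component is always closed, and here it is also open. A clopen subset of it is
  then clopen in all of \<open>V\<close>, and no clopen subset of \<open>V\<close> splits a
  quasi-component; so it is connected and serves as the neighbourhood.\<close>

lemma H1_subset_B1_imp_locally_connected_space:
  assumes sub: "H1 (top_of_set {0..1::real}) mtopology \<subseteq> B1 (top_of_set {0..1::real}) mtopology"
  shows "locally_connected_space mtopology"
  unfolding locally_connected_space
proof (intro allI impI)
  fix V x assume "openin mtopology V \<and> x \<in> V"
  then have V: "openin mtopology V" and x: "x \<in> V" by auto
  let ?X = "subtopology mtopology V"
  let ?Q = "quasi_component_of_set ?X x"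
  have topV: "topspace ?X = V" using openin_subset[OF V] by auto
  have QV: "?Q \<subseteq> V" using quasi_component_of_subset_topspace[of ?X x] topV by simp
  have oQ: "openin mtopology ?Q"
    unfolding openin_mtopology
  proof (intro conjI allI impI)
    show "?Q \<subseteq> M" using QV openin_subset[OF V] by auto
    fix y assume y: "y \<in> ?Q"
    then have "y \<in> V" using QV by blast
    then obtain e where e: "e > 0" "\<forall>z\<in>mball y e. quasi_component_of ?X y z"
      using H1_subset_B1_imp_quasi_component_nbhd[OF sub V] by blast
    have "mball y e \<subseteq> ?Q"
    proof
      fix z assume "z \<in> mball y e"
      then have "quasi_component_of ?X y z" using e(2) by blast
      then show "z \<in> ?Q" using y quasi_component_of_trans[of ?X x y z] by simp
    qed
    then show "\<exists>r>0. mball y r \<subseteq> ?Q" using e(1) by blast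
  qed
  have "connected_space (subtopology ?X ?Q)"
    unfolding connected_space_clopen_in
  proof (intro allI impI)
    fix T assume T: "openin (subtopology ?X ?Q) T \<and> closedin (subtopology ?X ?Q) T"
    have "openin ?X ?Q" using oQ QV by (metis inf.absorb_iff2 openin_subtopology_Int2 inf_commute)
    then have oT: "openin ?X T" by (rule openin_trans_full[OF conjunct1[OF T]])
    have cT: "closedin ?X T" by (rule closedin_trans_full[OF conjunct2[OF T] closedin_quasi_component_of])
    have topQ: "topspace (subtopology ?X ?Q) = ?Q" using QV topV by auto
    then have TQ: "T \<subseteq> ?Q" using T openin_subset[of "subtopology ?X ?Q" T] by simp
    show "T = {} \<or> T = topspace (subtopology ?X ?Q)"
    proof (cases "x \<in> T")
      case True
      have "?Q \<subseteq> T"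
      proof
        fix z assume "z \<in> ?Q"
        then have "quasi_component_of ?X x z" by simp
        then show "z \<in> T" using oT cT True unfolding quasi_component_of_def by blast
      qed
      then show ?thesis using TQ topQ by blast
    next
      case False
      have "z \<notin> T" for z
      proof
        assume "z \<in> T"
        then have "quasi_component_of ?X x z" using TQ by blast
        then show False using oT cT False \<open>z \<in> T\<close> unfolding quasi_component_of_def by blast
      qed
      then show ?thesis by blast
    qed
  qed
  then have "connectedin ?X ?Q" using QV topV by (simp add: connectedin_def)
  then have "connectedin mtopology ?Q" by (simp add: connectedin_subtopology)
  moreover have "x \<in> ?Q" using x topV by simp
  ultimately show "\<exists>U. openin mtopology U \<and> connectedin mtopology U \<and> x \<in> U \<and> U \<subseteq> V"
    using oQ QV by (intro exI[of _ ?Q] conjI)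
qed

end

section \<open>Paths in complete locally connected metric spaces\<close>

context Metric_space
begin

text \<open>The witness \<open>D\<close> is open and connected so that a finer chain can be run
  inside it; refining a link thus never leaves a set of diameter at most \<open>e\<close>.\<close>

definition small_link :: "'a set \<Rightarrow> real \<Rightarrow> 'a \<Rightarrow> 'a \<Rightarrow> bool" where
  "small_link V e u v \<longleftrightarrow> (\<exists>D. D \<subseteq> V \<and> openin mtopology D \<and> connectedin mtopology D \<and>
     (\<forall>w\<in>D. \<forall>w'\<in>D. d w w' \<le> e) \<and> u \<in> D \<and> v \<in> D)"

lemma small_link_refl:
  assumes lc: "locally_connected_space mtopology" and V: "openin mtopology V" and u: "u \<in> V" and "0 < e"
  shows "small_link V e u u"
proof -
  have uM: "u \<in> M" using V u openin_subset[OF V] by auto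
  have "openin mtopology (V \<inter> mball u (e / 2))" "u \<in> V \<inter> mball u (e / 2)" using V u uM \<open>0 < e\<close> by auto
  then have "\<exists>D. openin mtopology D \<and> connectedin mtopology D \<and> u \<in> D \<and> D \<subseteq> V \<inter> mball u (e / 2)"
    by (rule lc[unfolded locally_connected_space, rule_format, OF conjI])
  then obtain D where D: "openin mtopology D" "connectedin mtopology D" "u \<in> D" "D \<subseteq> V \<inter> mball u (e / 2)"
    by (elim exE conjE)
  have "d w w' \<le> e" if "w \<in> D" "w' \<in> D" for w w'
  proof -
    have w: "w \<in> M" "w' \<in> M" "d u w < e / 2" "d u w' < e / 2" using D(4) that by auto
    then have "d w w' \<le> d w u + d u w'" using uM by (intro triangle)
    then show ?thesis using w commute[of w u] by simp
  qed
  then show ?thesis unfolding small_link_def using D by (intro exI[of _ D] conjI ballI) auto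
qed

text \<open>The points reachable from \<open>a\<close> by finitely many links and those not
  reachable both form open subsets of \<open>C\<close>, since by local connectedness each point of
  \<open>C\<close> has a neighbourhood in which any two points are linked.\<close>

lemma connected_open_chain:
  assumes lc: "locally_connected_space mtopology" and C: "openin mtopology C" "connectedin mtopology C"
    and a: "a \<in> C" and b: "b \<in> C" and "0 < e"
  shows "\<exists>k c. c 0 = a \<and> (\<forall>j\<ge>k. c j = b) \<and> (\<forall>j. c j \<in> C \<and> small_link C e (c j) (c (Suc j)))"
proof -
  define R where "R = {(u, v). small_link C e u v}"
  have refl: "\<exists>D. D \<subseteq> C \<and> openin mtopology D \<and> u \<in> D \<and> (\<forall>v\<in>D. \<forall>w\<in>D. (v, w) \<in> R)" if "u \<in> C" for u
  proof -
    have "small_link C e u u" using small_link_refl[OF lc C(1) that \<open>0 < e\<close>] .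
    then obtain D where "D \<subseteq> C" "openin mtopology D" "connectedin mtopology D" "\<forall>w\<in>D. \<forall>w'\<in>D. d w w' \<le> e" "u \<in> D"
      unfolding small_link_def by (elim exE conjE)
    then show ?thesis unfolding R_def small_link_def by (intro exI[of _ D] conjI ballI) auto
  qed
  define S where "S = {v \<in> C. (a, v) \<in> R\<^sup>*}"
  have "openin mtopology S"
  proof (subst openin_subopen, intro ballI)
    fix u assume u: "u \<in> S"
    then have "u \<in> C" by (simp add: S_def)
    from refl[OF this] obtain D where D: "D \<subseteq> C" "openin mtopology D" "u \<in> D" "\<forall>v\<in>D. \<forall>w\<in>D. (v, w) \<in> R"
      by (elim exE conjE)
    have "D \<subseteq> S"
    proof
      fix v assume v: "v \<in> D"
      have "(a, u) \<in> R\<^sup>*" using u by (simp add: S_def)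
      moreover have "(u, v) \<in> R" using D(3,4) v by blast
      ultimately have "(a, v) \<in> R\<^sup>*" by (rule rtrancl_into_rtrancl)
      then show "v \<in> S" using D(1) v by (auto simp: S_def)
    qed
    then show "\<exists>T. openin mtopology T \<and> u \<in> T \<and> T \<subseteq> S" using D(2,3) by (intro exI[of _ D] conjI)
  qed
  moreover have "openin mtopology (C - S)"
  proof (subst openin_subopen, intro ballI)
    fix u assume u: "u \<in> C - S"
    then have "u \<in> C" by simp
    from refl[OF this] obtain D where D: "D \<subseteq> C" "openin mtopology D" "u \<in> D" "\<forall>v\<in>D. \<forall>w\<in>D. (v, w) \<in> R"
      by (elim exE conjE)
    have "D \<subseteq> C - S"
    proof
      fix v assume v: "v \<in> D"
      have "v \<notin> S"
      proof
        assume "v \<in> S"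
        then have "(a, v) \<in> R\<^sup>*" by (simp add: S_def)
        moreover have "(v, u) \<in> R" using D(3,4) v by blast
        ultimately have "(a, u) \<in> R\<^sup>*" by (rule rtrancl_into_rtrancl)
        then show False using u by (simp add: S_def)
      qed
      then show "v \<in> C - S" using D(1) v by blast
    qed
    then show "\<exists>T. openin mtopology T \<and> u \<in> T \<and> T \<subseteq> C - S" using D(2,3) by (intro exI[of _ D] conjI)
  qed
  moreover have "a \<in> S" using a by (simp add: S_def)
  moreover have "C \<subseteq> S \<union> (C - S)" by blast
  moreover have "S \<inter> (C - S) \<inter> C = {}" by blast
  ultimately have "(C - S) \<inter> C = {}"
    using C(2) a unfolding connectedin by (metis disjoint_iff)
  then have "(a, b) \<in> R\<^sup>*" using b unfolding S_def by blast
  then obtain n where "(a, b) \<in> R ^^ n" using rtrancl_imp_relpow by blast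
  then obtain f where f: "f 0 = a" "f n = b" "\<forall>i<n. (f i, f (Suc i)) \<in> R" unfolding relpow_fun_conv by blast
  \<comment> \<open>Padding with \<open>b\<close> makes the chain infinite, so that chains of
    different lengths can be cut to a common length.\<close>
  define c where "c j = (if j \<le> n then f j else b)" for j
  have bb: "(b, b) \<in> R" using small_link_refl[OF lc C(1) b \<open>0 < e\<close>] by (simp add: R_def)
  have link: "(c j, c (Suc j)) \<in> R" for j
  proof -
    consider "j < n" | "j = n" | "n < j" by linarith
    then show ?thesis
    proof cases
      case 1
      then show ?thesis using f(3) by (simp add: c_def)
    next
      case 2
      then show ?thesis using bb f(2) by (simp add: c_def)
    next
      case 3
      then show ?thesis using bb by (simp add: c_def)
    qed
  qed
  then have "c j \<in> C" for j unfolding R_def small_link_def by blast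
  then show ?thesis using link f(1,2) unfolding R_def
    by (intro exI[of _ n] exI[of _ c]) (auto simp: c_def)
qed

text \<open>Each link is refined inside its own witness, so new points are within \<open>e\<close>
  of the start of the link. All links receive the same number \<open>m\<close> of steps; position
  \<open>t\<close> then lies over the old position \<open>t div m\<close>, which lets the chains be
  read as step functions on equally spaced grids.\<close>

lemma refine_chain:
  assumes lc: "locally_connected_space mtopology" and V: "openin mtopology V" and b: "b \<in> V"
    and "0 < e" "0 < e'" "0 < N"
    and x: "x 0 = a" "\<And>i. N \<le> i \<Longrightarrow> x i = b" "\<And>i. small_link V e (x i) (x (Suc i))"
  shows "\<exists>m x'. 0 < m \<and> x' 0 = a \<and> (\<forall>i\<ge>N * m. x' i = b) \<and> (\<forall>i. small_link V e' (x' i) (x' (Suc i))) \<and>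
     (\<forall>t. d (x (t div m)) (x' t) \<le> e)"
proof -
  have "\<forall>i. \<exists>k c. c 0 = x i \<and> (\<forall>j\<ge>k. c j = x (Suc i)) \<and> (\<forall>j. d (x i) (c j) \<le> e \<and> small_link V e' (c j) (c (Suc j))) \<and>
      (N \<le> i \<longrightarrow> (\<forall>j. c j = b))"
  proof
    fix i
    show "\<exists>k c. c 0 = x i \<and> (\<forall>j\<ge>k. c j = x (Suc i)) \<and> (\<forall>j. d (x i) (c j) \<le> e \<and> small_link V e' (c j) (c (Suc j))) \<and>
      (N \<le> i \<longrightarrow> (\<forall>j. c j = b))"
    proof (cases "N \<le> i")
      case True
      have "b \<in> M" using b openin_subset[OF V] by auto
      then show ?thesis using True x(2) small_link_refl[OF lc V b \<open>0 < e'\<close>] \<open>0 < e\<close>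
        by (intro exI[of _ 0] exI[of _ "\<lambda>j. b"]) simp
    next
      case False
      obtain D where D: "D \<subseteq> V" "openin mtopology D" "connectedin mtopology D"
        "\<forall>w\<in>D. \<forall>w'\<in>D. d w w' \<le> e" "x i \<in> D" "x (Suc i) \<in> D"
        using x(3)[of i] unfolding small_link_def by (elim exE conjE)
      obtain k c where kc: "c 0 = x i" "\<forall>j\<ge>k. c j = x (Suc i)" "\<forall>j. c j \<in> D \<and> small_link D e' (c j) (c (Suc j))"
        using connected_open_chain[OF lc D(2,3,5,6) \<open>0 < e'\<close>] by (elim exE conjE)
      have "small_link V e' (c j) (c (Suc j))" for j
      proof -
        have "small_link D e' (c j) (c (Suc j))" using kc(3) by simp
        then obtain D' where "D' \<subseteq> D" "openin mtopology D'" "connectedin mtopology D'"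
          "\<forall>w\<in>D'. \<forall>w'\<in>D'. d w w' \<le> e'" "c j \<in> D'" "c (Suc j) \<in> D'"
          unfolding small_link_def by (elim exE conjE)
        then show ?thesis using D(1) unfolding small_link_def by (intro exI[of _ D'] conjI) auto
      qed
      moreover have "d (x i) (c j) \<le> e" for j using D(4,5) kc(3) by simp
      ultimately show ?thesis using kc(1,2) False by (intro exI[of _ k] exI[of _ c]) simp
    qed
  qed
  from choice[OF this] obtain k where k: "\<forall>i. \<exists>c. c 0 = x i \<and> (\<forall>j\<ge>k i. c j = x (Suc i)) \<and>
     (\<forall>j. d (x i) (c j) \<le> e \<and> small_link V e' (c j) (c (Suc j))) \<and> (N \<le> i \<longrightarrow> (\<forall>j. c j = b))" by (elim exE)
  from choice[OF this] obtain c where "\<forall>i. c i 0 = x i \<and> (\<forall>j\<ge>k i. c i j = x (Suc i)) \<and>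
     (\<forall>j. d (x i) (c i j) \<le> e \<and> small_link V e' (c i j) (c i (Suc j))) \<and> (N \<le> i \<longrightarrow> (\<forall>j. c i j = b))" by (elim exE)
  then have c: "c i 0 = x i" "k i \<le> j \<Longrightarrow> c i j = x (Suc i)" "d (x i) (c i j) \<le> e"
      "small_link V e' (c i j) (c i (Suc j))" "N \<le> i \<Longrightarrow> c i j = b" for i j by simp_all
  \<comment> \<open>Links from \<open>N\<close> on are constant, so a finite sum dominates every
    length that matters; \<open>Suc\<close> keeps \<open>m\<close> positive.\<close>
  define m where "m = Suc (\<Sum>i<N. k i)"
  have "k i \<le> m" if "i < N" for i
    using member_le_sum[of i "{..<N}" k] that unfolding m_def by simp
  then have cm: "c i m = x (Suc i)" for i
    using c(2)[of i m] c(5)[of i m] x(2)[of "Suc i"] by (cases "i < N") simp_all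
  have "0 < m" by (simp add: m_def)
  define x' where "x' t = c (t div m) (t mod m)" for t
  have "x' 0 = a" using x(1) c(1) by (simp add: x'_def)
  moreover have "x' t = b" if "N * m \<le> t" for t
  proof -
    have "N \<le> t div m" using that \<open>0 < m\<close> by (simp add: less_eq_div_iff_mult_less_eq)
    then show ?thesis unfolding x'_def by (rule c(5))
  qed
  moreover have "small_link V e' (x' t) (x' (Suc t))" for t
  proof (cases "Suc (t mod m) = m")
    case True
    then have eq: "Suc t div m = Suc (t div m)" "Suc t mod m = 0"
      by (simp_all add: div_Suc mod_Suc)
    have "x' (Suc t) = c (t div m) (Suc (t mod m))" unfolding x'_def eq c(1) using cm True by simp
    then show ?thesis using c(4) by (simp add: x'_def)
  next
    case False
    then have eq: "Suc t div m = t div m" "Suc t mod m = Suc (t mod m)"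
      by (simp_all add: div_Suc mod_Suc)
    show ?thesis unfolding x'_def eq by (rule c(4))
  qed
  moreover have "d (x (t div m)) (x' t) \<le> e" for t unfolding x'_def by (rule c(3))
  ultimately show ?thesis using \<open>0 < m\<close> by (intro exI[of _ m] exI[of _ x']) simp
qed

text \<open>Chains refined for ever give step functions whose successive distances
  \<open>K n\<close> are summable. Completeness provides the uniform limit; it is continuous because
  neighbouring steps at level \<open>n\<close> differ by at most \<open>K n\<close>.\<close>

lemma path_in_connected_open:
  assumes complete: mcomplete and lc: "locally_connected_space mtopology"
    and V: "openin mtopology V" "connectedin mtopology V" "V \<subseteq> mball p r" and a: "a \<in> V" and b: "b \<in> V"
    and "0 < r"
  shows "\<exists>g. pathin mtopology g \<and> g ` {0..1} \<subseteq> mball p (6 * r) \<and> g 0 = a \<and> g 1 = b"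
proof -
  have VM: "V \<subseteq> M" using openin_subset[OF V(1)] by simp
  have "p \<in> M" using V(3) a by auto
  \<comment> \<open>\<open>K 0 = 2 * r\<close> bounds the diameter of \<open>V\<close>, which lies
    in a ball of radius \<open>r\<close>. Later levels move a point by at most
    \<open>2 * K 0 = 4 * r\<close> in all, so the path stays within \<open>5 * r\<close> of
    \<open>p\<close>, hence in the ball of radius \<open>6 * r\<close>.\<close>
  define K where "K n = 2 * r * (1/2) ^ n" for n :: nat
  have Kpos: "0 < K n" and K_Suc: "K n = 2 * K (Suc n)" for n using \<open>0 < r\<close> by (simp_all add: K_def)
  define inv where "inv n Nx \<longleftrightarrow> 0 < fst Nx \<and> snd Nx 0 = a \<and> (\<forall>i\<ge>fst Nx. snd Nx i = b) \<and>
     (\<forall>i. small_link V (K n) (snd Nx i) (snd Nx (Suc i)))" for n and Nx :: "nat \<times> (nat \<Rightarrow> 'a)"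
  define rel where "rel n Nx Nx' \<longleftrightarrow> (\<exists>m>0. fst Nx' = fst Nx * m \<and> (\<forall>t. d (snd Nx (t div m)) (snd Nx' t) \<le> K n))"
    for n and Nx Nx' :: "nat \<times> (nat \<Rightarrow> 'a)"
  have "\<exists>Nx. inv 0 Nx"
  proof
    have "d w w' \<le> K 0" if "w \<in> V" "w' \<in> V" for w w'
    proof -
      have w: "w \<in> M" "w' \<in> M" "d p w < r" "d p w' < r" using V(3) that by auto
      then have "d w w' \<le> d w p + d p w'" using \<open>p \<in> M\<close> by (intro triangle)
      then show ?thesis using w commute[of w p] by (simp add: K_def)
    qed
    then have "small_link V (K 0) u v" if "u \<in> V" "v \<in> V" for u v
      unfolding small_link_def using V that by (intro exI[of _ V] conjI ballI) auto
    then show "inv 0 (1, \<lambda>i. if i = 0 then a else b)" using a b by (simp add: inv_def)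
  qed
  moreover have "\<exists>Nx'. inv (Suc n) Nx' \<and> rel n Nx Nx'" if "inv n Nx" for n Nx
  proof -
    have i: "0 < fst Nx" "snd Nx 0 = a" "\<And>i. fst Nx \<le> i \<Longrightarrow> snd Nx i = b" "\<And>i. small_link V (K n) (snd Nx i) (snd Nx (Suc i))"
      using that by (simp_all add: inv_def)
    have "\<exists>m x'. 0 < m \<and> x' 0 = a \<and> (\<forall>i\<ge>fst Nx * m. x' i = b) \<and>
        (\<forall>i. small_link V (K (Suc n)) (x' i) (x' (Suc i))) \<and> (\<forall>t. d (snd Nx (t div m)) (x' t) \<le> K n)"
      by (rule refine_chain[where x = "snd Nx" and N = "fst Nx", OF lc V(1) b Kpos Kpos i(1,2)]) (rule i(3), assumption, rule i(4))
    then obtain m x' where mx: "0 < m" "x' 0 = a" "\<forall>i\<ge>fst Nx * m. x' i = b" "\<forall>i. small_link V (K (Suc n)) (x' i) (x' (Suc i))"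
      "\<forall>t. d (snd Nx (t div m)) (x' t) \<le> K n" by (elim exE conjE)
    show ?thesis
    proof (intro exI[of _ "(fst Nx * m, x')"] conjI)
      show "inv (Suc n) (fst Nx * m, x')" unfolding inv_def fst_conv snd_conv using mx i(1) by (intro conjI) simp_all
      show "rel n Nx (fst Nx * m, x')" unfolding rel_def fst_conv snd_conv using mx by (intro exI[of _ m] conjI) simp_all
    qed
  qed
  ultimately obtain Nx where Nx: "\<forall>n. inv n (Nx n) \<and> rel n (Nx n) (Nx (Suc n))"
    using dependent_nat_choice[of inv rel] by metis
  define N where "N n = fst (Nx n)" for n
  define x where "x n = snd (Nx n)" for n
  have N: "0 < N n" and x0: "x n 0 = a" and xN: "x n (N n) = b" and link: "small_link V (K n) (x n i) (x n (Suc i))" for n i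
    using Nx by (simp_all add: inv_def N_def x_def)
  have ref: "\<exists>m>0. N (Suc n) = N n * m \<and> (\<forall>t. d (x n (t div m)) (x (Suc n) t) \<le> K n)" for n
    using Nx by (simp add: rel_def N_def x_def)
  have xV: "x n i \<in> V" for n i using link[of n i] unfolding small_link_def by blast
  then have xM: "x n i \<in> M" for n i using VM by blast
  \<comment> \<open>At \<open>s = 1\<close> the index is exactly \<open>N n\<close>, from which on
    the chain rests at \<open>b\<close>; so both endpoints are exact at every level.\<close>
  define g where "g n s = x n (nat \<lfloor>s * real (N n)\<rfloor>)" for n s
  have gV: "g n s \<in> V" for n s unfolding g_def by (rule xV)
  then have gM: "g n s \<in> M" for n s using VM by blast
  \<comment> \<open>The finer grid has \<open>N n * m\<close> cells, so dividing the finer index by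
    \<open>m\<close> gives exactly the coarser index of the same \<open>s\<close>, rounding
    included.\<close>
  have g_Suc: "d (g n s) (g (Suc n) s) \<le> K n" for n s
  proof -
    obtain m where m: "m > 0" "N (Suc n) = N n * m" "\<forall>t. d (x n (t div m)) (x (Suc n) t) \<le> K n" using ref by blast
    have "nat \<lfloor>s * real (N (Suc n))\<rfloor> div m = nat (\<lfloor>s * real (N (Suc n))\<rfloor> div int m)"
      by (simp add: nat_div_distrib')
    also have "\<lfloor>s * real (N (Suc n))\<rfloor> div int m = \<lfloor>s * real (N (Suc n)) / real_of_int (int m)\<rfloor>"
      by (rule floor_divide_real_eq_div[symmetric]) simp
    also have "s * real (N (Suc n)) / real_of_int (int m) = s * real (N n)" using m(1,2) by simp
    finally have "nat \<lfloor>s * real (N (Suc n))\<rfloor> div m = nat \<lfloor>s * real (N n)\<rfloor>" .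
    then show ?thesis using m(3)[rule_format, of "nat \<lfloor>s * real (N (Suc n))\<rfloor>"] by (simp add: g_def)
  qed
  have tele: "d (g n s) (g (n + k) s) \<le> 2 * K n - 2 * K (n + k)" for n k s
  proof (induction k)
    case 0
    show ?case using gM by simp
  next
    case (Suc k)
    have "d (g n s) (g (n + Suc k) s) \<le> d (g n s) (g (n + k) s) + d (g (n + k) s) (g (Suc (n + k)) s)"
      using gM by (simp add: triangle)
    then show ?case using Suc g_Suc[of "n + k" s] K_Suc[of "n + k"] by simp
  qed
  have close: "d (g n s) (g m s) \<le> 2 * K n" if "n \<le> m" for n m s
    using tele[of n s "m - n"] Kpos[of m] that by simp
  have K_small: "\<exists>n. K n < e" if e: "0 < e" for e
  proof -
    have "0 < e / (2 * r)" using e \<open>0 < r\<close> by simp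
    then obtain n :: nat where "(1/2) ^ n < e / (2 * r)"
      using real_arch_pow_inv[of "e / (2 * r)" "1/2"] by auto
    then have "K n < e" using \<open>0 < r\<close> by (simp add: K_def field_simps)
    then show ?thesis by blast
  qed
  have "\<forall>s. \<exists>l. limitin mtopology (\<lambda>n. g n s) l sequentially"
  proof
    fix s
    have "MCauchy (\<lambda>n. g n s)"
      unfolding MCauchy_def
    proof (intro conjI allI impI)
      show "range (\<lambda>n. g n s) \<subseteq> M" using gM by blast
      fix e :: real assume "0 < e"
      then obtain n where n: "K n < e / 4" using K_small[of "e / 4"] by auto
      have "d (g i s) (g j s) < e" if "n \<le> i" "n \<le> j" for i j
      proof -
        have "d (g i s) (g j s) \<le> d (g i s) (g n s) + d (g n s) (g j s)" using gM by (intro triangle)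
        then show ?thesis using close[OF that(1), of s] close[OF that(2), of s] n commute[of "g i s"] by simp
      qed
      then show "\<exists>n. \<forall>i j. n \<le> i \<longrightarrow> n \<le> j \<longrightarrow> d (g i s) (g j s) < e" by blast
    qed
    then show "\<exists>l. limitin mtopology (\<lambda>n. g n s) l sequentially" using complete unfolding mcomplete_def by simp
  qed
  from choice[OF this] obtain h where h: "\<forall>s. limitin mtopology (\<lambda>n. g n s) (h s) sequentially" by (elim exE)
  have hM: "h s \<in> M" for s using h unfolding limitin_metric by simp
  have gh: "d (g n s) (h s) \<le> 2 * K n" for n s
  proof (rule field_le_epsilon)
    fix e :: real assume "0 < e"
    from h[rule_format, of s, unfolded limitin_metric] this
    have "\<forall>\<^sub>F m in sequentially. g m s \<in> M \<and> d (g m s) (h s) < e" by blast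
    then obtain m0 where m0: "\<forall>m\<ge>m0. g m s \<in> M \<and> d (g m s) (h s) < e" unfolding eventually_sequentially ..
    let ?m = "max n m0"
    have "d (g n s) (h s) \<le> d (g n s) (g ?m s) + d (g ?m s) (h s)" using gM hM by (intro triangle)
    moreover have "d (g ?m s) (h s) < e" using m0 by simp
    ultimately show "d (g n s) (h s) \<le> 2 * K n + e" using close[of n ?m s] by simp
  qed
  have ends: "h s = c" if "\<And>n. g n s = c" for s c
  proof (rule ccontr)
    assume "h s \<noteq> c"
    have "c \<in> M" using gM[of 0 s] that by simp
    then have "0 < d c (h s)" using hM[of s] \<open>h s \<noteq> c\<close> mdist_pos_eq by metis
    then obtain n where "K n < d c (h s) / 2" using K_small[of "d c (h s) / 2"] by auto
    then show False using gh[of n s] that[of n] by simp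
  qed
  have "continuous_map (top_of_set {0..1}) mtopology h"
    unfolding continuous_map_to_metric
  proof (intro ballI allI impI)
    fix s :: real and e :: real
    assume "s \<in> topspace (top_of_set {0..1})" and "0 < e"
    then have s: "0 \<le> s" by simp
    \<comment> \<open>Twice \<open>2 * K n\<close> for passing between \<open>g n\<close> and the
      limit, and \<open>K n\<close> for the step between neighbouring cells.\<close>
    obtain n where n: "K n < e / 5" using K_small[of "e / 5"] \<open>0 < e\<close> by auto
    have osc: "d (g n s) (g n t) \<le> K n" if "0 \<le> t" "\<bar>t - s\<bar> < 1 / real (N n)" for t
    proof -
      let ?i = "nat \<lfloor>s * real (N n)\<rfloor>" and ?j = "nat \<lfloor>t * real (N n)\<rfloor>"
      have "\<bar>t - s\<bar> * real (N n) < 1" using that(2) N[of n] by (simp add: field_simps)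
      then have "\<bar>t * real (N n) - s * real (N n)\<bar> < 1" by (simp add: abs_mult flip: left_diff_distrib)
      then have "\<bar>\<lfloor>t * real (N n)\<rfloor> - \<lfloor>s * real (N n)\<rfloor>\<bar> \<le> 1" by linarith
      then have "?j = ?i \<or> ?j = Suc ?i \<or> ?i = Suc ?j" by linarith
      moreover have "d (x n i) (x n (Suc i)) \<le> K n" for i using link[of n i] unfolding small_link_def by blast
      ultimately show ?thesis unfolding g_def using Kpos[of n] xM commute
        by (metis less_imp_le mdist_zero)
    qed
    let ?U = "{0..1} \<inter> ball s (1 / real (N n))"
    have "h t \<in> mball (h s) e" if t: "t \<in> ?U" for t
    proof -
      have "0 \<le> t" "\<bar>t - s\<bar> < 1 / real (N n)" using t by (auto simp: dist_real_def)
      then have "d (g n s) (g n t) \<le> K n" by (rule osc)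
      moreover have "d (h s) (h t) \<le> d (h s) (g n s) + d (g n s) (h t)" "d (g n s) (h t) \<le> d (g n s) (g n t) + d (g n t) (h t)"
        using gM hM by (simp_all add: triangle)
      ultimately have "d (h s) (h t) < e" using gh[of n s] gh[of n t] n commute[of "h s" "g n s"] by simp
      then show ?thesis using hM by simp
    qed
    moreover have "openin (top_of_set {0..1}) ?U" by (intro openin_open_Int) simp
    moreover have "s \<in> ?U" using \<open>s \<in> topspace (top_of_set {0..1})\<close> N[of n] by simp
    ultimately show "\<exists>U. openin (top_of_set {0..1}) U \<and> s \<in> U \<and> (\<forall>t\<in>U. h t \<in> mball (h s) e)"
      by (intro exI[of _ ?U] conjI ballI)
  qed
  then have "pathin mtopology h" by (simp add: pathin_def)
  moreover have "h ` {0..1} \<subseteq> mball p (6 * r)"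
  proof
    fix z assume "z \<in> h ` {0..1}"
    then obtain s where s: "z = h s" by blast
    have "d p (g 0 s) < r" using V(3) gV[of 0 s] by auto
    moreover have "d p (h s) \<le> d p (g 0 s) + d (g 0 s) (h s)" using \<open>p \<in> M\<close> gM hM by (intro triangle)
    ultimately have "d p (h s) < 6 * r" using gh[of 0 s] \<open>0 < r\<close> by (simp add: K_def)
    then show "z \<in> mball p (6 * r)" using s hM \<open>p \<in> M\<close> by simp
  qed
  moreover have "h 0 = a" by (rule ends) (simp add: g_def x0)
  moreover have "h 1 = b" by (rule ends) (simp add: g_def xN)
  ultimately show ?thesis by blast
qed

text \<open>The path part of the Mazurkiewicz-Moore-Menger theorem.\<close>

lemma mcomplete_locally_connected_imp_locally_path_connected:
  assumes mcomplete "locally_connected_space mtopology"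
  shows "locally_path_connected_space mtopology"
  unfolding locally_path_connected_space_im_kleinen
proof (intro allI impI)
  fix W p assume W: "openin mtopology W \<and> p \<in> W"
  then obtain s where s: "s > 0" "mball p s \<subseteq> W" unfolding openin_mtopology by blast
  \<comment> \<open>The factor 6 by which \<open>path_in_connected_open\<close> enlarges the
    ball.\<close>
  define r where "r = s / 6"
  have r: "r > 0" "mball p (6 * r) \<subseteq> W" using s by (simp_all add: r_def)
  have "p \<in> M" using W openin_subset[of mtopology W] by auto
  then have "openin mtopology (mball p r)" "p \<in> mball p r" using r by simp_all
  then obtain V where V: "openin mtopology V" "connectedin mtopology V" "p \<in> V" "V \<subseteq> mball p r"
    using assms(2)[unfolded locally_connected_space, rule_format, OF conjI] by metis
  have "\<exists>C. path_connectedin mtopology C \<and> C \<subseteq> W \<and> p \<in> C \<and> y \<in> C" if y: "y \<in> V" for y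
  proof -
    obtain g where g: "pathin mtopology g" "g ` {0..1} \<subseteq> mball p (6 * r)" "g 0 = p" "g 1 = y"
      using path_in_connected_open[OF assms V(1,2,4,3) y r(1)] by (elim exE conjE)
    have "path_connectedin mtopology (g ` {0..1})" using g(1) by (rule path_connectedin_path_image)
    moreover have "p \<in> g ` {0..1}" "y \<in> g ` {0..1}" using g(3,4) by (metis atLeastAtMost_iff imageI order_refl zero_le_one)+
    ultimately show ?thesis using g(2) r(2) by (intro exI[of _ "g ` {0..1}"] conjI) auto
  qed
  moreover have "V \<subseteq> W"
  proof -
    have "mball p r \<subseteq> mball p (6 * r)" using r(1) by (intro mball_subset_concentric) simp
    then show ?thesis using V(4) r(2) by blast
  qed
  ultimately have "openin mtopology V \<and> p \<in> V \<and> V \<subseteq> W \<and>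
      (\<forall>y\<in>V. \<exists>C. path_connectedin mtopology C \<and> C \<subseteq> W \<and> p \<in> C \<and> y \<in> C)"
    using V(1,3) by simp
  then show "\<exists>U. openin mtopology U \<and> p \<in> U \<and> U \<subseteq> W \<and>
      (\<forall>y\<in>U. \<exists>C. path_connectedin mtopology C \<and> C \<subseteq> W \<and> p \<in> C \<and> y \<in> C)"
    by (rule exI)
qed

end

section \<open>From paths to arcs\<close>

context Metric_space
begin

text \<open>Kuratowski embedding: \<^term>\<open>x\<close> goes to the bounded function \<open>d x - d p\<close>. The discrete copy of the type
  turns arbitrary bounded functions into bounded continuous ones.\<close>

lemma exists_isometric_embedding:
  "\<exists>\<phi> :: 'a \<Rightarrow> ('a discrete \<Rightarrow>\<^sub>C real). \<forall>x\<in>M. \<forall>y\<in>M. dist (\<phi> x) (\<phi> y) = d x y"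
proof (cases "M = {}")
  case False
  then obtain p where p: "p \<in> M" by blast
  define f where "f x z = (if of_discrete z \<in> M then d x (of_discrete z) - d p (of_discrete z) else 0)" for x z
  have "f x \<in> bcontfun" if x: "x \<in> M" for x
  proof -
    have "\<bar>f x z\<bar> \<le> d x p" for z
    proof (cases "of_discrete z \<in> M")
      case True
      then have "d x (of_discrete z) \<le> d x p + d p (of_discrete z)" "d p (of_discrete z) \<le> d p x + d x (of_discrete z)"
        using x p by (simp_all add: triangle)
      then show ?thesis using True commute[of x p] by (simp add: f_def)
    qed (simp add: f_def)
    then have "bounded (range (f x))" by (intro boundedI[of _ "d x p"]) auto
    moreover have "continuous_on UNIV (f x)" by (simp add: continuous_on_open_vimage open_discrete)
    ultimately show ?thesis by (simp add: bcontfun_def)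
  qed
  then have app: "apply_bcontfun (Bcontfun (f x)) = f x" if "x \<in> M" for x
    using that by (simp add: Bcontfun_inverse)
  have "dist (Bcontfun (f x)) (Bcontfun (f y)) = d x y" if x: "x \<in> M" and y: "y \<in> M" for x y
  proof (rule antisym)
    show "dist (Bcontfun (f x)) (Bcontfun (f y)) \<le> d x y"
    proof (rule dist_bound)
      fix z
      show "dist (Bcontfun (f x) z) (Bcontfun (f y) z) \<le> d x y"
      proof (cases "of_discrete z \<in> M")
        case True
        then have "d x (of_discrete z) \<le> d x y + d y (of_discrete z)" "d y (of_discrete z) \<le> d y x + d x (of_discrete z)"
          using x y by (simp_all add: triangle)
        then show ?thesis unfolding app[OF x] app[OF y] using True commute[of x y]
          by (simp add: f_def dist_real_def)
      qed (simp add: app[OF x] app[OF y] f_def)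
    qed
    have "dist (f x (discrete y)) (f y (discrete y)) = d x y"
      using y by (simp add: f_def discrete_inverse dist_real_def)
    then show "d x y \<le> dist (Bcontfun (f x)) (Bcontfun (f y))"
      using dist_bounded[of "Bcontfun (f x)" "discrete y" "Bcontfun (f y)"] app[OF x] app[OF y] by simp
  qed
  then show ?thesis by (intro exI[of _ "\<lambda>x. Bcontfun (f x)"] ballI)
qed simp

text \<open>\<open>path_contains_arc\<close> is applied in the Banach space of bounded functions.
  The arc found there lies in the image of the path, hence in the range of the embedding, so \<psi>
  brings it back into the image of \<open>g\<close>.\<close>

lemma pathin_imp_embedded_arc:
  assumes g: "pathin mtopology g" "g 0 \<noteq> g 1"
  shows "\<exists>h. embedding_map (top_of_set {0..1::real}) (subtopology mtopology (g ` {0..1})) h \<and> h 0 = g 0 \<and> h 1 = g 1"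
proof -
  obtain \<phi> :: "'a \<Rightarrow> ('a discrete \<Rightarrow>\<^sub>C real)" where \<phi>: "\<forall>x\<in>M. \<forall>y\<in>M. dist (\<phi> x) (\<phi> y) = d x y"
    using exists_isometric_embedding by (elim exE)
  interpret E: Metric_space12 M d "UNIV :: ('a discrete \<Rightarrow>\<^sub>C real) set" dist
    by (simp add: Metric_space12_def Metric_space_axioms Met_TC.Metric_space_axioms)
  have "embedding_map mtopology Met_TC.mtopology \<phi>"
    by (rule E.isometry_imp_embedding_map) (use \<phi> in auto)
  then have "homeomorphic_map mtopology (top_of_set (\<phi> ` M)) \<phi>" by (simp add: embedding_map_def)
  then obtain \<psi> where "homeomorphic_maps mtopology (top_of_set (\<phi> ` M)) \<phi> \<psi>"
    unfolding homeomorphic_map_maps by (elim exE)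
  then have c\<phi>: "continuous_map mtopology (top_of_set (\<phi> ` M)) \<phi>"
    and c\<psi>: "continuous_map (top_of_set (\<phi> ` M)) mtopology \<psi>"
    and \<psi>\<phi>: "\<And>x. x \<in> M \<Longrightarrow> \<psi> (\<phi> x) = x"
    by (simp_all add: homeomorphic_maps_def)
  have gM: "g t \<in> M" if "t \<in> {0..1}" for t
    using g(1) that by (auto simp: pathin_def continuous_map_def)
  have "continuous_map (top_of_set {0..1}) (top_of_set (\<phi> ` M)) (\<phi> \<circ> g)"
    by (rule continuous_map_compose[OF g(1)[unfolded pathin_def] c\<phi>])
  then have "path (\<phi> \<circ> g)" by (simp add: path_def continuous_map_in_subtopology)
  moreover have "\<phi> (g 0) \<noteq> \<phi> (g 1)" using \<psi>\<phi>[OF gM[of 0]] \<psi>\<phi>[OF gM[of 1]] g(2) by auto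
  ultimately obtain q where q: "arc q" "path_image q \<subseteq> path_image (\<phi> \<circ> g)" "pathstart q = \<phi> (g 0)" "pathfinish q = \<phi> (g 1)"
    using path_contains_arc[of "\<phi> \<circ> g" "\<phi> (g 0)" "\<phi> (g 1)"] by (auto simp: pathstart_def pathfinish_def)
  have qg: "\<exists>s\<in>{0..1}. q t = \<phi> (g s)" if "t \<in> {0..1}" for t
  proof -
    have "q t \<in> path_image q" unfolding path_image_def using that by (rule imageI)
    then have "q t \<in> (\<phi> \<circ> g) ` {0..1}" using q(2) unfolding path_image_def by blast
    then show ?thesis by auto
  qed
  have q_im: "q t \<in> \<phi> ` M" if "t \<in> {0..1}" for t using qg[OF that] gM by blast
  have \<phi>\<psi>: "\<phi> (\<psi> z) = z" if "z \<in> \<phi> ` M" for z using that \<psi>\<phi> by auto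
  define h where "h = \<psi> \<circ> q"
  have "continuous_on {0..1} q" using q(1) by (simp add: arc_def path_def)
  then have "continuous_map (top_of_set {0..1}) (top_of_set (\<phi> ` M)) q"
    using q_im by (auto simp: continuous_map_in_subtopology)
  then have cont: "continuous_map (top_of_set {0..1}) mtopology h" unfolding h_def using c\<psi> by (rule continuous_map_compose)
  have "inj_on h {0..1}"
  proof (rule inj_onI)
    fix s t :: real assume st: "s \<in> {0..1}" "t \<in> {0..1}" "h s = h t"
    then have "\<phi> (\<psi> (q s)) = \<phi> (\<psi> (q t))" by (simp add: h_def)
    then have "q s = q t" using \<phi>\<psi> q_im st(1,2) by simp
    then show "s = t" using q(1) st(1,2) by (simp add: arc_def inj_on_def)
  qed
  moreover have "closed_map (top_of_set {0..1}) mtopology h"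
    by (rule continuous_imp_closed_map_gen[OF _ Hausdorff_imp_kc_space[OF Hausdorff_space_mtopology] cont])
      (simp add: compact_space_subtopology)
  ultimately have "embedding_map (top_of_set {0..1}) mtopology h" using cont by (simp add: injective_closed_imp_embedding_map)
  moreover have "h t \<in> g ` {0..1}" if t: "t \<in> {0..1}" for t
  proof -
    obtain s where s: "s \<in> {0..1}" "q t = \<phi> (g s)" using qg[OF t] by blast
    then have "h t = g s" using \<psi>\<phi>[OF gM] by (simp add: h_def)
    then show ?thesis using s(1) by blast
  qed
  moreover have "h 0 = g 0" "h 1 = g 1"
    using q(3,4) \<psi>\<phi>[OF gM[of 0]] \<psi>\<phi>[OF gM[of 1]] by (simp_all add: h_def pathstart_def pathfinish_def)
  ultimately show ?thesis by (intro exI[of _ h]) (auto simp: embedding_map_in_subtopology)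
qed

lemma path_connectedin_imp_arc_connectedin:
  assumes "path_connectedin mtopology S"
  shows "arc_connectedin mtopology S"
  unfolding arc_connectedin_def
proof (intro conjI ballI impI)
  show "S \<subseteq> topspace mtopology" using assms by (simp add: path_connectedin_def)
  fix x y assume xy: "x \<in> S" "y \<in> S" "x \<noteq> y"
  have "path_connected_space (subtopology mtopology S)" "S \<subseteq> M" using assms by (simp_all add: path_connectedin_def)
  then obtain g where g: "pathin (subtopology mtopology S) g" "g 0 = x" "g 1 = y"
    using xy unfolding path_connected_space_def by (metis Int_absorb1 topspace_mtopology topspace_subtopology)
  have gS: "g ` {0..1} \<subseteq> S" and "pathin mtopology g" using g(1) by (auto simp: pathin_subtopology)
  have "g 0 \<noteq> g 1" using g xy by simp
  from pathin_imp_embedded_arc[OF \<open>pathin mtopology g\<close> this] obtain h where h: "embedding_map (top_of_set {0..1::real}) (subtopology mtopology (g ` {0..1})) h"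
    "h 0 = g 0" "h 1 = g 1"
    by (elim exE conjE)
  have "embedding_map (top_of_set {0..1::real}) mtopology h" "h ` {0..1} \<subseteq> g ` {0..1}"
    using h(1) unfolding embedding_map_in_subtopology by simp_all
  then have "embedding_map (top_of_set {0..1::real}) (subtopology mtopology S) h"
    unfolding embedding_map_in_subtopology using order_trans[OF _ gS] by simp
  then show "\<exists>g. embedding_map (top_of_set {0..1::real}) (subtopology mtopology S) g \<and> g 0 = x \<and> g 1 = y"
    using h(2,3) g(2,3) by (intro exI[of _ h]) simp
qed

end

lemma arc_connectedin_imp_path_connectedin:
  assumes "arc_connectedin Y S"
  shows "path_connectedin Y S"
  unfolding path_connectedin_def path_connected_space_def
proof (intro conjI ballI)
  show S: "S \<subseteq> topspace Y" using assms by (simp add: arc_connectedin_def)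
  fix x y assume "x \<in> topspace (subtopology Y S)" "y \<in> topspace (subtopology Y S)"
  then have xy: "x \<in> S" "y \<in> S" by auto
  show "\<exists>g. pathin (subtopology Y S) g \<and> g 0 = x \<and> g 1 = y"
  proof (cases "x = y")
    case True
    then show ?thesis using xy S by (intro exI[of _ "\<lambda>t. x"]) auto
  next
    case False
    from assms[unfolded arc_connectedin_def, THEN conjunct2, rule_format, OF xy this]
    obtain g where g: "embedding_map (top_of_set {0..1::real}) (subtopology Y S) g" "g 0 = x" "g 1 = y"
      by (elim exE conjE)
    then have "continuous_map (top_of_set {0..1}) (subtopology Y S) g"
      unfolding embedding_map_def by (metis continuous_map_in_subtopology homeomorphic_imp_continuous_map)
    then show ?thesis using g by (intro exI[of _ g]) (simp add: pathin_def)
  qed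
qed

lemma (in Metric_space) locally_arc_connected_space_iff:
  "locally_arc_connected_space mtopology \<longleftrightarrow> locally_path_connected_space mtopology"
  unfolding locally_arc_connected_space_def locally_path_connected_space_def
  by (intro iffI; erule neighbourhood_base_of_mono)
    (rule arc_connectedin_imp_path_connectedin path_connectedin_imp_arc_connectedin, assumption)+

section \<open>The characterization\<close>

context Metric_space
begin

lemma K1_Sigma_f_eq_B1:
  assumes "connected_space mtopology" "locally_arc_connected_space mtopology"
  shows "K1 X mtopology \<inter> Sigma_f X mtopology = B1 X mtopology"
proof -
  have lpc: "locally_path_connected_space mtopology" using assms(2) by (simp add: locally_arc_connected_space_iff)
  then have "path_connected_space mtopology" using assms(1) by (simp add: path_connected_eq_connected_space)
  then show ?thesis using K1_Sigma_f_subset_B1[OF _ lpc] B1_subset_K1 B1_subset_Sigma_f by blast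
qed

lemma H1_unit_interval_eq:
  "H1 (top_of_set {0..1::real}) mtopology =
     K1 (top_of_set {0..1::real}) mtopology \<inter> Sigma_f (top_of_set {0..1::real}) mtopology"
  using H1_top_of_set_eq_K1[of "{0..1::real}" mtopology] H1_subset_Sigma_f[of "{0..1::real}"] by auto

lemma H1_eq_B1_imp_connected_locally_arc_connected:
  assumes mcomplete and "H1 (top_of_set {0..1::real}) mtopology = B1 (top_of_set {0..1::real}) mtopology"
  shows "connected_space mtopology \<and> locally_arc_connected_space mtopology"
proof -
  have sub: "H1 (top_of_set {0..1::real}) mtopology \<subseteq> B1 (top_of_set {0..1::real}) mtopology"
    using assms(2) by simp
  show ?thesis
    unfolding locally_arc_connected_space_iff
    using H1_subset_B1_imp_connected_space[OF sub]
      mcomplete_locally_connected_imp_locally_path_connected[OF assms(1) H1_subset_B1_imp_locally_connected_space[OF sub]]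
    by (rule conjI)
qed

end

text \<open>A quantifier over spaces ranges over the topologies on one type. The passage from (i) to
  (ii) is stated for an arbitrary type \<open>'a\<close>; for the way back topologies on
  \<open>real\<close> suffice, since the interval is one of them.\<close>

theorem mainTheorem14:
  fixes Y :: "'b topology"
  assumes "completely_metrizable_space Y"
  shows "((connected_space Y \<and> locally_arc_connected_space Y) \<longleftrightarrow>
            H1 (top_of_set {0..1::real}) Y = B1 (top_of_set {0..1::real}) Y)
       \<and> ((connected_space Y \<and> locally_arc_connected_space Y) \<longrightarrow>
            (\<forall>X :: 'a topology. K1 X Y \<inter> Sigma_f X Y = B1 X Y))
       \<and> ((\<forall>X :: real topology. K1 X Y \<inter> Sigma_f X Y = B1 X Y) \<longrightarrow>
            (connected_space Y \<and> locally_arc_connected_space Y))"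
proof -
  obtain M d where Md: "Metric_space M d" "Metric_space.mcomplete M d" "Y = Metric_space.mtopology M d"
    using assms unfolding completely_metrizable_space_def by (elim exE conjE)
  interpret Metric_space M d by (rule Md(1))
  let ?I = "top_of_set {0..1::real}"
  \<comment> \<open>On the unit interval the left-hand sides of (ii) and (iii) coincide, so both
    implications back to (i) reduce to \<open>i\<close>.\<close>
  have H1: "H1 ?I Y = K1 ?I Y \<inter> Sigma_f ?I Y" unfolding Md(3) by (rule H1_unit_interval_eq)
  have i: "connected_space Y \<and> locally_arc_connected_space Y" if "H1 ?I Y = B1 ?I Y"
    using that unfolding Md(3) by (rule H1_eq_B1_imp_connected_locally_arc_connected[OF Md(2)])
  show ?thesis
  proof (intro conjI[OF iffI conjI[OF impI impI]] allI)
    show "H1 ?I Y = B1 ?I Y" if "connected_space Y \<and> locally_arc_connected_space Y"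
      unfolding H1 using that unfolding Md(3) by (elim conjE) (rule K1_Sigma_f_eq_B1)
    show "connected_space Y \<and> locally_arc_connected_space Y" if "H1 ?I Y = B1 ?I Y"
      by (rule i[OF that])
    show "K1 X Y \<inter> Sigma_f X Y = B1 X Y" if "connected_space Y \<and> locally_arc_connected_space Y"
      for X :: "'a topology"
      using that unfolding Md(3) by (elim conjE) (rule K1_Sigma_f_eq_B1)
    show "connected_space Y \<and> locally_arc_connected_space Y"
      if "\<forall>X :: real topology. K1 X Y \<inter> Sigma_f X Y = B1 X Y"
      by (rule i) (simp add: H1 that)
  qed
qed

end
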